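(* Let $R$ be an associative ring with identity and pseudo-involution, let $(V,B,\mathfrak L)$ be an odd quadratic space over $R$, and let $n\geq5$ be an integer or $n=\infty$. Suppose that $$\mathrm{K_2U}(2n,R,\mathfrak L)\subseteq\mathrm{Cent}(\mathrm{StU}(2n,R,\mathfrak L))$$ (this holds, for example, when the natural map $\mathrm{K_2U}(2n-2,R,\mathfrak L)\to\mathrm{K_2U}(2n,R,\mathfrak L)$ is surjective, or when $n=\infty$). Then $$\mathrm{K_2U}(2n,R,\mathfrak L)=\mathrm M(\mathrm{EU}(2n,R,\mathfrak L)),$$ i.e. $\mathrm{K_2U}(2n,R,\mathfrak L)$ is the Schur multiplier of the odd hyperbolic elementary group $\mathrm{EU}(2n,R,\mathfrak L)$.
   Context: Odd quadratic spaces. A pseudo-involution on an associative ring $R$ with identity is an additive map $\overline{\phantom a}:R\to R$ such that $\overline 1$ is invertible, $\overline{\overline a}=a$ and $\overline{ab}=\overline b\,\overline1^{-1}\overline a$. An anti-Hermitian form on a right $R$-module $V$ is a biadditive map $B:V\times V\to R$ with $B(ua,vb)=\overline a\,\overline1^{-1}B(u,v)b$ and $B(u,v)=-\overline{B(v,u)}$. The Heisenberg group $\mathfrak H$ of $B$ is the set $V\times R$ with group law $(u,a)\dotplus(v,b)=(u+v,\,a+b+B(u,v))$; inverses are $\dot-(u,a)=(-u,-a+B(u,u))$. $R$ acts on $\mathfrak H$ on the right by $(u,a)\leftharpoonup b=(ub,\,\overline b\,\overline1^{-1}ab)$. An odd form parameter is a subgroup $\mathfrak L\leq\mathfrak H$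 stable under the action of $R$ with $\mathfrak L_{\min}\leq\mathfrak L\leq\mathfrak L_{\max}$, where $\mathfrak L_{\min}=\{(0,a+\overline a)\mid a\in R\}$ and $\mathfrak L_{\max}=\{(u,a)\mid a=\overline a+B(u,u)\}$. The triple $(V,B,\mathfrak L)$ is called an odd quadratic space. Odd unitary Steinberg group. For an integer $n\ge3$ put $\Omega=\{1,\dots,n,-n,\dots,-1\}$, and $\varepsilon_i=\overline1^{-1}$ for $i>0$, $\varepsilon_i=-1$ for $i<0$. Commutators are $[x,y]=xyx^{-1}y^{-1}$. $\mathrm{StU}(2n,R,\mathfrak L)$ is the group with generators $X_{ij}(a)$ ($i,j\in\Omega$, $i\notin\{\pm j\}$, $a\in R$) and $X_i(\xi)$ ($i\in\Omega$, $\xi\in\mathfrak L$), and relations (for all indices and parameters for which the symbols are defined): (R0) $X_{ij}(a)=X_{-j,-i}(\varepsilon_{-j}\overline a\varepsilon_i)$; (R1) $X_{ij}(a)X_{ij}(b)=X_{ij}(a+b)$; (R2) $X_i(\xi)X_i(\zeta)=X_i(\xi\dotplus\zeta)$; (R3) $[X_{ij}(a),X_{hk}(b)]=1$ for $h\notin\{j,-i\}$, $k\notin\{i,-j\}$; (R4) $[X_i(\xi),X_{jk}(a)]=1$ for $j\ne-i$, $k\neq i$; (R5) $[X_{ij}(a),X_{jk}(b)]=X_{ik}(ab)$; (R6) $[X_i(u,a),X_j(v,b)]=X_{i,-j}(\varepsilon_iB(u,v))$ for $i\notin\{\pm j\}$; (R7) $[X_i(u,a),X_i(v,b)]=X_i(0,B(u,v)-B(v,u))$;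 (R8) $[X_i(u,a),X_{-i,j}(b)]=X_{ij}(\varepsilon_iab)\,X_{-j}((u,-\overline a)\leftharpoonup b)$; (R9) $[X_{ij}(a),X_{j,-i}(b)]=X_i(0,-\varepsilon_{-i}\overline1ab+\overline b\,\overline1^{-1}\overline a\varepsilon_i)$. Elementary group. Let $H^n$ be the free right $R$-module with basis $e_1,\dots,e_n,e_{-n},\dots,e_{-1}$ and the anti-Hermitian form with $(e_i,e_{-i})=1$ for $1\le i\le n$ (so $(e_{-i},e_i)=-\overline1$) and $(e_i,e_j)=0$ for $j\ne-i$. On the orthogonal sum $H^n\oplus V$, with form $(\cdot,\cdot)$ equal to the sum of this form and $B$, define the elementary transvections, for $i\in\Omega$, $j\in\Omega\setminus\{\pm i\}$, $a\in R$, $(u,b)\in\mathfrak L$, by $$T_{ij}(a):w\mapsto w+e_{-j}\varepsilon_{-j}\overline a\,\overline1^{-1}(e_i,w)-e_ia\varepsilon_j(e_{-j},w),$$ $$T_i(u,b):w\mapsto w-e_i\varepsilon_i(u,w)-e_i\varepsilon_ib\varepsilon_{-i}(e_i,w)+u\varepsilon_{-i}(e_i,w).$$ These are bijective isometries of $H^n\oplus V$, and $\mathrm{EU}(2n,R,\mathfrak L)$ is the group they generate. There is a natural epimorphism $\mathrm{StU}(2n,R,\mathfrak L)\to\mathrm{EU}(2n,R,\mathfrak L)$, $X_{ij}(a)\mapsto T_{ij}(a)$, $X_i(\xi)\mapsto T_i(\xi)$; its kernel is $\mathrm{K_2U}(2n,R,\mathfrak L)$. Stabilization. The map $\mathrm{StU}(2n,R,\mathfrak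 L)\to\mathrm{StU}(2n+2,R,\mathfrak L)$ sends $X_{ij}(a)\mapsto X_{ij}(a)$, $X_i(\xi)\mapsto X_i(\xi)$; it is compatible with the inclusion $\mathrm{EU}(2n,R,\mathfrak L)\to\mathrm{EU}(2n+2,R,\mathfrak L)$ and induces the natural map $\mathrm{K_2U}(2n,R,\mathfrak L)\to\mathrm{K_2U}(2n+2,R,\mathfrak L)$. For $n=\infty$ the groups $\mathrm{StU}$, $\mathrm{EU}$, $\mathrm{K_2U}$ are the direct limits over these maps, written also $\mathrm{StU}(R,\mathfrak L)$, $\mathrm{EU}(R,\mathfrak L)$, $\mathrm{K_2U}(R,\mathfrak L)$. $\mathrm{Cent}$ denotes the center. Schur multiplier. A central extension of a group $G$ is an epimorphism $\epsilon:H\to G$ whose kernel lies in the center of $H$. A central extension $\pi:U\to G$ is universal if for every central extension $\epsilon:H\to G$ there is a unique homomorphism $\eta:U\to H$ with $\epsilon\eta=\pi$. Such $\pi$ exists exactly when $G$ is perfect, and then the Schur multiplier is $\mathrm M(G)=\mathrm{Ker}(\pi)$, well defined up to isomorphism. The groups $\mathrm{StU}(2n,R,\mathfrak L)$, and hence their images $\mathrm{EU}(2n,R,\mathfrak L)$, are perfect. *)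

theory Defs
  imports
    "HOL-Algebra.Coset"
    "HOL-Algebra.Bij"
    "HOL-Algebra.Generated_Groups"
    "HOL-Library.Function_Algebras"
    "HOL-Library.Product_Plus"
begin

section \<open>Central extensions\<close>

definition center :: "('a, 'm) monoid_scheme \<Rightarrow> 'a set"
  where "center G = {z \<in> carrier G. \<forall>x \<in> carrier G. z \<otimes>\<^bsub>G\<^esub> x = x \<otimes>\<^bsub>G\<^esub> z}"

definition central_extension :: "'h monoid \<Rightarrow> 'g monoid \<Rightarrow> ('h \<Rightarrow> 'g) \<Rightarrow> bool"
  where "central_extension H G \<epsilon> \<longleftrightarrow>
    group H \<and> group G \<and> \<epsilon> \<in> epi H G \<and> kernel H G \<epsilon> \<subseteq> center H"

text \<open>Universality refers to the central extensions \<open>H\<close> of \<open>G\<close> whose elements have the type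
  given by the first argument. In the notion of a universal central extension this type is
  arbitrary. Homomorphisms are made extensional, so that uniqueness concerns only the values on
  the carrier.\<close>

definition universal_central_extension ::
    "'h itself \<Rightarrow> 'u monoid \<Rightarrow> 'g monoid \<Rightarrow> ('u \<Rightarrow> 'g) \<Rightarrow> bool"
  where "universal_central_extension _ U G \<pi> \<longleftrightarrow>
    central_extension U G \<pi> \<and>
    (\<forall>(H :: 'h monoid) \<epsilon>. central_extension H G \<epsilon> \<longrightarrow>
      (\<exists>!\<eta>. \<eta> \<in> hom U H \<inter> extensional (carrier U) \<and>
            (\<forall>x \<in> carrier U. \<epsilon> (\<eta> x) = \<pi> x)))"

text \<open>\<open>K\<close> is the Schur multiplier of \<open>G\<close>: it is the kernel of the universal central
  extension \<open>p\<close>, and it is isomorphic to the kernel of every universal central extension of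
  \<open>G\<close>. For such an extension \<open>U\<close> only universality with respect to the
  element types of \<open>U\<close> and \<open>E\<close> is demanded, which is weaker than universality for all types.\<close>

definition schur_multiplier ::
    "'h itself \<Rightarrow> 'u itself \<Rightarrow> 'a set \<Rightarrow> 'a monoid \<Rightarrow> 'g monoid \<Rightarrow> ('a \<Rightarrow> 'g) \<Rightarrow> bool"
  where "schur_multiplier _ _ K E G p \<longleftrightarrow>
    universal_central_extension TYPE('h) E G p \<and>
    K = kernel E G p \<and>
    (\<forall>(U :: 'u monoid) \<pi>.
       universal_central_extension TYPE('u) U G \<pi> \<and>
       universal_central_extension TYPE('a) U G \<pi> \<longrightarrow>
       E\<lparr>carrier := K\<rparr> \<cong> U\<lparr>carrier := kernel U G \<pi>\<rparr>)"


section \<open>Groups given by generators and relations\<close>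

datatype 'g letter = Pos 'g | Neg 'g

type_synonym 'g word = "'g letter list"

primrec inv_letter :: "'g letter \<Rightarrow> 'g letter"
  where
    "inv_letter (Pos g) = Neg g"
  | "inv_letter (Neg g) = Pos g"

definition letters :: "'g set \<Rightarrow> 'g letter set"
  where "letters S = Pos ` S \<union> Neg ` S"

definition comm_word :: "'g \<Rightarrow> 'g \<Rightarrow> 'g word"
  where "comm_word x y = [Pos x, Pos y, Neg x, Neg y]"

text \<open>A relation is a pair of words, to be made equal. Pairs involving generators outside
  \<open>S\<close> are ignored.\<close>

inductive word_eq :: "'g set \<Rightarrow> ('g word \<Rightarrow> 'g word \<Rightarrow> bool) \<Rightarrow> 'g word \<Rightarrow> 'g word \<Rightarrow> bool"
  for S :: "'g set" and rel :: "'g word \<Rightarrow> 'g word \<Rightarrow> bool"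
  where
    refl: "w \<in> lists (letters S) \<Longrightarrow> word_eq S rel w w"
  | sym: "word_eq S rel v w \<Longrightarrow> word_eq S rel w v"
  | trans: "word_eq S rel u v \<Longrightarrow> word_eq S rel v w \<Longrightarrow> word_eq S rel u w"
  | cancel: "u \<in> lists (letters S) \<Longrightarrow> v \<in> lists (letters S) \<Longrightarrow> l \<in> letters S \<Longrightarrow>
      word_eq S rel (u @ [l, inv_letter l] @ v) (u @ v)"
  | relation: "u \<in> lists (letters S) \<Longrightarrow> v \<in> lists (letters S) \<Longrightarrow>
      x \<in> lists (letters S) \<Longrightarrow> y \<in> lists (letters S) \<Longrightarrow> rel x y \<Longrightarrow>
      word_eq S rel (u @ x @ v) (u @ y @ v)"

definition word_rel :: "'g set \<Rightarrow> ('g word \<Rightarrow> 'g word \<Rightarrow> bool) \<Rightarrow> ('g word \<times> 'g word) set"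
  where "word_rel S rel = {(v, w). word_eq S rel v w}"

definition presented_group :: "'g set \<Rightarrow> ('g word \<Rightarrow> 'g word \<Rightarrow> bool) \<Rightarrow> 'g word set monoid"
  where "presented_group S rel =
    \<lparr>carrier = lists (letters S) // word_rel S rel,
     mult = (\<lambda>A B. \<Union>v \<in> A. \<Union>w \<in> B. word_rel S rel `` {v @ w}),
     one = word_rel S rel `` {[]}\<rparr>"

fun eval_word :: "('a, 'm) monoid_scheme \<Rightarrow> ('g \<Rightarrow> 'a) \<Rightarrow> 'g word \<Rightarrow> 'a"
  where
    "eval_word G f [] = \<one>\<^bsub>G\<^esub>"
  | "eval_word G f (Pos g # w) = f g \<otimes>\<^bsub>G\<^esub> eval_word G f w"
  | "eval_word G f (Neg g # w) = inv\<^bsub>G\<^esub> (f g) \<otimes>\<^bsub>G\<^esub> eval_word G f w"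

text \<open>The homomorphism from a presented group to \<open>G\<close> which extends \<open>f\<close>, where \<open>f\<close> respects
  the defining relations.\<close>

definition presented_lift :: "('a, 'm) monoid_scheme \<Rightarrow> ('g \<Rightarrow> 'a) \<Rightarrow> 'g word set \<Rightarrow> 'a"
  where "presented_lift G f A = the_elem (eval_word G f ` A)"


section \<open>Direct limits of sequences of groups\<close>

primrec transition :: "(nat \<Rightarrow> 'a \<Rightarrow> 'a) \<Rightarrow> nat \<Rightarrow> nat \<Rightarrow> 'a \<Rightarrow> 'a"
  where
    "transition f m 0 = id"
  | "transition f m (Suc d) = f (m + d) \<circ> transition f m d"

definition direct_limit_rel ::
    "(nat \<Rightarrow> 'a monoid) \<Rightarrow> (nat \<Rightarrow> 'a \<Rightarrow> 'a) \<Rightarrow> ((nat \<times> 'a) \<times> (nat \<times> 'a)) set"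
  where "direct_limit_rel G f =
    {((m, x), (n, y)). x \<in> carrier (G m) \<and> y \<in> carrier (G n) \<and>
       (\<exists>k. m \<le> k \<and> n \<le> k \<and> transition f m (k - m) x = transition f n (k - n) y)}"

definition direct_limit ::
    "(nat \<Rightarrow> 'a monoid) \<Rightarrow> (nat \<Rightarrow> 'a \<Rightarrow> 'a) \<Rightarrow> (nat \<times> 'a) set monoid"
  where "direct_limit G f =
    \<lparr>carrier = (SIGMA n:UNIV. carrier (G n)) // direct_limit_rel G f,
     mult = (\<lambda>A B. \<Union>(m, x) \<in> A. \<Union>(n, y) \<in> B. direct_limit_rel G f ``
       {(max m n,
         transition f m (max m n - m) x \<otimes>\<^bsub>G (max m n)\<^esub> transition f n (max m n - n) y)}),
     one = direct_limit_rel G f `` {(0, \<one>\<^bsub>G 0\<^esub>)}\<rparr>"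

text \<open>The map of direct limits induced by maps \<open>h n\<close>, where \<open>G\<close> and \<open>f\<close> belong to the target.\<close>

definition direct_limit_map ::
    "(nat \<Rightarrow> 'b monoid) \<Rightarrow> (nat \<Rightarrow> 'b \<Rightarrow> 'b) \<Rightarrow> (nat \<Rightarrow> 'a \<Rightarrow> 'b) \<Rightarrow>
     (nat \<times> 'a) set \<Rightarrow> (nat \<times> 'b) set"
  where "direct_limit_map G f h A = direct_limit_rel G f `` ((\<lambda>(n, x). (n, h n x)) ` A)"


section \<open>Odd quadratic spaces\<close>

text \<open>The sort \<open>{ring, monoid_mult}\<close> consists of the associative rings with identity; the
  class \<open>ring_1\<close> would exclude the zero ring.\<close>

definition ring_inverse :: "'r::{ring,monoid_mult} \<Rightarrow> 'r"
  where "ring_inverse a = (THE b. a * b = 1 \<and> b * a = 1)"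

locale pseudo_involution =
  fixes bar :: "'r::{ring,monoid_mult} \<Rightarrow> 'r"
  assumes bar_add: "bar (a + b) = bar a + bar b"
    and bar_one_invertible: "\<exists>c. bar 1 * c = 1 \<and> c * bar 1 = 1"
    and bar_bar: "bar (bar a) = a"
    and bar_mult: "bar (a * b) = bar b * ring_inverse (bar 1) * bar a"

locale right_module =
  fixes act :: "'v::ab_group_add \<Rightarrow> 'r::{ring,monoid_mult} \<Rightarrow> 'v"
  assumes act_add_left: "act (u + v) a = act u a + act v a"
    and act_add_right: "act u (a + b) = act u a + act u b"
    and act_mult: "act u (a * b) = act (act u a) b"
    and act_one: "act u 1 = u"

locale anti_hermitian_form = pseudo_involution bar + right_module act
  for bar :: "'r::{ring,monoid_mult} \<Rightarrow> 'r"
    and act :: "'v::ab_group_add \<Rightarrow> 'r \<Rightarrow> 'v" +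
  fixes B :: "'v \<Rightarrow> 'v \<Rightarrow> 'r"
  assumes form_add_left: "B (u + v) w = B u w + B v w"
    and form_add_right: "B u (v + w) = B u v + B u w"
    and form_act: "B (act u a) (act v b) = bar a * ring_inverse (bar 1) * B u v * b"
    and form_anti: "B u v = - bar (B v u)"

definition heisenberg :: "('v::ab_group_add \<Rightarrow> 'v \<Rightarrow> 'r::{ring,monoid_mult}) \<Rightarrow> ('v \<times> 'r) monoid"
  where "heisenberg B =
    \<lparr>carrier = UNIV,
     mult = (\<lambda>(u, a) (v, b). (u + v, a + b + B u v)),
     one = (0, 0)\<rparr>"

definition heisenberg_act ::
    "('r::{ring,monoid_mult} \<Rightarrow> 'r) \<Rightarrow> ('v \<Rightarrow> 'r \<Rightarrow> 'v) \<Rightarrow> 'v \<times> 'r \<Rightarrow> 'r \<Rightarrow> 'v \<times> 'r"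
  where "heisenberg_act bar act \<xi> b =
    (act (fst \<xi>) b, bar b * ring_inverse (bar 1) * snd \<xi> * b)"

definition L_min :: "('r::{ring,monoid_mult} \<Rightarrow> 'r) \<Rightarrow> ('v::ab_group_add \<times> 'r) set"
  where "L_min bar = {(0, a + bar a) | a. True}"

definition L_max ::
    "('r::{ring,monoid_mult} \<Rightarrow> 'r) \<Rightarrow> ('v::ab_group_add \<Rightarrow> 'v \<Rightarrow> 'r) \<Rightarrow> ('v \<times> 'r) set"
  where "L_max bar B = {(u, a). a = bar a + B u u}"

locale odd_quadratic_space = anti_hermitian_form bar act B
  for bar :: "'r::{ring,monoid_mult} \<Rightarrow> 'r"
    and act :: "'v::ab_group_add \<Rightarrow> 'r \<Rightarrow> 'v"
    and B :: "'v \<Rightarrow> 'v \<Rightarrow> 'r" +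
  fixes L :: "('v \<times> 'r) set"
  assumes param_subgroup: "subgroup L (heisenberg B)"
    and param_act: "\<xi> \<in> L \<Longrightarrow> heisenberg_act bar act \<xi> b \<in> L"
    and param_min: "L_min bar \<subseteq> L"
    and param_max: "L \<subseteq> L_max bar B"


section \<open>Steinberg and elementary groups\<close>

definition Omega :: "nat \<Rightarrow> int set"
  where "Omega n = {i. i \<noteq> 0 \<and> \<bar>i\<bar> \<le> int n}"

text \<open>\<open>X2 i j a\<close> is \<open>X\<^sub>i\<^sub>j(a)\<close> and \<open>X1 i \<xi>\<close> is \<open>X\<^sub>i(\<xi>)\<close>.\<close>

datatype ('r, 'v) steinberg_gen = X2 int int 'r | X1 int "'v \<times> 'r"

type_synonym ('r, 'v) stu_elem = "('r, 'v) steinberg_gen word set"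

text \<open>Vectors of the orthogonal sum of \<open>H\<^sup>n\<close> and \<open>V\<close> are pairs consisting of a coordinate
  function, supported in \<open>Omega n\<close>, and an element of \<open>V\<close>. Addition is componentwise.\<close>

type_synonym ('r, 'v) hyp_vec = "(int \<Rightarrow> 'r) \<times> 'v"

type_synonym ('r, 'v) eu_elem = "('r, 'v) hyp_vec \<Rightarrow> ('r, 'v) hyp_vec"

definition hyp_space :: "nat \<Rightarrow> ('r::zero, 'v) hyp_vec set"
  where "hyp_space n = {w. \<forall>i. i \<notin> Omega n \<longrightarrow> fst w i = 0}"

definition basis_vec :: "int \<Rightarrow> ('r::{ring,monoid_mult}, 'v::ab_group_add) hyp_vec"
  where "basis_vec i = ((\<lambda>k. if k = i then 1 else 0), 0)"

definition embed_vec :: "'v \<Rightarrow> ('r::{ring,monoid_mult}, 'v::ab_group_add) hyp_vec"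
  where "embed_vec u = (0, u)"

definition hyp_trunc :: "nat \<Rightarrow> ('r::{ring,monoid_mult}, 'v::ab_group_add) hyp_vec \<Rightarrow> ('r, 'v) hyp_vec"
  where "hyp_trunc n w = ((\<lambda>k. if k \<in> Omega n then fst w k else 0), snd w)"

text \<open>The inclusion of \<open>EU(2n)\<close> into \<open>EU(2n+2)\<close>: act by \<open>g\<close> on the sum of \<open>H\<^sup>n\<close> and \<open>V\<close>
  and trivially on the orthogonal complement.\<close>

definition eu_stab ::
    "nat \<Rightarrow> ('r::{ring,monoid_mult}, 'v::ab_group_add) eu_elem \<Rightarrow> ('r, 'v) eu_elem"
  where "eu_stab n g =
    restrict (\<lambda>w. g (hyp_trunc n w) + (w - hyp_trunc n w)) (hyp_space (Suc n))"

context odd_quadratic_space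
begin

definition eps :: "int \<Rightarrow> 'r"
  where "eps i = (if i > 0 then ring_inverse (bar 1) else - 1)"

definition steinberg_gens :: "nat \<Rightarrow> ('r, 'v) steinberg_gen set"
  where "steinberg_gens n =
    {X2 i j a | i j a. i \<in> Omega n \<and> j \<in> Omega n \<and> i \<notin> {j, -j}} \<union>
    {X1 i \<xi> | i \<xi>. i \<in> Omega n \<and> \<xi> \<in> L}"

text \<open>The indices and parameters are unrestricted here apart from the explicit side conditions,
  because \<open>presented_group\<close> retains only the relations in which all symbols are defined.\<close>

inductive steinberg_rel ::
    "('r, 'v) steinberg_gen word \<Rightarrow> ('r, 'v) steinberg_gen word \<Rightarrow> bool"
  where
    R0: "steinberg_rel [Pos (X2 i j a)] [Pos (X2 (-j) (-i) (eps (-j) * bar a * eps i))]"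
  | R1: "steinberg_rel [Pos (X2 i j a), Pos (X2 i j b)] [Pos (X2 i j (a + b))]"
  | R2: "steinberg_rel [Pos (X1 i \<xi>), Pos (X1 i \<zeta>)] [Pos (X1 i (\<xi> \<otimes>\<^bsub>heisenberg B\<^esub> \<zeta>))]"
  | R3: "h \<notin> {j, -i} \<Longrightarrow> k \<notin> {i, -j} \<Longrightarrow>
      steinberg_rel (comm_word (X2 i j a) (X2 h k b)) []"
  | R4: "j \<noteq> -i \<Longrightarrow> k \<noteq> i \<Longrightarrow>
      steinberg_rel (comm_word (X1 i \<xi>) (X2 j k a)) []"
  | R5: "steinberg_rel (comm_word (X2 i j a) (X2 j k b)) [Pos (X2 i k (a * b))]"
  | R6: "i \<notin> {j, -j} \<Longrightarrow>
      steinberg_rel (comm_word (X1 i (u, a)) (X1 j (v, b))) [Pos (X2 i (-j) (eps i * B u v))]"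
  | R7: "steinberg_rel (comm_word (X1 i (u, a)) (X1 i (v, b))) [Pos (X1 i (0, B u v - B v u))]"
  | R8: "steinberg_rel (comm_word (X1 i (u, a)) (X2 (-i) j b))
      [Pos (X2 i j (eps i * a * b)), Pos (X1 (-j) (heisenberg_act bar act (u, - bar a) b))]"
  | R9: "steinberg_rel (comm_word (X2 i j a) (X2 j (-i) b))
      [Pos (X1 i (0, - (eps (-i) * bar 1 * a * b) +
                     bar b * ring_inverse (bar 1) * bar a * eps i))]"

definition StU :: "nat \<Rightarrow> ('r, 'v) stu_elem monoid"
  where "StU n = presented_group (steinberg_gens n) steinberg_rel"

definition gram :: "int \<Rightarrow> int \<Rightarrow> 'r"
  where "gram i j = (if j = - i then if i > 0 then 1 else - bar 1 else 0)"

definition hyp_form :: "nat \<Rightarrow> ('r, 'v) hyp_vec \<Rightarrow> ('r, 'v) hyp_vec \<Rightarrow> 'r"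
  where "hyp_form n w z =
    (\<Sum>i \<in> Omega n. \<Sum>j \<in> Omega n. bar (fst w i) * ring_inverse (bar 1) * gram i j * fst z j) +
    B (snd w) (snd z)"

definition hyp_act :: "('r, 'v) hyp_vec \<Rightarrow> 'r \<Rightarrow> ('r, 'v) hyp_vec"
  where "hyp_act w a = ((\<lambda>k. fst w k * a), act (snd w) a)"

definition T2 :: "nat \<Rightarrow> int \<Rightarrow> int \<Rightarrow> 'r \<Rightarrow> ('r, 'v) eu_elem"
  where "T2 n i j a = restrict
    (\<lambda>w. w + hyp_act (basis_vec (-j))
               (eps (-j) * bar a * ring_inverse (bar 1) * hyp_form n (basis_vec i) w)
           - hyp_act (basis_vec i) (a * eps j * hyp_form n (basis_vec (-j)) w))
    (hyp_space n)"

definition T1 :: "nat \<Rightarrow> int \<Rightarrow> 'v \<times> 'r \<Rightarrow> ('r, 'v) eu_elem"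
  where "T1 n i = (\<lambda>(u, b). restrict
    (\<lambda>w. w - hyp_act (basis_vec i) (eps i * hyp_form n (embed_vec u) w)
           - hyp_act (basis_vec i) (eps i * b * eps (-i) * hyp_form n (basis_vec i) w)
           + hyp_act (embed_vec u) (eps (-i) * hyp_form n (basis_vec i) w))
    (hyp_space n))"

definition gen_T :: "nat \<Rightarrow> ('r, 'v) steinberg_gen \<Rightarrow> ('r, 'v) eu_elem"
  where "gen_T n g = (case g of X2 i j a \<Rightarrow> T2 n i j a | X1 i \<xi> \<Rightarrow> T1 n i \<xi>)"

definition EU :: "nat \<Rightarrow> ('r, 'v) eu_elem monoid"
  where "EU n = subgroup_generated (BijGroup (hyp_space n)) (gen_T n ` steinberg_gens n)"

definition proj :: "nat \<Rightarrow> ('r, 'v) stu_elem \<Rightarrow> ('r, 'v) eu_elem"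
  where "proj n = presented_lift (EU n) (gen_T n)"

definition K2U :: "nat \<Rightarrow> ('r, 'v) stu_elem set"
  where "K2U n = kernel (StU n) (EU n) (proj n)"

definition stu_stab :: "nat \<Rightarrow> ('r, 'v) stu_elem \<Rightarrow> ('r, 'v) stu_elem"
  where "stu_stab n = presented_lift (StU (Suc n))
    (\<lambda>g. word_rel (steinberg_gens (Suc n)) steinberg_rel `` {[Pos g]})"

text \<open>The limits are taken over \<open>n \<ge> 3\<close>, hence the shift of the index.\<close>

definition StU_inf :: "(nat \<times> ('r, 'v) stu_elem) set monoid"
  where "StU_inf = direct_limit (\<lambda>k. StU (k + 3)) (\<lambda>k. stu_stab (k + 3))"

definition EU_inf :: "(nat \<times> ('r, 'v) eu_elem) set monoid"
  where "EU_inf = direct_limit (\<lambda>k. EU (k + 3)) (\<lambda>k. eu_stab (k + 3))"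

definition proj_inf :: "(nat \<times> ('r, 'v) stu_elem) set \<Rightarrow> (nat \<times> ('r, 'v) eu_elem) set"
  where "proj_inf =
    direct_limit_map (\<lambda>k. EU (k + 3)) (\<lambda>k. eu_stab (k + 3)) (\<lambda>k. proj (k + 3))"

text \<open>The direct limit of the groups \<open>K2U n\<close>, as a subset of the direct limit of the groups
  \<open>StU n\<close>.\<close>

definition K2U_inf :: "(nat \<times> ('r, 'v) stu_elem) set set"
  where "K2U_inf =
    {direct_limit_rel (\<lambda>k. StU (k + 3)) (\<lambda>k. stu_stab (k + 3)) `` {(k, x)} | k x. x \<in> K2U (k + 3)}"

end

end

theory Submission
  imports Defs
begin

text \<open>
  Write \<open>x\<^sub>i\<^sub>j(a)\<close> and \<open>x\<^sub>i(\<xi>)\<close> for the images of the Steinberg generators in the elementary group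
  \<open>EU\<close>. The Steinberg group is perfect, so once the kernel of \<open>StU \<rightarrow> EU\<close> is central it is enough to
  show that, for every central extension \<open>\<epsilon> : H \<rightarrow> EU\<close>, the \<open>x\<close> lift to elements \<open>y\<close> of \<open>H\<close> that
  satisfy the Steinberg relations: the presentation then yields the homomorphism \<open>StU \<rightarrow> H\<close>, and
  perfectness makes it unique (\<open>universal_central_extensionI\<close>). The Schur multiplier is the kernel
  of any universal central extension (\<open>schur_multiplier_kernel\<close>).

  The lifts exist because a commutator in \<open>H\<close> depends only on the images of its entries
  (\<open>commutator_eq_cl\<close>). With at least five hyperbolic planes, any two root elements whose
  commutator is prescribed leave one plane free; writing one of them as a commutator through that
  plane shows that root elements commuting in \<open>EU\<close> by a Steinberg relation have commuting lifts
  (\<open>cc_x2_x2\<close>, \<open>cc_x1_x2\<close>). A form of the Hall--Witt identity (\<open>cl_hall\<close>) then shows that the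
  commutator of \<open>x\<^sub>i\<^sub>j(a)\<close> and \<open>x\<^sub>j\<^sub>k(b)\<close> in \<open>H\<close> depends only on \<open>i\<close>, \<open>k\<close> and \<open>a b\<close>; it is the lift
  \<open>y\<^sub>i\<^sub>k(a b)\<close>. A long root element is obtained by solving the relation R8 with \<open>b = 1\<close> for its last
  factor, which involves an auxiliary index. The relation R9 for these elements comes first
  (\<open>y1_via_nu\<close>), then R8 (\<open>cl_x1_x2_via_any\<close>), and R8 in turn gives independence of the auxiliary
  index (\<open>y1_via_eq\<close>). The result is \<open>lifted_family\<close>.

  Centrality is a separate argument. Let \<open>z\<close> in the kernel come from rank \<open>n\<close>, and let \<open>m\<close> be one of
  the two new indices in rank \<open>n + 1\<close>. The radical generated by all \<open>x\<^sub>m\<^sub>j(a)\<close> and \<open>x\<^sub>m(\<xi>)\<close> is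
  normalized by everything that comes from rank \<open>n\<close>, and it maps injectively to \<open>EU\<close>, since the
  parameters of a normal form can be read off from the action on basis vectors
  (\<open>proj_injective_on_radical\<close>). Hence \<open>z\<close> centralizes both radicals, which together generate the
  Steinberg group (\<open>central_if_normalizes\<close>). In the direct limit every element of the kernel is of
  this kind, so there the kernel is always central.

  Everything up to the lifting of relations is carried out for an arbitrary set of indices closed
  under sign, so that the same statement serves finite rank and, with all nonzero integers as
  indices, the direct limit.
\<close>

section \<open>Groups given by generators and relations\<close>

text \<open>Relations in which symbols outside \<open>S\<close> occur impose no condition, in agreement with
  \<open>word_eq\<close>.\<close>

definition satisfies ::
    "'g set \<Rightarrow> ('g word \<Rightarrow> 'g word \<Rightarrow> bool) \<Rightarrow> ('a, 'm) monoid_scheme \<Rightarrow> ('g \<Rightarrow> 'a) \<Rightarrow> bool"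
  where "satisfies S rel G f \<longleftrightarrow> f ` S \<subseteq> carrier G \<and>
    (\<forall>v \<in> lists (letters S). \<forall>w \<in> lists (letters S). rel v w \<longrightarrow> eval_word G f v = eval_word G f w)"

lemma inv_letter_in_letters: "l \<in> letters S \<Longrightarrow> inv_letter l \<in> letters S"
  by (auto simp: letters_def)

lemma inv_letter_inv_letter [simp]: "inv_letter (inv_letter l) = l"
  by (cases l) auto

lemma Pos_in_letters [simp]: "Pos g \<in> letters S \<longleftrightarrow> g \<in> S"
  and Neg_in_letters [simp]: "Neg g \<in> letters S \<longleftrightarrow> g \<in> S"
  by (auto simp: letters_def)

lemma letters_cases:
  assumes "l \<in> letters S"
  obtains g where "g \<in> S" "l = Pos g" | g where "g \<in> S" "l = Neg g"
  using assms by (auto simp: letters_def)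

lemma word_eq_in_lists:
  "word_eq S rel v w \<Longrightarrow> v \<in> lists (letters S) \<and> w \<in> lists (letters S)"
  by (induction rule: word_eq.induct) (simp_all add: inv_letter_in_letters)

lemma word_eq_append_left:
  assumes "word_eq S rel v w" "u \<in> lists (letters S)"
  shows "word_eq S rel (u @ v) (u @ w)"
  using assms
proof (induction rule: word_eq.induct)
  case (cancel u' v l)
  then show ?case using word_eq.cancel[of "u @ u'" S v l rel] by simp
next
  case (relation u' v x y)
  then show ?case using word_eq.relation[of "u @ u'" S v x y rel] by simp
next
  case (refl w)
  then show ?case by (intro word_eq.refl) simp
qed (blast intro: word_eq.intros)+

lemma word_eq_append_right:
  assumes "word_eq S rel v w" "u \<in> lists (letters S)"
  shows "word_eq S rel (v @ u) (w @ u)"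
  using assms
proof (induction rule: word_eq.induct)
  case (cancel u' v l)
  then show ?case using word_eq.cancel[of "u'" S "v @ u" l rel] by simp
next
  case (relation u' v x y)
  then show ?case using word_eq.relation[of "u'" S "v @ u" x y rel] by simp
next
  case (refl w)
  then show ?case by (intro word_eq.refl) simp
qed (blast intro: word_eq.intros)+

lemma word_eq_append:
  assumes "word_eq S rel v v'" "word_eq S rel w w'"
  shows "word_eq S rel (v @ w) (v' @ w')"
  using word_eq_append_left[OF assms(2)] word_eq_append_right[OF assms(1)]
    word_eq_in_lists[OF assms(1)] word_eq_in_lists[OF assms(2)] word_eq.trans
  by metis

lemma equiv_word_rel: "equiv (lists (letters S)) (word_rel S rel)"
proof (rule equivI)
  show "word_rel S rel \<subseteq> lists (letters S) \<times> lists (letters S)"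
    by (auto simp only: word_rel_def dest: word_eq_in_lists)
  show "refl_on (lists (letters S)) (word_rel S rel)"
    unfolding refl_on_def word_rel_def by (blast intro: word_eq.refl)
  show "sym (word_rel S rel)"
    unfolding sym_def word_rel_def by (blast intro: word_eq.sym)
  show "trans (word_rel S rel)"
    unfolding trans_def word_rel_def by (blast intro: word_eq.trans)
qed

abbreviation word_class ::
    "'g set \<Rightarrow> ('g word \<Rightarrow> 'g word \<Rightarrow> bool) \<Rightarrow> 'g word \<Rightarrow> 'g word set"
  where "word_class S rel w \<equiv> word_rel S rel `` {w}"

lemma word_class_eq_iff:
  assumes "v \<in> lists (letters S)" "w \<in> lists (letters S)"
  shows "word_class S rel v = word_class S rel w \<longleftrightarrow> word_eq S rel v w"
  using eq_equiv_class_iff[OF equiv_word_rel assms] by (simp add: word_rel_def)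

lemma presented_group_carrierE:
  assumes "A \<in> carrier (presented_group S rel)"
  obtains w where "w \<in> lists (letters S)" "A = word_class S rel w"
  using assms by (auto simp: presented_group_def elim!: quotientE)

lemma word_class_in_carrier:
  "w \<in> lists (letters S) \<Longrightarrow> word_class S rel w \<in> carrier (presented_group S rel)"
  by (simp add: presented_group_def quotientI)

lemma presented_group_mult:
  assumes "v \<in> lists (letters S)" "w \<in> lists (letters S)"
  shows "word_class S rel v \<otimes>\<^bsub>presented_group S rel\<^esub> word_class S rel w = word_class S rel (v @ w)"
proof -
  have *: "word_class S rel (v' @ w') = word_class S rel (v @ w)"
    if "word_eq S rel v v'" "word_eq S rel w w'" for v' w'
    using that word_eq_append[OF that] word_eq_in_lists[OF that(1)] word_eq_in_lists[OF that(2)]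
    by (subst word_class_eq_iff) (auto intro: word_eq.sym)
  have "word_eq S rel v v" "word_eq S rel w w" using assms by (auto intro: word_eq.refl)
  then have "(\<Union>v' \<in> word_class S rel v. \<Union>w' \<in> word_class S rel w. word_class S rel (v' @ w'))
      = word_class S rel (v @ w)"
    unfolding word_rel_def Image_singleton_iff using * unfolding word_rel_def by blast
  then show ?thesis by (simp add: presented_group_def)
qed

lemma presented_group_one: "\<one>\<^bsub>presented_group S rel\<^esub> = word_class S rel []"
  by (simp add: presented_group_def)

definition inv_word :: "'g word \<Rightarrow> 'g word"
  where "inv_word w = rev (map inv_letter w)"

lemma inv_word_in_lists: "w \<in> lists (letters S) \<Longrightarrow> inv_word w \<in> lists (letters S)"
  by (auto simp: inv_word_def inv_letter_in_letters)

lemma word_eq_inv_word: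
  assumes "w \<in> lists (letters S)"
  shows "word_eq S rel (inv_word w @ w) []"
  using assms
proof (induction w)
  case Nil
  then show ?case by (simp add: inv_word_def word_eq.refl)
next
  case (Cons l w)
  have "word_eq S rel (inv_word w @ [inv_letter l, inv_letter (inv_letter l)] @ w) (inv_word w @ w)"
  proof (rule word_eq.cancel)
    show "w \<in> lists (letters S)" "inv_letter l \<in> letters S"
      using Cons by (auto simp: inv_letter_in_letters)
    then show "inv_word w \<in> lists (letters S)" by (simp add: inv_word_in_lists)
  qed
  then show ?case using Cons by (auto simp: inv_word_def intro: word_eq.trans)
qed

lemma group_presented_group: "group (presented_group S rel)"
proof (rule groupI)
  let ?P = "presented_group S rel"
  show "\<one>\<^bsub>?P\<^esub> \<in> carrier ?P" by (simp add: presented_group_one word_class_in_carrier)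
  fix x assume "x \<in> carrier ?P"
  then obtain u where u: "u \<in> lists (letters S)" "x = word_class S rel u"
    by (rule presented_group_carrierE)
  show "\<one>\<^bsub>?P\<^esub> \<otimes>\<^bsub>?P\<^esub> x = x" using u by (simp add: presented_group_one presented_group_mult)
  show "\<exists>y\<in>carrier ?P. y \<otimes>\<^bsub>?P\<^esub> x = \<one>\<^bsub>?P\<^esub>"
  proof (rule bexI[of _ "word_class S rel (inv_word u)"])
    have "word_eq S rel (inv_word u @ u) []" using u word_eq_inv_word by blast
    then show "word_class S rel (inv_word u) \<otimes>\<^bsub>?P\<^esub> x = \<one>\<^bsub>?P\<^esub>"
      using u inv_word_in_lists[OF u(1)]
      by (simp add: presented_group_one presented_group_mult word_class_eq_iff)
  qed (use u inv_word_in_lists[OF u(1)] in \<open>simp add: word_class_in_carrier\<close>)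
  fix y assume "y \<in> carrier ?P"
  then obtain v where v: "v \<in> lists (letters S)" "y = word_class S rel v"
    by (rule presented_group_carrierE)
  show "x \<otimes>\<^bsub>?P\<^esub> y \<in> carrier ?P" using u v by (simp add: presented_group_mult word_class_in_carrier)
  fix z assume "z \<in> carrier ?P"
  then obtain w where w: "w \<in> lists (letters S)" "z = word_class S rel w"
    by (rule presented_group_carrierE)
  show "x \<otimes>\<^bsub>?P\<^esub> y \<otimes>\<^bsub>?P\<^esub> z = x \<otimes>\<^bsub>?P\<^esub> (y \<otimes>\<^bsub>?P\<^esub> z)"
    using u v w by (simp add: presented_group_mult)
qed

context group
begin

lemma eval_word_closed:
  "f ` S \<subseteq> carrier G \<Longrightarrow> w \<in> lists (letters S) \<Longrightarrow> eval_word G f w \<in> carrier G"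
proof (induction w)
  case (Cons l w)
  then show ?case by (auto elim!: letters_cases)
qed simp

lemma eval_word_append:
  assumes "f ` S \<subseteq> carrier G" "v \<in> lists (letters S)" "w \<in> lists (letters S)"
  shows "eval_word G f (v @ w) = eval_word G f v \<otimes> eval_word G f w"
  using assms(2)
proof (induction v)
  case Nil
  then show ?case using eval_word_closed[OF assms(1,3)] by simp
next
  case (Cons l v)
  have "f g \<in> carrier G" if "g \<in> S" for g using assms(1) that by blast
  moreover have "eval_word G f v \<in> carrier G"
    using Cons by (auto intro!: eval_word_closed[OF assms(1)])
  ultimately show ?case using Cons eval_word_closed[OF assms(1,3)]
    by (auto elim!: letters_cases simp: m_assoc)
qed

lemma eval_word_satisfies:
  assumes f: "satisfies S rel G f" and "word_eq S rel v w"
  shows "eval_word G f v = eval_word G f w"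
proof -
  have fS: "f ` S \<subseteq> carrier G" using f by (simp add: satisfies_def)
  show ?thesis using assms(2)
  proof (induction rule: word_eq.induct)
    case (cancel u v l)
    have "eval_word G f ([l, inv_letter l] @ v) = eval_word G f v"
      using cancel(3) fS eval_word_closed[OF fS cancel(2)]
      by (auto elim!: letters_cases simp: m_assoc[symmetric])
    moreover have "[l, inv_letter l] @ v \<in> lists (letters S)"
      using cancel inv_letter_in_letters by auto
    ultimately show ?case using cancel by (simp only: eval_word_append[OF fS])
  next
    case (relation u v x y)
    then show ?case using f by (simp add: eval_word_append[OF fS] satisfies_def)
  qed auto
qed

lemma presented_lift_class:
  assumes "satisfies S rel G f" "w \<in> lists (letters S)"
  shows "presented_lift G f (word_class S rel w) = eval_word G f w"
proof -
  have "eval_word G f v = eval_word G f w" if "v \<in> word_class S rel w" for v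
    using eval_word_satisfies[OF assms(1), of w v] that by (simp add: word_rel_def)
  moreover have "w \<in> word_class S rel w" using word_eq.refl[OF assms(2)] by (simp add: word_rel_def)
  ultimately have "eval_word G f ` word_class S rel w = {eval_word G f w}" by blast
  then show ?thesis by (simp add: presented_lift_def)
qed

lemma presented_lift_hom:
  assumes f: "satisfies S rel G f"
  shows "presented_lift G f \<in> hom (presented_group S rel) G"
proof (rule homI)
  have fS: "f ` S \<subseteq> carrier G" using f by (simp add: satisfies_def)
  fix x assume "x \<in> carrier (presented_group S rel)"
  then obtain u where u: "u \<in> lists (letters S)" "x = word_class S rel u"
    by (rule presented_group_carrierE)
  show "presented_lift G f x \<in> carrier G"
    using u presented_lift_class[OF f] eval_word_closed[OF fS] by simp
  fix y assume "y \<in> carrier (presented_group S rel)"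
  then obtain v where v: "v \<in> lists (letters S)" "y = word_class S rel v"
    by (rule presented_group_carrierE)
  show "presented_lift G f (x \<otimes>\<^bsub>presented_group S rel\<^esub> y) = presented_lift G f x \<otimes> presented_lift G f y"
    using u v presented_lift_class[OF f] eval_word_append[OF fS] by (simp add: presented_group_mult)
qed

lemma presented_lift_gen:
  assumes f: "satisfies S rel G f" and "g \<in> S"
  shows "presented_lift G f (word_class S rel [Pos g]) = f g"
proof -
  have "f g \<in> carrier G" using assms by (auto simp: satisfies_def)
  then show ?thesis using presented_lift_class[OF f, of "[Pos g]"] assms(2) by simp
qed

end

abbreviation gen_class ::
    "'g set \<Rightarrow> ('g word \<Rightarrow> 'g word \<Rightarrow> bool) \<Rightarrow> 'g \<Rightarrow> 'g word set"
  where "gen_class S rel g \<equiv> word_class S rel [Pos g]"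

lemma eval_word_gen_class:
  assumes "w \<in> lists (letters S)"
  shows "eval_word (presented_group S rel) (gen_class S rel) w = word_class S rel w"
  using assms
proof (induction w)
  case Nil
  then show ?case by (simp add: presented_group_one)
next
  case (Cons l w)
  interpret P: group "presented_group S rel" by (rule group_presented_group)
  have inv: "inv\<^bsub>presented_group S rel\<^esub> (gen_class S rel g) = word_class S rel [Neg g]"
    if "g \<in> S" for g
  proof (rule P.inv_equality)
    have "word_eq S rel ([] @ [Neg g, inv_letter (Neg g)] @ []) ([] @ [])"
      using that by (intro word_eq.cancel) auto
    then show "word_class S rel [Neg g] \<otimes>\<^bsub>presented_group S rel\<^esub> gen_class S rel g = \<one>\<^bsub>presented_group S rel\<^esub>"
      using that by (simp add: presented_group_mult presented_group_one word_class_eq_iff)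
  qed (use that in \<open>auto simp: word_class_in_carrier\<close>)
  from Cons(1) show ?case
    by (cases rule: letters_cases) (use Cons in \<open>simp_all add: inv presented_group_mult\<close>)
qed

lemma satisfies_gen_class: "satisfies S rel (presented_group S rel) (gen_class S rel)"
proof -
  have "word_class S rel v = word_class S rel w"
    if "v \<in> lists (letters S)" "w \<in> lists (letters S)" "rel v w" for v w
    using word_eq.relation[of "[]" S "[]" v w rel] that by (simp add: word_class_eq_iff)
  then show ?thesis
    unfolding satisfies_def by (simp add: word_class_in_carrier eval_word_gen_class image_subset_iff)
qed

lemma satisfies_hom:
  assumes "satisfies S rel G f" "\<phi> \<in> hom G H" "group G" "group H"
  shows "satisfies S rel H (\<phi> \<circ> f)"
    and "w \<in> lists (letters S) \<Longrightarrow> eval_word H (\<phi> \<circ> f) w = \<phi> (eval_word G f w)"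
proof -
  interpret group_hom G H \<phi> using assms by (simp add: group_hom_def group_hom_axioms_def)
  have fS: "f ` S \<subseteq> carrier G" using assms by (simp add: satisfies_def)
  have *: "eval_word H (\<phi> \<circ> f) w = \<phi> (eval_word G f w)" if "w \<in> lists (letters S)" for w
    using that
  proof (induction w)
    case (Cons l w)
    have "f g \<in> carrier G" if "g \<in> S" for g using fS that by blast
    moreover have "eval_word G f w \<in> carrier G"
      using Cons by (auto intro!: G.eval_word_closed[OF fS])
    ultimately show ?case using Cons by (auto elim!: letters_cases)
  qed simp
  then show "w \<in> lists (letters S) \<Longrightarrow> eval_word H (\<phi> \<circ> f) w = \<phi> (eval_word G f w)" .
  show "satisfies S rel H (\<phi> \<circ> f)" using assms(1) * by (auto simp: satisfies_def)
qed

lemma satisfies_cong: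
  assumes "\<And>g. g \<in> S \<Longrightarrow> f g = f' g" "satisfies S rel G f"
  shows "satisfies S rel G f'"
proof -
  have "eval_word G f w = eval_word G f' w" if "w \<in> lists (letters S)" for w
    using that assms(1) by (induction w) (auto elim!: letters_cases)
  moreover have "f' ` S \<subseteq> carrier G"
    using assms by (auto simp: satisfies_def)
  ultimately show ?thesis using assms(2) by (auto simp: satisfies_def)
qed

lemma satisfies_mono:
  assumes "S \<subseteq> S'" "satisfies S' rel G f"
  shows "satisfies S rel G f"
proof -
  have "letters S \<subseteq> letters S'" using assms(1) by (auto simp: letters_def)
  then have sub: "w \<in> lists (letters S')" if "w \<in> lists (letters S)" for w
    using that lists_mono by blast
  show ?thesis
    unfolding satisfies_def
  proof (intro conjI ballI impI)
    show "f ` S \<subseteq> carrier G" using assms by (auto simp: satisfies_def)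
    fix v w assume "v \<in> lists (letters S)" "w \<in> lists (letters S)" "rel v w"
    then show "eval_word G f v = eval_word G f w"
      using assms(2) sub[of v] sub[of w] unfolding satisfies_def by fast
  qed
qed

lemma presented_group_generated:
  "generate (presented_group S rel) (gen_class S rel ` S) = carrier (presented_group S rel)"
proof -
  interpret P: group "presented_group S rel" by (rule group_presented_group)
  have gen: "gen_class S rel ` S \<subseteq> carrier (presented_group S rel)"
    by (auto simp: word_class_in_carrier)
  have "word_class S rel w \<in> generate (presented_group S rel) (gen_class S rel ` S)"
    if "w \<in> lists (letters S)" for w
  proof -
    have "eval_word (presented_group S rel) (gen_class S rel) w
        \<in> generate (presented_group S rel) (gen_class S rel ` S)"
      using that
    proof (induction w)
      case (Cons l w)
      from Cons(1) show ?case
      proof (cases rule: letters_cases)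
        case (1 g)
        then show ?thesis using Cons by (simp add: generate.eng generate.incl)
      next
        case (2 g)
        then show ?thesis using Cons by (simp add: generate.eng generate.inv)
      qed
    qed (simp add: generate.one)
    then show ?thesis using that by (simp add: eval_word_gen_class)
  qed
  then show ?thesis using P.generate_in_carrier[OF gen]
    by (auto elim!: presented_group_carrierE)
qed

section \<open>Direct limits of groups\<close>

locale group_sequence =
  fixes G :: "nat \<Rightarrow> 'a monoid" and f :: "nat \<Rightarrow> 'a \<Rightarrow> 'a"
  assumes group_G: "group (G n)"
    and hom_f: "f n \<in> hom (G n) (G (Suc n))"
begin

lemma transition_add: "transition f m (d + e) x = transition f (m + d) e (transition f m d x)"
  by (induction e) (simp_all add: add.assoc)

lemma transition_hom: "transition f m d \<in> hom (G m) (G (m + d))"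
proof (induction d)
  case 0
  then show ?case by (simp add: hom_def)
next
  case (Suc d)
  show ?case using hom_compose[OF Suc hom_f] by (simp add: o_def)
qed

text \<open>Indexing the transition maps by source and target instead of source and distance makes
  composition (\<open>trans_to_trans_to\<close>) free of subtraction.\<close>

definition trans_to :: "nat \<Rightarrow> nat \<Rightarrow> 'a \<Rightarrow> 'a"
  where "trans_to m k = transition f m (k - m)"

lemma trans_to_hom: "m \<le> k \<Longrightarrow> trans_to m k \<in> hom (G m) (G k)"
  using transition_hom[of m "k - m"] by (simp add: trans_to_def)

lemma trans_to_closed: "m \<le> k \<Longrightarrow> x \<in> carrier (G m) \<Longrightarrow> trans_to m k x \<in> carrier (G k)"
  using trans_to_hom by (auto simp: hom_def)

lemma trans_to_self [simp]: "trans_to m m x = x"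
  by (simp add: trans_to_def)

lemma trans_to_Suc: "trans_to m (Suc m) x = f m x"
  by (simp add: trans_to_def)

lemma trans_to_trans_to: "m \<le> k \<Longrightarrow> k \<le> l \<Longrightarrow> trans_to k l (trans_to m k x) = trans_to m l x"
  using transition_add[of m "k - m" "l - k" x] by (simp add: trans_to_def)

lemma trans_to_Suc_right: "m \<le> k \<Longrightarrow> trans_to m (Suc k) x = f k (trans_to m k x)"
  using trans_to_trans_to[of m k "Suc k" x] by (simp add: trans_to_Suc)

abbreviation lim_rel where "lim_rel \<equiv> direct_limit_rel G f"

abbreviation lim where "lim \<equiv> direct_limit G f"

definition lim_in :: "nat \<Rightarrow> 'a \<Rightarrow> (nat \<times> 'a) set"
  where "lim_in n x = lim_rel `` {(n, x)}"

lemma lim_rel_iff: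
  "((m, x), (n, y)) \<in> lim_rel \<longleftrightarrow> x \<in> carrier (G m) \<and> y \<in> carrier (G n) \<and>
    (\<exists>k. m \<le> k \<and> n \<le> k \<and> trans_to m k x = trans_to n k y)"
  by (simp add: direct_limit_rel_def trans_to_def)

lemma trans_to_eq_mono:
  assumes "m \<le> k" "n \<le> k" "trans_to m k x = trans_to n k y" "k \<le> l"
  shows "trans_to m l x = trans_to n l y"
  using assms trans_to_trans_to by metis

lemma equiv_lim_rel: "equiv (SIGMA n:UNIV. carrier (G n)) lim_rel"
proof (rule equivI)
  show "lim_rel \<subseteq> (SIGMA n:UNIV. carrier (G n)) \<times> (SIGMA n:UNIV. carrier (G n))"
    by (auto simp: direct_limit_rel_def)
  show "refl_on (SIGMA n:UNIV. carrier (G n)) lim_rel"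
    by (auto simp: refl_on_def lim_rel_iff)
  show "sym lim_rel"
    unfolding sym_def by (auto simp: lim_rel_iff)
  show "trans lim_rel"
  proof (rule transI)
    fix a b c assume ab: "(a, b) \<in> lim_rel" and bc: "(b, c) \<in> lim_rel"
    obtain m x n y l z where [simp]: "a = (m, x)" "b = (n, y)" "c = (l, z)"
      by (cases a; cases b; cases c)
    from ab obtain k where k: "m \<le> k" "n \<le> k" "trans_to m k x = trans_to n k y"
      by (auto simp: lim_rel_iff)
    from bc obtain k' where k': "n \<le> k'" "l \<le> k'" "trans_to n k' y = trans_to l k' z"
      by (auto simp: lim_rel_iff)
    have "trans_to m (max k k') x = trans_to l (max k k') z"
      using trans_to_eq_mono[OF k, of "max k k'"] trans_to_eq_mono[OF k', of "max k k'"] by simp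
    then show "(a, c) \<in> lim_rel"
      using ab bc k k' by (auto simp: lim_rel_iff intro!: exI[of _ "max k k'"])
  qed
qed

lemma lim_in_eq_iff:
  assumes "x \<in> carrier (G m)" "y \<in> carrier (G n)"
  shows "lim_in m x = lim_in n y \<longleftrightarrow>
    (\<exists>k. m \<le> k \<and> n \<le> k \<and> trans_to m k x = trans_to n k y)"
  using eq_equiv_class_iff[OF equiv_lim_rel, of "(m, x)" "(n, y)"] assms
  by (simp add: lim_in_def lim_rel_iff)

lemma lim_in_closed: "x \<in> carrier (G n) \<Longrightarrow> lim_in n x \<in> carrier lim"
  by (simp add: direct_limit_def lim_in_def quotientI)

lemma lim_carrierE:
  assumes "A \<in> carrier lim"
  obtains n x where "x \<in> carrier (G n)" "A = lim_in n x"
  using assms by (auto simp: direct_limit_def lim_in_def elim!: quotientE)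

lemma lim_in_trans_to:
  assumes "m \<le> k" "x \<in> carrier (G m)"
  shows "lim_in k (trans_to m k x) = lim_in m x"
  using assms trans_to_closed[OF assms] by (subst lim_in_eq_iff) (auto intro!: exI[of _ k])

lemma lim_in_mult:
  assumes "x \<in> carrier (G m)" "y \<in> carrier (G n)"
  shows "lim_in m x \<otimes>\<^bsub>lim\<^esub> lim_in n y =
    lim_in (max m n) (trans_to m (max m n) x \<otimes>\<^bsub>G (max m n)\<^esub> trans_to n (max m n) y)"
proof -
  have *: "lim_in (max m' n') (trans_to m' (max m' n') x' \<otimes>\<^bsub>G (max m' n')\<^esub> trans_to n' (max m' n') y')
     = lim_in (max m n) (trans_to m (max m n) x \<otimes>\<^bsub>G (max m n)\<^esub> trans_to n (max m n) y)"
    if "(m', x') \<in> lim_in m x" "(n', y') \<in> lim_in n y" for m' x' n' y'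
  proof -
    from that(1) obtain k where k: "m \<le> k" "m' \<le> k" "trans_to m k x = trans_to m' k x'"
      and x': "x' \<in> carrier (G m')"
      by (auto simp: lim_in_def lim_rel_iff)
    from that(2) obtain k' where k': "n \<le> k'" "n' \<le> k'" "trans_to n k' y = trans_to n' k' y'"
      and y': "y' \<in> carrier (G n')"
      by (auto simp: lim_in_def lim_rel_iff)
    have key: "trans_to (max i j) (max k k') (trans_to i (max i j) a \<otimes>\<^bsub>G (max i j)\<^esub> trans_to j (max i j) b)
       = trans_to i (max k k') a \<otimes>\<^bsub>G (max k k')\<^esub> trans_to j (max k k') b"
      if "i \<le> max k k'" "j \<le> max k k'" "a \<in> carrier (G i)" "b \<in> carrier (G j)" for i j a b
      using that hom_mult[OF trans_to_hom[of "max i j" "max k k'"], of "trans_to i (max i j) a" "trans_to j (max i j) b"]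
      by (simp add: trans_to_closed trans_to_trans_to)
    have closed: "trans_to i (max i j) a \<otimes>\<^bsub>G (max i j)\<^esub> trans_to j (max i j) b \<in> carrier (G (max i j))"
      if "a \<in> carrier (G i)" "b \<in> carrier (G j)" for i j a b
      using that group_G by (simp add: group.is_monoid monoid.m_closed trans_to_closed)
    have "trans_to m (max k k') x = trans_to m' (max k k') x'"
      "trans_to n (max k k') y = trans_to n' (max k k') y'"
      using trans_to_eq_mono[OF k, of "max k k'"] trans_to_eq_mono[OF k', of "max k k'"] by simp_all
    then show ?thesis
      using k k' x' y' assms closed key
      by (subst lim_in_eq_iff) (auto intro!: exI[of _ "max k k'"] simp: le_max_iff_disj)
  qed
  have mem: "(m, x) \<in> lim_in m x" "(n, y) \<in> lim_in n y"
    using assms by (auto simp: lim_in_def lim_rel_iff)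
  have "lim_in m x \<otimes>\<^bsub>lim\<^esub> lim_in n y =
    (\<Union>(m', x') \<in> lim_in m x. \<Union>(n', y') \<in> lim_in n y.
      lim_in (max m' n') (trans_to m' (max m' n') x' \<otimes>\<^bsub>G (max m' n')\<^esub> trans_to n' (max m' n') y'))"
    by (simp add: direct_limit_def lim_in_def trans_to_def)
  also have "\<dots> = (\<Union>p \<in> lim_in m x. \<Union>q \<in> lim_in n y.
      lim_in (max m n) (trans_to m (max m n) x \<otimes>\<^bsub>G (max m n)\<^esub> trans_to n (max m n) y))"
    using * by (intro SUP_cong refl) (auto simp: split_beta)
  also have "\<dots> = lim_in (max m n) (trans_to m (max m n) x \<otimes>\<^bsub>G (max m n)\<^esub> trans_to n (max m n) y)"
    using mem by auto
  finally show ?thesis .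
qed

lemma lim_in_mult_same:
  assumes "x \<in> carrier (G n)" "y \<in> carrier (G n)"
  shows "lim_in n x \<otimes>\<^bsub>lim\<^esub> lim_in n y = lim_in n (x \<otimes>\<^bsub>G n\<^esub> y)"
  using lim_in_mult[OF assms] by simp

lemma lim_one: "\<one>\<^bsub>lim\<^esub> = lim_in n \<one>\<^bsub>G n\<^esub>"
proof -
  have one: "\<one>\<^bsub>G n\<^esub> \<in> carrier (G n)" for n using group_G by (simp add: group.is_monoid)
  have "trans_to 0 n \<one>\<^bsub>G 0\<^esub> = \<one>\<^bsub>G n\<^esub>"
    using hom_one[OF trans_to_hom[of 0 n]] group_G by simp
  then have "lim_in n \<one>\<^bsub>G n\<^esub> = lim_in 0 \<one>\<^bsub>G 0\<^esub>"
    using lim_in_trans_to[of 0 n "\<one>\<^bsub>G 0\<^esub>"] one by simp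
  then show ?thesis by (simp add: direct_limit_def lim_in_def)
qed

text \<open>This reduces identities in the limit to identities in a single group of the sequence; the bound
  \<open>N\<close> serves to reach a level that is already given.\<close>

lemma lim_common_level:
  assumes "A \<in> carrier lim" "A' \<in> carrier lim"
  obtains n x y where "N \<le> n" "x \<in> carrier (G n)" "y \<in> carrier (G n)" "A = lim_in n x" "A' = lim_in n y"
proof -
  from assms obtain k x l y where x: "x \<in> carrier (G k)" "A = lim_in k x"
    and y: "y \<in> carrier (G l)" "A' = lim_in l y"
    by (metis lim_carrierE)
  let ?n = "max N (max k l)"
  have "A = lim_in ?n (trans_to k ?n x)" "A' = lim_in ?n (trans_to l ?n y)"
    using x y by (simp_all add: lim_in_trans_to)
  moreover have "trans_to k ?n x \<in> carrier (G ?n)" "trans_to l ?n y \<in> carrier (G ?n)"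
    using x y by (simp_all add: trans_to_closed)
  ultimately show thesis by (intro that[of ?n]) simp_all
qed

lemma group_lim: "group lim"
proof (rule groupI)
  show "\<one>\<^bsub>lim\<^esub> \<in> carrier lim"
    using lim_one[of 0] group_G[of 0] by (simp add: lim_in_closed group.is_monoid)
  fix A assume A: "A \<in> carrier lim"
  then obtain n x where x: "x \<in> carrier (G n)" "A = lim_in n x" by (rule lim_carrierE)
  interpret Gn: group "G n" by (rule group_G)
  show "\<one>\<^bsub>lim\<^esub> \<otimes>\<^bsub>lim\<^esub> A = A"
    using x by (simp add: lim_one[of n] lim_in_mult_same)
  show "\<exists>C\<in>carrier lim. C \<otimes>\<^bsub>lim\<^esub> A = \<one>\<^bsub>lim\<^esub>"
    using x by (intro bexI[of _ "lim_in n (inv\<^bsub>G n\<^esub> x)"])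
      (simp_all add: lim_one[of n] lim_in_mult_same lim_in_closed)
next
  fix A C assume A: "A \<in> carrier lim" "C \<in> carrier lim"
  then obtain n x y where xy: "x \<in> carrier (G n)" "y \<in> carrier (G n)" "A = lim_in n x" "C = lim_in n y"
    using lim_common_level[of A C 0] by metis
  interpret Gn: group "G n" by (rule group_G)
  show "A \<otimes>\<^bsub>lim\<^esub> C \<in> carrier lim"
    using xy by (simp add: lim_in_mult_same lim_in_closed)
next
  fix A C D assume A: "A \<in> carrier lim" "C \<in> carrier lim" "D \<in> carrier lim"
  then obtain n x y where xy: "x \<in> carrier (G n)" "y \<in> carrier (G n)" "A = lim_in n x" "C = lim_in n y"
    using lim_common_level[of A C 0] by metis
  from A(3) obtain m z where z: "z \<in> carrier (G m)" "D = lim_in m z" by (rule lim_carrierE)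
  let ?k = "max n m"
  interpret Gk: group "G ?k" by (rule group_G)
  define x' y' z' where "x' = trans_to n ?k x" "y' = trans_to n ?k y" "z' = trans_to m ?k z"
  have "x' \<in> carrier (G ?k)" "y' \<in> carrier (G ?k)" "z' \<in> carrier (G ?k)"
    "A = lim_in ?k x'" "C = lim_in ?k y'" "D = lim_in ?k z'"
    using xy z by (simp_all add: x'_y'_z'_def trans_to_closed lim_in_trans_to)
  then show "A \<otimes>\<^bsub>lim\<^esub> C \<otimes>\<^bsub>lim\<^esub> D = A \<otimes>\<^bsub>lim\<^esub> (C \<otimes>\<^bsub>lim\<^esub> D)"
    by (simp add: lim_in_mult_same Gk.m_assoc)
qed

lemma lim_in_hom: "lim_in n \<in> hom (G n) lim"
  by (rule homI) (simp_all add: lim_in_closed lim_in_mult_same)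

text \<open>The map is defined on representatives. Two representatives of the same element agree at some
  later level, and compatibility carries this back to the values.\<close>

lemma lim_lift:
  fixes H :: "('h, 'm) monoid_scheme"
  assumes hom: "\<And>n. \<phi> n \<in> hom (G n) H"
    and compat: "\<And>n x. x \<in> carrier (G n) \<Longrightarrow> \<phi> (Suc n) (f n x) = \<phi> n x"
  shows "\<exists>\<psi> \<in> hom lim H. \<forall>n. \<forall>x \<in> carrier (G n). \<psi> (lim_in n x) = \<phi> n x"
proof -
  have \<phi>: "\<phi> k (trans_to m k x) = \<phi> m x" if "m \<le> k" "x \<in> carrier (G m)" for m k x
    using that
  proof (induction k rule: dec_induct)
    case (step k)
    then show ?case using compat[of "trans_to m k x" k] by (simp add: trans_to_Suc_right trans_to_closed)
  qed simp
  define \<psi> where "\<psi> = (\<lambda>A. THE h. \<exists>n x. x \<in> carrier (G n) \<and> A = lim_in n x \<and> h = \<phi> n x)"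
  have \<psi>: "\<psi> (lim_in n x) = \<phi> n x" if x: "x \<in> carrier (G n)" for n x
    unfolding \<psi>_def
  proof (rule the_equality)
    show "\<exists>m y. y \<in> carrier (G m) \<and> lim_in n x = lim_in m y \<and> \<phi> n x = \<phi> m y"
      using x by blast
    fix h assume "\<exists>m y. y \<in> carrier (G m) \<and> lim_in n x = lim_in m y \<and> h = \<phi> m y"
    then obtain m y where y: "y \<in> carrier (G m)" "lim_in n x = lim_in m y" "h = \<phi> m y" by blast
    then obtain k where "n \<le> k" "m \<le> k" "trans_to n k x = trans_to m k y"
      using x by (auto simp: lim_in_eq_iff)
    then show "h = \<phi> n x" using \<phi> x y by metis
  qed
  have "\<psi> \<in> hom lim H"
  proof (rule homI)
    fix A assume "A \<in> carrier lim"
    then show "\<psi> A \<in> carrier H"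
      using hom_in_carrier[OF hom] \<psi> by (auto elim!: lim_carrierE)
    fix C assume "C \<in> carrier lim"
    with \<open>A \<in> carrier lim\<close> obtain n x y where xy: "x \<in> carrier (G n)" "y \<in> carrier (G n)"
      "A = lim_in n x" "C = lim_in n y"
      using lim_common_level[of A C 0] by metis
    then have "x \<otimes>\<^bsub>G n\<^esub> y \<in> carrier (G n)"
      using group_G by (simp add: group.is_monoid monoid.m_closed)
    then show "\<psi> (A \<otimes>\<^bsub>lim\<^esub> C) = \<psi> A \<otimes>\<^bsub>H\<^esub> \<psi> C"
      using xy hom_mult[OF hom] by (simp add: lim_in_mult_same \<psi>)
  qed
  with \<psi> show ?thesis by blast
qed

end

lemma direct_limit_map_in:
  assumes G: "group_sequence G f" and H: "group_sequence H g"
    and h: "\<And>n. h n \<in> hom (G n) (H n)"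
    and compat: "\<And>n x. x \<in> carrier (G n) \<Longrightarrow> h (Suc n) (f n x) = g n (h n x)"
    and x: "x \<in> carrier (G n)"
  shows "direct_limit_map H g h (group_sequence.lim_in G f n x) = group_sequence.lim_in H g n (h n x)"
proof -
  interpret G: group_sequence G f by (rule G)
  interpret H: group_sequence H g by (rule H)
  have closed: "h n x \<in> carrier (H n)" if "x \<in> carrier (G n)" for n x
    using h that by (auto simp: hom_def)
  have trans: "h k (G.trans_to m k x) = H.trans_to m k (h m x)" if "m \<le> k" "x \<in> carrier (G m)" for m k x
    using that
  proof (induction k rule: dec_induct)
    case (step k)
    then show ?case
      using compat[of "G.trans_to m k x" k]
      by (simp add: G.trans_to_Suc_right H.trans_to_Suc_right G.trans_to_closed)
  qed simp
  have eq: "H.lim_in m (h m y) = H.lim_in n (h n x)" if "(m, y) \<in> G.lim_in n x" for m y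
  proof -
    from that obtain k where "n \<le> k" "m \<le> k" "G.trans_to n k x = G.trans_to m k y" and y: "y \<in> carrier (G m)"
      by (auto simp: G.lim_in_def G.lim_rel_iff)
    then have "H.trans_to n k (h n x) = H.trans_to m k (h m y)"
      using trans x by metis
    with \<open>n \<le> k\<close> \<open>m \<le> k\<close> show ?thesis
      using closed x y by (subst H.lim_in_eq_iff) (auto intro!: exI[of _ k])
  qed
  have mem: "(n, x) \<in> G.lim_in n x" using x by (auto simp: G.lim_in_def G.lim_rel_iff)
  have "direct_limit_map H g h (G.lim_in n x) = (\<Union>(m, y) \<in> G.lim_in n x. H.lim_in m (h m y))"
    unfolding direct_limit_map_def H.lim_in_def by force
  also have "\<dots> = (\<Union>p \<in> G.lim_in n x. H.lim_in n (h n x))"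
    using eq by (intro SUP_cong refl) auto
  also have "\<dots> = H.lim_in n (h n x)" using mem by blast
  finally show ?thesis .
qed

section \<open>Commutators in central extensions\<close>

definition commutator :: "('a, 'm) monoid_scheme \<Rightarrow> 'a \<Rightarrow> 'a \<Rightarrow> 'a"
  where "commutator G x y = x \<otimes>\<^bsub>G\<^esub> y \<otimes>\<^bsub>G\<^esub> inv\<^bsub>G\<^esub> x \<otimes>\<^bsub>G\<^esub> inv\<^bsub>G\<^esub> y"

context group
begin

lemma cancel_inv_left [simp]:
  "x \<in> carrier G \<Longrightarrow> y \<in> carrier G \<Longrightarrow> x \<otimes> (inv x \<otimes> y) = y"
  "x \<in> carrier G \<Longrightarrow> y \<in> carrier G \<Longrightarrow> inv x \<otimes> (x \<otimes> y) = y"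
  by (simp_all add: m_assoc[symmetric])

lemma commutator_closed [simp]:
  "x \<in> carrier G \<Longrightarrow> y \<in> carrier G \<Longrightarrow> commutator G x y \<in> carrier G"
  by (simp add: commutator_def)

lemma commutator_swap:
  "x \<in> carrier G \<Longrightarrow> y \<in> carrier G \<Longrightarrow> inv (commutator G x y) = commutator G y x"
  by (simp add: commutator_def inv_mult_group m_assoc)

lemma mult_eq_commutator:
  "x \<in> carrier G \<Longrightarrow> y \<in> carrier G \<Longrightarrow> x \<otimes> y = commutator G x y \<otimes> (y \<otimes> x)"
  by (simp add: commutator_def m_assoc)

lemma commutator_eq_iff:
  assumes "x \<in> carrier G" "y \<in> carrier G" "z \<in> carrier G"
  shows "commutator G x y = z \<longleftrightarrow> x \<otimes> y = z \<otimes> (y \<otimes> x)"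
proof
  assume "x \<otimes> y = z \<otimes> (y \<otimes> x)"
  then show "commutator G x y = z" using assms by (simp add: commutator_def) (simp add: m_assoc)
qed (use assms mult_eq_commutator in blast)

lemma commutator_eq_one_iff:
  "x \<in> carrier G \<Longrightarrow> y \<in> carrier G \<Longrightarrow> commutator G x y = \<one> \<longleftrightarrow> x \<otimes> y = y \<otimes> x"
  by (simp add: commutator_eq_iff)

lemma commutator_mult_right:
  assumes "x \<in> carrier G" "y \<in> carrier G" "z \<in> carrier G"
  shows "commutator G x (y \<otimes> z) = commutator G x y \<otimes> (y \<otimes> commutator G x z \<otimes> inv y)"
  using assms by (simp add: commutator_def inv_mult_group m_assoc)

lemma commutator_mult_left:
  assumes "x \<in> carrier G" "y \<in> carrier G" "z \<in> carrier G"
  shows "commutator G (x \<otimes> y) z = (x \<otimes> commutator G y z \<otimes> inv x) \<otimes> commutator G x z"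
  using assms by (simp add: commutator_def inv_mult_group m_assoc)

lemma conj_commutator:
  assumes "x \<in> carrier G" "y \<in> carrier G" "z \<in> carrier G"
  shows "z \<otimes> commutator G x y \<otimes> inv z = commutator G (z \<otimes> x \<otimes> inv z) (z \<otimes> y \<otimes> inv z)"
  using assms by (simp add: commutator_def inv_mult_group m_assoc)

text \<open>The Hall--Witt identity when two of the three elements commute: conjugation by \<open>p\<close> fixes \<open>r\<close> and
  replaces \<open>q\<close> by \<open>s q\<close>, so it turns the commutator of \<open>q\<close> and \<open>r\<close> into that of \<open>s q\<close> and \<open>r\<close>.\<close>

lemma commutator_hall:
  assumes "p \<in> carrier G" "q \<in> carrier G" "r \<in> carrier G" "p \<otimes> r = r \<otimes> p"
  defines "s \<equiv> commutator G p q" and "t \<equiv> commutator G q r"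
  shows "commutator G p t = commutator G s t \<otimes> (t \<otimes> commutator G s r \<otimes> inv t)"
proof -
  have s: "s \<in> carrier G" and t: "t \<in> carrier G" using assms by simp_all
  have "p \<otimes> t \<otimes> inv p = commutator G (p \<otimes> q \<otimes> inv p) (p \<otimes> r \<otimes> inv p)"
    using assms by (simp add: t_def conj_commutator)
  also have "p \<otimes> r \<otimes> inv p = r" using assms by (simp add: m_assoc)
  also have "p \<otimes> q \<otimes> inv p = s \<otimes> q" using assms by (simp add: s_def commutator_def m_assoc)
  also have "commutator G (s \<otimes> q) r = s \<otimes> t \<otimes> inv s \<otimes> commutator G s r"
    using assms s by (simp add: t_def commutator_mult_left)
  finally have "p \<otimes> t \<otimes> inv p \<otimes> inv t = s \<otimes> t \<otimes> inv s \<otimes> commutator G s r \<otimes> inv t" by simp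
  moreover have "commutator G s t \<otimes> (t \<otimes> commutator G s r \<otimes> inv t) = s \<otimes> t \<otimes> inv s \<otimes> commutator G s r \<otimes> inv t"
    using s t assms(3) by (simp add: commutator_def[of G s t] m_assoc)
  ultimately show ?thesis by (simp add: commutator_def[of G p t])
qed

lemma left_cancel:
  assumes "x \<in> carrier G" "y \<in> carrier G" "z \<in> carrier G" "x \<otimes> y = x \<otimes> z"
  shows "y = z"
proof -
  have "inv x \<otimes> (x \<otimes> y) = inv x \<otimes> (x \<otimes> z)" using assms(4) by simp
  then show ?thesis using assms(1-3) by simp
qed

lemma swap_middle:
  assumes "p \<in> carrier G" "x \<in> carrier G" "y \<in> carrier G" "z \<in> carrier G" "x \<otimes> y = y \<otimes> x"
  shows "p \<otimes> x \<otimes> (y \<otimes> z) = p \<otimes> y \<otimes> (x \<otimes> z)"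
proof -
  have "p \<otimes> x \<otimes> (y \<otimes> z) = p \<otimes> (x \<otimes> y) \<otimes> z" using assms(1-4) by (simp add: m_assoc)
  then show ?thesis using assms by (simp add: m_assoc)
qed

lemma conj_eq_self: "x \<in> carrier G \<Longrightarrow> y \<in> carrier G \<Longrightarrow> x \<otimes> y = y \<otimes> x \<Longrightarrow> x \<otimes> y \<otimes> inv x = y"
  by simp (simp add: m_assoc)

lemma commute_mult:
  assumes "x \<in> carrier G" "y \<in> carrier G" "z \<in> carrier G" "x \<otimes> y = y \<otimes> x" "x \<otimes> z = z \<otimes> x"
  shows "x \<otimes> (y \<otimes> z) = y \<otimes> z \<otimes> x"
proof -
  have "x \<otimes> (y \<otimes> z) = x \<otimes> y \<otimes> z" using assms(1-3) by (simp add: m_assoc)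
  also have "\<dots> = y \<otimes> (x \<otimes> z)" using assms(1-3) by (simp add: assms(4) m_assoc)
  finally show ?thesis using assms(1-3) by (simp add: assms(5) m_assoc)
qed

lemma commutator_mult_mult:
  assumes [simp]: "p \<in> carrier G" "P \<in> carrier G" "q \<in> carrier G" "Q \<in> carrier G"
    and "q \<otimes> commutator G P Q = commutator G P Q \<otimes> q" "p \<otimes> commutator G P q = commutator G P q \<otimes> p"
    and "p \<otimes> commutator G P Q = commutator G P Q \<otimes> p" "q \<otimes> commutator G p Q = commutator G p Q \<otimes> q"
  shows "commutator G (p \<otimes> P) (q \<otimes> Q) =
    commutator G P q \<otimes> commutator G P Q \<otimes> (commutator G p q \<otimes> commutator G p Q)"
proof -
  have "commutator G (p \<otimes> P) (q \<otimes> Q) = p \<otimes> commutator G P (q \<otimes> Q) \<otimes> inv p \<otimes> commutator G p (q \<otimes> Q)"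
    by (simp add: commutator_mult_left)
  also have "commutator G p (q \<otimes> Q) = commutator G p q \<otimes> commutator G p Q"
    using conj_eq_self[OF _ _ assms(8)] by (simp add: commutator_mult_right)
  also have "commutator G P (q \<otimes> Q) = commutator G P q \<otimes> commutator G P Q"
    using conj_eq_self[OF _ _ assms(5)] by (simp add: commutator_mult_right)
  also have "p \<otimes> (commutator G P q \<otimes> commutator G P Q) \<otimes> inv p = commutator G P q \<otimes> commutator G P Q"
    using assms by (intro conj_eq_self commute_mult) simp_all
  finally show ?thesis .
qed

end

lemma hom_eq_on_generate:
  assumes "group_hom G H \<phi>" "group_hom G H \<psi>" "S \<subseteq> carrier G"
    and eq: "\<And>s. s \<in> S \<Longrightarrow> \<phi> s = \<psi> s" and x: "x \<in> generate G S"
  shows "\<phi> x = \<psi> x"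
proof -
  interpret \<phi>: group_hom G H \<phi> by fact
  interpret \<psi>: group_hom G H \<psi> by fact
  from x have "x \<in> carrier G \<and> \<phi> x = \<psi> x"
    by (induction rule: generate.induct) (use assms(3) eq in auto)
  then show ?thesis by simp
qed

locale central_ext = H: group H + G: group G
  for H :: "'h monoid" and G :: "'g monoid" and \<epsilon> :: "'h \<Rightarrow> 'g" +
  assumes epi: "\<epsilon> \<in> epi H G" and central: "kernel H G \<epsilon> \<subseteq> center H"

sublocale central_ext \<subseteq> group_hom H G \<epsilon>
  using epi by unfold_locales (simp add: epi_def)

context central_ext
begin

abbreviation mult_H (infixl "\<odot>" 70)
  where "x \<odot> y \<equiv> x \<otimes>\<^bsub>H\<^esub> y"

definition lift :: "'g \<Rightarrow> 'h"
  where "lift g = (SOME h. h \<in> carrier H \<and> \<epsilon> h = g)"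

lemma lift: assumes "g \<in> carrier G" shows "lift g \<in> carrier H" "\<epsilon> (lift g) = g"
proof -
  have "\<exists>h. h \<in> carrier H \<and> \<epsilon> h = g" using epi assms unfolding epi_def by (metis (mono_tags, lifting) imageE mem_Collect_eq)
  from someI_ex[OF this] show "lift g \<in> carrier H" "\<epsilon> (lift g) = g" by (simp_all add: lift_def)
qed

text \<open>The commutator of lifts of two elements of \<open>G\<close>. The choice of the lifts is immaterial by
  \<open>commutator_eq_cl\<close>.\<close>

definition cl :: "'g \<Rightarrow> 'g \<Rightarrow> 'h"
  where "cl g h = commutator H (lift g) (lift h)"

lemma commutator_central_left:
  assumes "x \<in> carrier H" "y \<in> carrier H" "z \<in> center H"
  shows "commutator H (x \<odot> z) y = commutator H x y"
proof -
  have z: "z \<in> carrier H" "z \<odot> y = y \<odot> z" using assms by (auto simp: center_def)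
  then have "commutator H z y = \<one>\<^bsub>H\<^esub>" using assms by (simp add: H.commutator_eq_one_iff)
  then show ?thesis using assms z by (simp add: H.commutator_mult_left)
qed

lemma same_image:
  assumes "x \<in> carrier H" "x' \<in> carrier H" "\<epsilon> x = \<epsilon> x'"
  obtains z where "z \<in> center H" "x = x' \<odot> z"
proof
  have "inv\<^bsub>H\<^esub> x' \<odot> x \<in> kernel H G \<epsilon>" using assms by (simp add: kernel_def)
  then show "inv\<^bsub>H\<^esub> x' \<odot> x \<in> center H" using central by blast
  show "x = x' \<odot> (inv\<^bsub>H\<^esub> x' \<odot> x)" using assms by simp
qed

text \<open>Two elements with the same image differ by a central factor, which cancels in a commutator.
  Commutators in \<open>H\<close> can therefore be computed from the images in \<open>G\<close>. This is what makes relations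
  liftable.\<close>

lemma commutator_eq_cl:
  assumes "x \<in> carrier H" "y \<in> carrier H"
  shows "commutator H x y = cl (\<epsilon> x) (\<epsilon> y)"
proof -
  have left: "commutator H x y = commutator H x' y"
    if "x \<in> carrier H" "x' \<in> carrier H" "\<epsilon> x = \<epsilon> x'" "y \<in> carrier H" for x x' y
    using same_image[OF that(1-3)] that commutator_central_left by metis
  have "commutator H x y = commutator H (lift (\<epsilon> x)) y"
    using assms by (intro left) (simp_all add: lift)
  also have "\<dots> = inv\<^bsub>H\<^esub> (commutator H y (lift (\<epsilon> x)))"
    using assms by (simp add: H.commutator_swap lift)
  also have "commutator H y (lift (\<epsilon> x)) = commutator H (lift (\<epsilon> y)) (lift (\<epsilon> x))"
    using assms by (intro left) (simp_all add: lift)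
  finally show ?thesis using assms by (simp add: H.commutator_swap lift cl_def)
qed

lemma cl_closed [simp]: "g \<in> carrier G \<Longrightarrow> h \<in> carrier G \<Longrightarrow> cl g h \<in> carrier H"
  by (simp add: cl_def lift)

lemma hom_commutator: "x \<in> carrier H \<Longrightarrow> y \<in> carrier H \<Longrightarrow> \<epsilon> (commutator H x y) = commutator G (\<epsilon> x) (\<epsilon> y)"
  by (simp add: commutator_def)

lemma hom_cl [simp]: "g \<in> carrier G \<Longrightarrow> h \<in> carrier G \<Longrightarrow> \<epsilon> (cl g h) = commutator G g h"
  by (simp add: cl_def hom_commutator lift)

lemma cl_swap: "g \<in> carrier G \<Longrightarrow> h \<in> carrier G \<Longrightarrow> inv\<^bsub>H\<^esub> (cl g h) = cl h g"
  by (simp add: cl_def H.commutator_swap lift)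

text \<open>Commutation in \<open>H\<close> as a relation on \<open>G\<close>. It implies commutation in \<open>G\<close>; the converse is what has to
  be proved for root elements.\<close>

definition cc :: "'g \<Rightarrow> 'g \<Rightarrow> bool"
  where "cc g h \<longleftrightarrow> g \<in> carrier G \<and> h \<in> carrier G \<and> cl g h = \<one>\<^bsub>H\<^esub>"

lemma cc_iff: "x \<in> carrier H \<Longrightarrow> y \<in> carrier H \<Longrightarrow> cc (\<epsilon> x) (\<epsilon> y) \<longleftrightarrow> x \<odot> y = y \<odot> x"
  by (simp add: cc_def commutator_eq_cl[symmetric] H.commutator_eq_one_iff)

lemma cc_commute:
  "cc (\<epsilon> x) (\<epsilon> y) \<Longrightarrow> x \<in> carrier H \<Longrightarrow> y \<in> carrier H \<Longrightarrow> x \<odot> y = y \<odot> x"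
  by (simp add: cc_iff)

lemma cc_sym: "cc g h \<Longrightarrow> cc h g"
  using cl_swap[of g h] by (auto simp: cc_def)

lemma cc_mult: "cc g h \<Longrightarrow> cc g h' \<Longrightarrow> cc g (h \<otimes>\<^bsub>G\<^esub> h')"
proof -
  assume a: "cc g h" "cc g h'"
  then have [simp]: "g \<in> carrier G" "h \<in> carrier G" "h' \<in> carrier G" by (auto simp: cc_def)
  have "cl g (h \<otimes>\<^bsub>G\<^esub> h') = commutator H (lift g) (lift h \<odot> lift h')"
    by (simp add: commutator_eq_cl lift)
  also have "\<dots> = \<one>\<^bsub>H\<^esub>"
    using a by (simp add: H.commutator_mult_right lift cl_def[symmetric] cc_def)
  finally show ?thesis by (simp add: cc_def)
qed

text \<open>An element commuting with \<open>p\<close> and \<open>q\<close> in \<open>G\<close> has lifts that are conjugated by lifts of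
  \<open>p\<close> and \<open>q\<close> only up to central factors, and these disappear in the commutator.\<close>

lemma cc_commutator:
  assumes "g \<in> carrier G" "p \<in> carrier G" "q \<in> carrier G"
    "commutator G g p = \<one>\<^bsub>G\<^esub>" "commutator G g q = \<one>\<^bsub>G\<^esub>"
  shows "cc g (commutator G p q)"
proof -
  let ?g = "lift g" and ?p = "lift p" and ?q = "lift q"
  have [simp]: "?g \<in> carrier H" "?p \<in> carrier H" "?q \<in> carrier H" "\<epsilon> ?g = g" "\<epsilon> ?p = p" "\<epsilon> ?q = q"
    using assms lift by auto
  have [simp]: "g \<otimes>\<^bsub>G\<^esub> p \<otimes>\<^bsub>G\<^esub> inv\<^bsub>G\<^esub> g = p" "g \<otimes>\<^bsub>G\<^esub> q \<otimes>\<^bsub>G\<^esub> inv\<^bsub>G\<^esub> g = q"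
    using assms by (auto intro!: G.conj_eq_self iffD1[OF G.commutator_eq_one_iff])
  have "?g \<odot> commutator H ?p ?q \<odot> inv\<^bsub>H\<^esub> ?g =
    commutator H (?g \<odot> ?p \<odot> inv\<^bsub>H\<^esub> ?g) (?g \<odot> ?q \<odot> inv\<^bsub>H\<^esub> ?g)"
    by (simp add: H.conj_commutator)
  also have "\<dots> = commutator H ?p ?q"
    by (simp add: commutator_eq_cl)
  finally have "?g \<odot> commutator H ?p ?q = commutator H ?p ?q \<odot> ?g"
    by (metis \<open>?g \<in> carrier H\<close> \<open>?p \<in> carrier H\<close> \<open>?q \<in> carrier H\<close> H.commutator_closed H.inv_solve_right' H.m_closed)
  then show ?thesis using cc_iff[of ?g "commutator H ?p ?q"] by (simp add: hom_commutator)
qed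

text \<open>Under the commutation hypotheses the two correction terms in \<open>commutator_hall\<close> disappear, and
  the middle factor \<open>q\<close> can be moved from one entry of the commutator to the other.\<close>

lemma cl_hall:
  assumes "cc p r" "q \<in> carrier G"
    and "cc (commutator G p q) (commutator G q r)"
    and "cc (commutator G q r) (commutator G (commutator G p q) r)"
  shows "cl p (commutator G q r) = cl (commutator G p q) r"
proof -
  have [simp]: "p \<in> carrier G" "q \<in> carrier G" "r \<in> carrier G" using assms by (auto simp: cc_def)
  let ?p = "lift p" and ?q = "lift q" and ?r = "lift r"
  have [simp]: "?p \<in> carrier H" "?q \<in> carrier H" "?r \<in> carrier H" "\<epsilon> ?p = p" "\<epsilon> ?q = q" "\<epsilon> ?r = r"
    using lift by auto
  let ?s = "commutator H ?p ?q" and ?t = "commutator H ?q ?r"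
  have "?p \<odot> ?r = ?r \<odot> ?p" using assms by (intro cc_commute) simp_all
  from H.commutator_hall[OF _ _ _ this, of ?q]
  have "commutator H ?p ?t = commutator H ?s ?t \<odot> (?t \<odot> commutator H ?s ?r \<odot> inv\<^bsub>H\<^esub> ?t)" by simp
  also have "commutator H ?s ?t = \<one>\<^bsub>H\<^esub>"
    using assms(3) by (simp add: commutator_eq_cl hom_commutator cc_def)
  also have "?t \<odot> commutator H ?s ?r \<odot> inv\<^bsub>H\<^esub> ?t = commutator H ?s ?r"
    using assms(4) by (intro H.conj_eq_self cc_commute) (simp_all add: hom_commutator)
  finally show ?thesis by (simp add: commutator_eq_cl hom_commutator)
qed

lemma cl_mult_right:
  assumes "p \<in> carrier G" "cc q (commutator G p r)" "r \<in> carrier G"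
  shows "cl p (q \<otimes>\<^bsub>G\<^esub> r) = cl p q \<odot> cl p r"
proof -
  have [simp]: "p \<in> carrier G" "q \<in> carrier G" "r \<in> carrier G" using assms by (auto simp: cc_def)
  let ?p = "lift p" and ?q = "lift q" and ?r = "lift r"
  have [simp]: "?p \<in> carrier H" "?q \<in> carrier H" "?r \<in> carrier H" "\<epsilon> ?p = p" "\<epsilon> ?q = q" "\<epsilon> ?r = r"
    using lift by auto
  have "cl p (q \<otimes>\<^bsub>G\<^esub> r) = commutator H ?p (?q \<odot> ?r)" by (simp add: commutator_eq_cl)
  also have "\<dots> = cl p q \<odot> (?q \<odot> cl p r \<odot> inv\<^bsub>H\<^esub> ?q)"
    by (simp add: H.commutator_mult_right cl_def[symmetric])
  also have "?q \<odot> cl p r \<odot> inv\<^bsub>H\<^esub> ?q = cl p r"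
    using assms by (intro H.conj_eq_self cc_commute) simp_all
  finally show ?thesis .
qed

end

lemma center_iff: "z \<in> center G \<longleftrightarrow> z \<in> carrier G \<and> (\<forall>x\<in>carrier G. z \<otimes>\<^bsub>G\<^esub> x = x \<otimes>\<^bsub>G\<^esub> z)"
  by (simp add: center_def)

lemma central_extension_iff: "central_extension H G \<epsilon> \<longleftrightarrow> central_ext H G \<epsilon>"
  by (auto simp: central_extension_def central_ext_def central_ext_axioms_def)

section \<open>Universal central extensions\<close>

text \<open>On a commutator both homomorphisms take the value \<open>cl\<close> of the common images of the two entries,
  and a perfect group is generated by commutators.\<close>

lemma (in central_ext) hom_eq_on_perfect:
  assumes "group E" and perfect: "carrier E \<subseteq> derived E (carrier E)"
    and hom: "\<phi> \<in> hom E H" "\<psi> \<in> hom E H"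
    and eq: "\<And>x. x \<in> carrier E \<Longrightarrow> \<epsilon> (\<phi> x) = \<epsilon> (\<psi> x)"
    and x: "x \<in> carrier E"
  shows "\<phi> x = \<psi> x"
proof -
  interpret E: group E by fact
  interpret \<phi>: group_hom E H \<phi> by unfold_locales fact
  interpret \<psi>: group_hom E H \<psi> by unfold_locales fact
  have "x \<in> generate E (derived_set E (carrier E))" using perfect x by (auto simp: derived_def)
  then have "x \<in> carrier E \<and> \<phi> x = \<psi> x"
  proof (induction rule: generate.induct)
    case (incl h)
    then obtain u v where uv: "u \<in> carrier E" "v \<in> carrier E" "h = commutator E u v"
      by (auto simp: commutator_def)
    have "\<phi> h = commutator H (\<phi> u) (\<phi> v)" "\<psi> h = commutator H (\<psi> u) (\<psi> v)"
      using uv by (simp_all add: commutator_def)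
    then show ?case using uv eq by (simp add: commutator_eq_cl)
  next
    case (inv h)
    then obtain u v where uv: "u \<in> carrier E" "v \<in> carrier E" "h = commutator E u v"
      by (auto simp: commutator_def)
    have "\<phi> h = commutator H (\<phi> u) (\<phi> v)" "\<psi> h = commutator H (\<psi> u) (\<psi> v)"
      using uv by (simp_all add: commutator_def)
    then show ?case using uv eq by (simp add: commutator_eq_cl)
  qed (auto)
  then show ?thesis by simp
qed

text \<open>The hypothesis \<open>univ\<close> expresses that \<open>E\<close> is presented by the generators \<open>X g\<close> and the relations
  \<open>rel\<close>. It turns lifted generators into a homomorphism, and perfectness gives uniqueness.\<close>

lemma universal_central_extensionI:
  fixes p :: "'e \<Rightarrow> 'g"
  assumes ext: "central_extension E G p"
    and perfect: "carrier E \<subseteq> derived E (carrier E)"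
    and gens: "generate E (X ` S) = carrier E"
    and univ: "\<And>(H :: 'h monoid) Y. group H \<Longrightarrow> satisfies S rel H Y \<Longrightarrow>
      \<exists>\<phi> \<in> hom E H. \<forall>g \<in> S. \<phi> (X g) = Y g"
    and lift: "\<And>(H :: 'h monoid) \<epsilon>. central_extension H G \<epsilon> \<Longrightarrow>
      \<exists>Y. satisfies S rel H Y \<and> (\<forall>g \<in> S. \<epsilon> (Y g) = p (X g))"
  shows "universal_central_extension TYPE('h) E G p"
  unfolding universal_central_extension_def
proof (intro conjI allI impI)
  fix H :: "'h monoid" and \<epsilon> assume H: "central_extension H G \<epsilon>"
  interpret H: central_ext H G \<epsilon> using H by (simp add: central_extension_iff)
  interpret E: central_ext E G p using ext by (simp add: central_extension_iff)
  obtain Y where Y: "satisfies S rel H Y" "\<And>g. g \<in> S \<Longrightarrow> \<epsilon> (Y g) = p (X g)"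
    using lift[OF H] by blast
  obtain \<phi> where \<phi>: "\<phi> \<in> hom E H" "\<And>g. g \<in> S \<Longrightarrow> \<phi> (X g) = Y g"
    using univ[OF H.H.group_axioms Y(1)] by blast
  interpret \<phi>: group_hom E H \<phi> by unfold_locales (rule \<phi>)
  have X_in: "X ` S \<subseteq> carrier E" using generate.incl[of _ "X ` S" E] gens by blast
  have comp: "group_hom E G (\<epsilon> \<circ> \<phi>)"
    using hom_compose[OF \<phi>(1) H.homh] by unfold_locales
  have \<epsilon>\<phi>: "\<epsilon> (\<phi> x) = p x" if "x \<in> carrier E" for x
  proof -
    have "(\<epsilon> \<circ> \<phi>) x = p x"
      by (rule hom_eq_on_generate[OF comp E.group_hom_axioms X_in]) (use Y(2) \<phi>(2) that gens in auto)
    then show ?thesis by simp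
  qed
  show "\<exists>!\<eta>. \<eta> \<in> hom E H \<inter> extensional (carrier E) \<and> (\<forall>x\<in>carrier E. \<epsilon> (\<eta> x) = p x)"
  proof (intro ex1I conjI)
    show "restrict \<phi> (carrier E) \<in> hom E H \<inter> extensional (carrier E)"
      using \<phi>(1) by (auto simp: hom_def)
    show "\<forall>x\<in>carrier E. \<epsilon> (restrict \<phi> (carrier E) x) = p x" using \<epsilon>\<phi> by simp
    fix \<eta> assume \<eta>: "\<eta> \<in> hom E H \<inter> extensional (carrier E) \<and> (\<forall>x\<in>carrier E. \<epsilon> (\<eta> x) = p x)"
    show "\<eta> = restrict \<phi> (carrier E)"
    proof
      fix x show "\<eta> x = restrict \<phi> (carrier E) x"
      proof (cases "x \<in> carrier E")
        case True
        then show ?thesis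
          using H.hom_eq_on_perfect[OF E.H.group_axioms perfect, of \<eta> \<phi> x] \<eta> \<phi>(1) \<epsilon>\<phi> by simp
      qed (use \<eta> in \<open>auto simp: extensional_def\<close>)
    qed
  qed
qed (rule ext)

text \<open>Both \<open>\<eta>\<close> and the identity are homomorphisms over \<open>\<pi>\<close>, and there is only one.\<close>

lemma universal_hom_identity:
  fixes U :: "'u monoid"
  assumes "universal_central_extension TYPE('u) U G \<pi>"
    and "\<eta> \<in> hom U U" and "\<And>x. x \<in> carrier U \<Longrightarrow> \<pi> (\<eta> x) = \<pi> x" and "x \<in> carrier U"
  shows "\<eta> x = x"
proof -
  have "central_extension U G \<pi>" using assms(1) by (simp add: universal_central_extension_def)
  then have ex1: "\<exists>!\<eta>. \<eta> \<in> hom U U \<inter> extensional (carrier U) \<and> (\<forall>x\<in>carrier U. \<pi> (\<eta> x) = \<pi> x)"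
    using assms(1) unfolding universal_central_extension_def by blast
  have "restrict \<eta> (carrier U) = restrict (\<lambda>x. x) (carrier U)"
  proof (rule ex1E[OF ex1])
    fix \<theta> assume \<theta>: "\<forall>y. y \<in> hom U U \<inter> extensional (carrier U) \<and> (\<forall>x\<in>carrier U. \<pi> (y x) = \<pi> x) \<longrightarrow> y = \<theta>"
    interpret U: group U using \<open>central_extension U G \<pi>\<close> by (simp add: central_extension_def)
    have "restrict \<eta> (carrier U) \<in> hom U U" "restrict (\<lambda>x. x) (carrier U) \<in> hom U U"
      using assms(2) by (auto simp: hom_def)
    then have "restrict \<eta> (carrier U) = \<theta>" "restrict (\<lambda>x. x) (carrier U) = \<theta>"
      using \<theta> assms(3) by (simp_all del: restrict_apply add: restrict_apply')
    then show ?thesis by simp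
  qed
  then show ?thesis using assms(4) by (metis restrict_apply')
qed

text \<open>Universality in both directions gives comparison maps between two universal central extensions,
  and by \<open>universal_hom_identity\<close> they are mutually inverse. Each of the three element types occurs: one for
  the statement itself, one for mapping to \<open>U\<close>, one for maps from \<open>E\<close> to itself.\<close>

lemma schur_multiplier_kernel:
  fixes E :: "'a monoid" and p :: "'a \<Rightarrow> 'g"
  assumes Eh: "universal_central_extension TYPE('h) E G p"
    and Eu: "universal_central_extension TYPE('u) E G p"
    and Ea: "universal_central_extension TYPE('a) E G p"
    and K: "K = kernel E G p"
  shows "schur_multiplier TYPE('h) TYPE('u) K E G p"
  unfolding schur_multiplier_def
proof (intro conjI allI impI)
  fix U :: "'u monoid" and \<pi>
  assume U: "universal_central_extension TYPE('u) U G \<pi> \<and> universal_central_extension TYPE('a) U G \<pi>"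
  have E_ext: "central_extension E G p" and U_ext: "central_extension U G \<pi>"
    using Eh U by (auto simp: universal_central_extension_def)
  interpret E: central_ext E G p using E_ext by (simp add: central_extension_iff)
  interpret U: central_ext U G \<pi> using U_ext by (simp add: central_extension_iff)
  obtain \<alpha> where \<alpha>: "\<alpha> \<in> hom E U" "\<And>x. x \<in> carrier E \<Longrightarrow> \<pi> (\<alpha> x) = p x"
    using Eu U_ext unfolding universal_central_extension_def by blast
  obtain \<beta> where \<beta>: "\<beta> \<in> hom U E" "\<And>x. x \<in> carrier U \<Longrightarrow> p (\<beta> x) = \<pi> x"
    using U E_ext unfolding universal_central_extension_def by blast
  have \<alpha>_in: "\<alpha> x \<in> carrier U" if "x \<in> carrier E" for x using \<alpha>(1) that by (auto simp: hom_def)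
  have \<beta>_in: "\<beta> x \<in> carrier E" if "x \<in> carrier U" for x using \<beta>(1) that by (auto simp: hom_def)
  have \<beta>\<alpha>: "\<beta> (\<alpha> x) = x" if "x \<in> carrier E" for x
    using universal_hom_identity[OF Ea, of "\<beta> \<circ> \<alpha>" x] hom_compose[OF \<alpha>(1) \<beta>(1)] \<alpha> \<beta> \<alpha>_in that by simp
  have \<alpha>\<beta>: "\<alpha> (\<beta> x) = x" if "x \<in> carrier U" for x
    using universal_hom_identity[of U G \<pi> "\<alpha> \<circ> \<beta>" x] U hom_compose[OF \<beta>(1) \<alpha>(1)] \<alpha> \<beta> \<beta>_in that by simp
  have "\<alpha> \<in> iso (E\<lparr>carrier := K\<rparr>) (U\<lparr>carrier := kernel U G \<pi>\<rparr>)"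
  proof (rule isoI)
    show "\<alpha> \<in> hom (E\<lparr>carrier := K\<rparr>) (U\<lparr>carrier := kernel U G \<pi>\<rparr>)"
      using \<alpha> \<alpha>_in by (auto simp: hom_def K kernel_def)
    show "bij_betw \<alpha> (carrier (E\<lparr>carrier := K\<rparr>)) (carrier (U\<lparr>carrier := kernel U G \<pi>\<rparr>))"
      by (rule bij_betw_byWitness[where f' = \<beta>])
        (use \<alpha> \<beta> \<alpha>_in \<beta>_in \<alpha>\<beta> \<beta>\<alpha> in \<open>auto simp: K kernel_def\<close>)
  qed
  then show "E\<lparr>carrier := K\<rparr> \<cong> U\<lparr>carrier := kernel U G \<pi>\<rparr>" by (rule is_isoI)
qed (use Eh K in auto)

section \<open>Odd quadratic spaces\<close>

context odd_quadratic_space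
begin

abbreviation lam :: 'r where "lam \<equiv> bar 1"
abbreviation mu :: 'r where "mu \<equiv> ring_inverse (bar 1)"

lemma lam_mu [simp]: "lam * mu = 1" "mu * lam = 1"
proof -
  obtain c where c: "bar 1 * c = 1" "c * bar 1 = 1" using bar_one_invertible by blast
  have "mu = c" unfolding ring_inverse_def
  proof (rule the_equality)
    show "bar 1 * c = 1 \<and> c * bar 1 = 1" using c by simp
    fix b assume b: "bar 1 * b = 1 \<and> b * bar 1 = 1"
    have "b = b * (bar 1 * c)" using c by simp
    also have "\<dots> = c" using b by (simp add: mult.assoc[symmetric])
    finally show "b = c" .
  qed
  with c show "lam * mu = 1" "mu * lam = 1" by simp_all
qed

lemma lam_mu_assoc [simp]: "lam * (mu * x) = x" "mu * (lam * x) = x"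
  by (simp_all add: mult.assoc[symmetric])

lemma bar_zero [simp]: "bar 0 = 0"
  using bar_add[of 0 0] by simp

lemma bar_minus [simp]: "bar (- a) = - bar a"
  using bar_add[of a "- a"] by (simp add: eq_neg_iff_add_eq_0 add.commute)

lemma bar_mu [simp]: "bar mu = lam * lam"
proof -
  have "lam = bar mu * mu" using bar_mult[of lam mu] by (simp add: bar_bar)
  then have "lam * lam = bar mu * mu * lam" by simp
  then show ?thesis by (simp add: mult.assoc)
qed

lemma form_zero [simp]: "B 0 v = 0" "B v 0 = 0"
  using form_add_left[of 0 0 v] form_add_right[of v 0 0] by simp_all

lemma form_minus [simp]: "B (- u) v = - B u v" "B u (- v) = - B u v"
  using form_add_left[of u "- u" v] form_add_right[of u v "- v"]
  by (simp_all add: eq_neg_iff_add_eq_0 add.commute)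

lemma form_diff: "B (u - u') v = B u v - B u' v" "B u (v - v') = B u v - B u v'"
  using form_add_left[of u "- u'" v] form_add_right[of u v "- v'"] by simp_all

lemma bar_form: "bar (B u v) = - B v u"
  using form_anti[of v u] by simp

lemma act_zero [simp]: "act 0 a = 0" "act u 0 = 0"
  using act_add_left[of 0 0 a] act_add_right[of u 0 0] by simp_all

lemma act_minus [simp]: "act (- u) a = - act u a" "act u (- a) = - act u a"
  using act_add_left[of u "- u" a] act_add_right[of u a "- a"]
  by (simp_all add: eq_neg_iff_add_eq_0 add.commute)

lemma form_act_right: "B u (act v b) = B u v * b"
  using form_act[of u 1 v b] by (simp add: act_one)

lemma form_act_left: "B (act u a) v = bar a * mu * B u v"
  using form_act[of u a v 1] by (simp add: act_one)

abbreviation hadd :: "'v \<times> 'r \<Rightarrow> 'v \<times> 'r \<Rightarrow> 'v \<times> 'r"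
  where "hadd \<xi> \<zeta> \<equiv> \<xi> \<otimes>\<^bsub>heisenberg B\<^esub> \<zeta>"

abbreviation hact :: "'v \<times> 'r \<Rightarrow> 'r \<Rightarrow> 'v \<times> 'r"
  where "hact \<equiv> heisenberg_act bar act"

lemma hadd_def: "hadd \<xi> \<zeta> = (fst \<xi> + fst \<zeta>, snd \<xi> + snd \<zeta> + B (fst \<xi>) (fst \<zeta>))"
  by (simp add: heisenberg_def split_beta)

lemma group_heisenberg: "group (heisenberg B)"
proof (rule groupI)
  fix x :: "'v \<times> 'r"
  show "\<exists>y\<in>carrier (heisenberg B). y \<otimes>\<^bsub>heisenberg B\<^esub> x = \<one>\<^bsub>heisenberg B\<^esub>"
    by (rule bexI[of _ "(- fst x, - snd x + B (fst x) (fst x))"]) (auto simp: heisenberg_def split_beta)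
qed (auto simp: heisenberg_def split_beta form_add_left form_add_right algebra_simps)

lemma hadd_in: "\<xi> \<in> L \<Longrightarrow> \<zeta> \<in> L \<Longrightarrow> hadd \<xi> \<zeta> \<in> L"
  using param_subgroup by (rule subgroup.m_closed)

lemma zero_in: "(0, 0) \<in> L"
  using subgroup.one_closed[OF param_subgroup] by (simp add: heisenberg_def)

lemma hact_in: "\<xi> \<in> L \<Longrightarrow> hact \<xi> b \<in> L"
  by (rule param_act)

text \<open>In \<open>L\<close> the element \<open>(u, - bar a)\<close> is the inverse of \<open>(u, a)\<close>, acted upon by \<open>-1\<close>. The map is
  the twist that occurs when a long root element is moved to another long root.\<close>

definition flip :: "'v \<times> 'r \<Rightarrow> 'v \<times> 'r"
  where "flip \<xi> = (fst \<xi>, - bar (snd \<xi>))"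

lemma heisenberg_inv: "inv\<^bsub>heisenberg B\<^esub> \<xi> = (- fst \<xi>, - snd \<xi> + B (fst \<xi>) (fst \<xi>))"
proof -
  interpret group "heisenberg B" by (rule group_heisenberg)
  show ?thesis by (rule inv_equality) (auto simp: heisenberg_def split_beta)
qed

lemma hinv_in: "\<xi> \<in> L \<Longrightarrow> (- fst \<xi>, - snd \<xi> + B (fst \<xi>) (fst \<xi>)) \<in> L"
  using subgroup.m_inv_closed[OF param_subgroup, of \<xi>] by (simp add: heisenberg_inv)

lemma in_L_snd: "\<xi> \<in> L \<Longrightarrow> snd \<xi> = bar (snd \<xi>) + B (fst \<xi>) (fst \<xi>)"
  using param_max by (auto simp: L_max_def)

lemma flip_in: assumes "\<xi> \<in> L" shows "flip \<xi> \<in> L"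
proof -
  have "hact (- fst \<xi>, - snd \<xi> + B (fst \<xi>) (fst \<xi>)) (- 1) \<in> L"
    using assms by (intro hact_in hinv_in)
  moreover have "- snd \<xi> + B (fst \<xi>) (fst \<xi>) = - bar (snd \<xi>)"
    using in_L_snd[OF assms] by (metis add.commute add_diff_cancel_right' minus_diff_eq uminus_add_conv_diff)
  ultimately show ?thesis by (simp add: heisenberg_act_def flip_def act_one)
qed

lemma fst_flip [simp]: "fst (flip \<xi>) = fst \<xi>"
  and snd_flip [simp]: "snd (flip \<xi>) = - bar (snd \<xi>)"
  and flip_flip [simp]: "flip (flip \<xi>) = \<xi>"
  by (simp_all add: flip_def bar_bar)

lemma flip_hadd: "flip (hadd \<xi> \<zeta>) = hadd (flip \<zeta>) (flip \<xi>)"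
  by (simp add: flip_def hadd_def bar_add bar_form algebra_simps)

lemma hact_one [simp]: "hact \<xi> 1 = \<xi>"
  by (simp add: heisenberg_act_def act_one)

lemma flip_hact: "flip (hact \<xi> b) = hact (flip \<xi>) b"
  by (simp add: flip_def heisenberg_act_def bar_mult bar_bar mult.assoc)

lemma fst_hact [simp]: "fst (hact \<xi> b) = act (fst \<xi>) b"
  and snd_hact [simp]: "snd (hact \<xi> b) = bar b * mu * snd \<xi> * b"
  by (simp_all add: heisenberg_act_def)

text \<open>The second component of the parameter on the right-hand side of R9, which depends only on the
  product \<open>c = a b\<close>.\<close>

definition nu :: "int \<Rightarrow> 'r \<Rightarrow> 'r"
  where "nu i c = - (eps (- i) * lam * c) + bar c * eps i"

lemma nu_trace: "i \<noteq> 0 \<Longrightarrow> \<exists>g. nu i c = g + bar g"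
proof (cases "i > 0")
  case True
  then show ?thesis
    by (intro exI[of _ "lam * c"]) (simp add: nu_def eps_def bar_mult bar_bar)
qed (intro exI[of _ "- c"], simp add: nu_def eps_def bar_mult bar_bar mult.assoc[symmetric])

lemma nu_in: "i \<noteq> 0 \<Longrightarrow> (0, nu i c) \<in> L"
  using nu_trace[of i c] param_min by (auto simp: L_min_def)

lemma bar_nu: "i \<noteq> 0 \<Longrightarrow> bar (nu i c) = nu i c"
  using nu_trace[of i c] by (auto simp: bar_add bar_bar add.commute)

lemma R9_parameter: "- (eps (-i) * bar 1 * a * b) + bar b * ring_inverse (bar 1) * bar a * eps i = nu i (a * b)"
  by (simp add: nu_def bar_mult mult.assoc)

lemma form_commutator_in: "\<xi> \<in> L \<Longrightarrow> \<zeta> \<in> L \<Longrightarrow> (0, B (fst \<xi>) (fst \<zeta>) - B (fst \<zeta>) (fst \<xi>)) \<in> L"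
  using param_min by (auto simp: L_min_def bar_form intro!: exI[of _ "B (fst \<xi>) (fst \<zeta>)"])

lemma eps_mult: "i \<noteq> 0 \<Longrightarrow> eps i * eps (- i) = - mu" "i \<noteq> 0 \<Longrightarrow> eps i * (eps (- i) * x) = - (mu * x)"
  by (auto simp: eps_def)

lemma nu_change: "i \<noteq> 0 \<Longrightarrow> k \<noteq> 0 \<Longrightarrow> nu k (eps k * lam * eps (- i) * c) = - nu i c"
  by (auto simp: nu_def eps_def bar_mult bar_bar mult.assoc algebra_simps)

lemma nu_eps: "i \<noteq> 0 \<Longrightarrow> k \<noteq> 0 \<Longrightarrow> eps k * nu i c = eps k * bar c * eps i - eps k * lam * eps (- i) * c"
  by (auto simp: nu_def eps_def mult.assoc algebra_simps)

lemma eps_flip_aux: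
  "i \<noteq> 0 \<Longrightarrow> k \<noteq> 0 \<Longrightarrow> m \<noteq> 0 \<Longrightarrow>
    eps i * bar (- (eps (- m) * bar (eps k * lam * eps (- i) * c) * eps k)) * eps (- m) = c"
  by (auto simp: eps_def bar_mult bar_bar mult.assoc)

lemma eps_act_aux:
  "i \<noteq> 0 \<Longrightarrow> eps k * bar (eps i * s * b) * eps i * b = eps k * (bar b * mu * bar s * b)"
  by (auto simp: eps_def bar_mult bar_bar mult.assoc)

lemma nu_act_aux:
  "i \<noteq> 0 \<Longrightarrow> j \<noteq> 0 \<Longrightarrow>
    bar b * mu * s * b + nu (- j) (eps (- j) * bar b * eps (- i) * (eps i * s * b)) = - (bar b * mu * bar s * b)"
  by (auto simp: nu_def eps_def bar_mult bar_bar mult.assoc)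

end

text \<open>The hyperbolic plane spanned by \<open>e\<^sub>i\<close> and \<open>e\<^sub>-\<^sub>i\<close>. The side condition \<open>i \<notin> {j, - j}\<close> becomes the
  symmetric condition that two planes are different, which is insensitive to signs.\<close>

definition plane :: "int \<Rightarrow> nat"
  where "plane i = nat \<bar>i\<bar>"

lemma plane_minus [simp]: "plane (- i) = plane i"
  by (simp add: plane_def)

lemma plane_eq_iff: "plane i = plane j \<longleftrightarrow> i = j \<or> i = - j"
  by (auto simp: plane_def)

lemma plane_neD:
  assumes "plane i \<noteq> plane j"
  shows "i \<noteq> j \<and> i \<noteq> - j \<and> - i \<noteq> j \<and> j \<noteq> i \<and> j \<noteq> - i \<and> - j \<noteq> i"
  using assms by (auto simp: plane_eq_iff)

section \<open>Families of elements satisfying the Steinberg relations\<close>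

(* Inequations between indices are settled by rewriting. Splitting each of them into two strict
   inequalities would take time exponential in their number. *)
declare [[linarith_neq_limit = 0]]

definition root_gens :: "('v \<times> 'r) set \<Rightarrow> int set \<Rightarrow> ('r, 'v) steinberg_gen set"
  where "root_gens L \<Omega> =
    {X2 i j a | i j a. i \<in> \<Omega> \<and> j \<in> \<Omega> \<and> i \<notin> {j, -j}} \<union> {X1 i \<xi> | i \<xi>. i \<in> \<Omega> \<and> \<xi> \<in> L}"

text \<open>The defining relations as equations between commutators, with the parameters of R8 and R9
  expressed by \<open>flip\<close> and \<open>nu\<close>. The relation R7 is derived in \<open>x1_x1_same\<close>.\<close>

locale steinberg_family = odd_quadratic_space bar act B L + group G
  for bar :: "'r::{ring,monoid_mult} \<Rightarrow> 'r" and act :: "'v::ab_group_add \<Rightarrow> 'r \<Rightarrow> 'v"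
    and B L and G :: "'g monoid" (structure) +
  fixes \<Omega> :: "int set" and x2 :: "int \<Rightarrow> int \<Rightarrow> 'r \<Rightarrow> 'g" and x1 :: "int \<Rightarrow> 'v \<times> 'r \<Rightarrow> 'g"
  assumes zero_notin: "0 \<notin> \<Omega>" and neg_in: "i \<in> \<Omega> \<Longrightarrow> - i \<in> \<Omega>"
    and x2_closed [simp]: "i \<in> \<Omega> \<Longrightarrow> j \<in> \<Omega> \<Longrightarrow> plane i \<noteq> plane j \<Longrightarrow> x2 i j a \<in> carrier G"
    and x1_closed [simp]: "i \<in> \<Omega> \<Longrightarrow> \<xi> \<in> L \<Longrightarrow> x1 i \<xi> \<in> carrier G"
    and x2_flip: "i \<in> \<Omega> \<Longrightarrow> j \<in> \<Omega> \<Longrightarrow> plane i \<noteq> plane j \<Longrightarrow>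
      x2 i j a = x2 (-j) (-i) (eps (-j) * bar a * eps i)"
    and x2_add: "i \<in> \<Omega> \<Longrightarrow> j \<in> \<Omega> \<Longrightarrow> plane i \<noteq> plane j \<Longrightarrow> x2 i j a \<otimes> x2 i j b = x2 i j (a + b)"
    and x1_add: "i \<in> \<Omega> \<Longrightarrow> \<xi> \<in> L \<Longrightarrow> \<zeta> \<in> L \<Longrightarrow> x1 i \<xi> \<otimes> x1 i \<zeta> = x1 i (hadd \<xi> \<zeta>)"
    and x2_x2_commute: "i \<in> \<Omega> \<Longrightarrow> j \<in> \<Omega> \<Longrightarrow> plane i \<noteq> plane j \<Longrightarrow> h \<in> \<Omega> \<Longrightarrow> k \<in> \<Omega> \<Longrightarrow> plane h \<noteq> plane k \<Longrightarrow>
      h \<noteq> j \<Longrightarrow> h \<noteq> - i \<Longrightarrow> k \<noteq> i \<Longrightarrow> k \<noteq> - j \<Longrightarrow> commutator G (x2 i j a) (x2 h k b) = \<one>"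
    and x1_x2_commute: "i \<in> \<Omega> \<Longrightarrow> \<xi> \<in> L \<Longrightarrow> j \<in> \<Omega> \<Longrightarrow> k \<in> \<Omega> \<Longrightarrow> plane j \<noteq> plane k \<Longrightarrow>
      j \<noteq> - i \<Longrightarrow> k \<noteq> i \<Longrightarrow> commutator G (x1 i \<xi>) (x2 j k a) = \<one>"
    and x2_x2: "i \<in> \<Omega> \<Longrightarrow> j \<in> \<Omega> \<Longrightarrow> k \<in> \<Omega> \<Longrightarrow> plane i \<noteq> plane j \<Longrightarrow> plane j \<noteq> plane k \<Longrightarrow> plane i \<noteq> plane k \<Longrightarrow>
      commutator G (x2 i j a) (x2 j k b) = x2 i k (a * b)"
    and x1_x1: "i \<in> \<Omega> \<Longrightarrow> j \<in> \<Omega> \<Longrightarrow> plane i \<noteq> plane j \<Longrightarrow> \<xi> \<in> L \<Longrightarrow> \<zeta> \<in> L \<Longrightarrow>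
      commutator G (x1 i \<xi>) (x1 j \<zeta>) = x2 i (-j) (eps i * B (fst \<xi>) (fst \<zeta>))"
    and x1_x2: "i \<in> \<Omega> \<Longrightarrow> j \<in> \<Omega> \<Longrightarrow> plane i \<noteq> plane j \<Longrightarrow> \<xi> \<in> L \<Longrightarrow>
      commutator G (x1 i \<xi>) (x2 (-i) j b) = x2 i j (eps i * snd \<xi> * b) \<otimes> x1 (-j) (hact (flip \<xi>) b)"
    and x2_x2_long: "i \<in> \<Omega> \<Longrightarrow> j \<in> \<Omega> \<Longrightarrow> plane i \<noteq> plane j \<Longrightarrow>
      commutator G (x2 i j a) (x2 j (-i) b) = x1 i (0, nu i (a * b))"
begin

lemma neg_in_iff [simp]: "- i \<in> \<Omega> \<longleftrightarrow> i \<in> \<Omega>"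
  using neg_in[of i] neg_in[of "- i"] by auto

lemma nonzero: "i \<in> \<Omega> \<Longrightarrow> i \<noteq> 0"
  using zero_notin by auto

lemma x2_zero: assumes "i \<in> \<Omega>" "j \<in> \<Omega>" "plane i \<noteq> plane j" shows "x2 i j 0 = \<one>"
  using x2_add[OF assms, of 0 0] assms by (simp add: r_cancel_one)

lemma x2_inv: assumes "i \<in> \<Omega>" "j \<in> \<Omega>" "plane i \<noteq> plane j" shows "inv (x2 i j a) = x2 i j (- a)"
  using assms by (intro inv_equality) (simp_all add: x2_add x2_zero)

lemma x1_zero: assumes "i \<in> \<Omega>" shows "x1 i (0, 0) = \<one>"
  using x1_add[OF assms zero_in zero_in] assms by (simp add: r_cancel_one hadd_def zero_in)

lemma x1_inv:
  assumes "i \<in> \<Omega>" "\<xi> \<in> L"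
  shows "inv (x1 i \<xi>) = x1 i (- fst \<xi>, - snd \<xi> + B (fst \<xi>) (fst \<xi>))"
  using assms hinv_in[OF assms(2)] by (intro inv_equality) (simp_all add: x1_add x1_zero hadd_def)

text \<open>The relation R7 follows from R2: the sums of \<open>\<xi>\<close> and \<open>\<zeta>\<close> in the two orders differ by the element
  \<open>(0, B u v - B v u)\<close> of the Heisenberg group, where \<open>u\<close> and \<open>v\<close> are the vectors of \<open>\<xi>\<close> and \<open>\<zeta>\<close>.\<close>

lemma x1_x1_same:
  assumes "i \<in> \<Omega>" "\<xi> \<in> L" "\<zeta> \<in> L"
  shows "commutator G (x1 i \<xi>) (x1 i \<zeta>) = x1 i (0, B (fst \<xi>) (fst \<zeta>) - B (fst \<zeta>) (fst \<xi>))"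
  using assms form_commutator_in[of \<xi> \<zeta>] hadd_in[of \<xi> \<zeta>] hadd_in[of \<zeta> \<xi>]
  by (simp add: commutator_eq_iff x1_add hadd_def algebra_simps)

end

context odd_quadratic_space
begin

lemma steinberg_gens_eq: "steinberg_gens n = root_gens L (Omega n)"
  by (simp add: steinberg_gens_def root_gens_def)

lemma X2_in_root_gens: "X2 i j a \<in> root_gens L \<Omega> \<longleftrightarrow> i \<in> \<Omega> \<and> j \<in> \<Omega> \<and> plane i \<noteq> plane j"
  by (auto simp: root_gens_def plane_eq_iff)

lemma X1_in_root_gens: "X1 i \<xi> \<in> root_gens L \<Omega> \<longleftrightarrow> i \<in> \<Omega> \<and> \<xi> \<in> L"
  by (cases \<xi>) (auto simp: root_gens_def)

lemma eval_comm_word: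
  assumes "group G" "f g \<in> carrier G" "f h \<in> carrier G"
  shows "eval_word G f (comm_word g h) = commutator G (f g) (f h)"
proof -
  interpret group G by fact
  show ?thesis using assms by (simp add: comm_word_def commutator_def m_assoc)
qed

text \<open>A relation counts in the presentation only if all its symbols are generators. The parameters on
  the right-hand sides lie in \<open>L\<close> whenever those on the left do, so no relation is lost.\<close>

lemma steinberg_family_iff:
  fixes G :: "'g monoid"
  assumes "0 \<notin> \<Omega>" "\<And>i. i \<in> \<Omega> \<Longrightarrow> - i \<in> \<Omega>"
  shows "steinberg_family bar act B L G \<Omega> (\<lambda>i j a. X (X2 i j a)) (\<lambda>i \<xi>. X (X1 i \<xi>)) \<longleftrightarrow>
    group G \<and> satisfies (root_gens L \<Omega>) steinberg_rel G X"
    (is "?fam \<longleftrightarrow> _")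
proof
  let ?S = "root_gens L \<Omega>"
  have neg: "- i \<in> \<Omega> \<longleftrightarrow> i \<in> \<Omega>" for i using assms(2)[of i] assms(2)[of "- i"] by auto
  {
    assume a: "group G \<and> satisfies ?S steinberg_rel G X"
    interpret group G using a by simp
    have X: "X g \<in> carrier G" if "g \<in> ?S" for g using a that by (auto simp: satisfies_def)
    have rel: "eval_word G X v = eval_word G X w"
      if "steinberg_rel v w" "v \<in> lists (letters ?S)" "w \<in> lists (letters ?S)" for v w
      using a that by (simp add: satisfies_def)
    have lists_comm: "comm_word g h \<in> lists (letters ?S) \<longleftrightarrow> g \<in> ?S \<and> h \<in> ?S" for g h
      by (auto simp: comm_word_def)
    note mem = X2_in_root_gens X1_in_root_gens
    show ?fam
    proof (unfold_locales, goal_cases)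
      case (5 i j a)
      then show ?case using rel[OF R0[of i j a]] by (simp add: X mem neg)
    next
      case (6 i j a b)
      then show ?case using rel[OF R1[of i j a b]] by (simp add: X mem)
    next
      case (7 i \<xi> \<zeta>)
      then show ?case using rel[OF R2[of i \<xi> \<zeta>]] by (simp add: X mem hadd_in)
    next
      case (8 i j h k a b)
      then show ?case using rel[OF R3[of h j i k a b]] lists_comm
        by (simp add: eval_comm_word group_axioms X mem)
    next
      case (9 i \<xi> j k a)
      then show ?case using rel[OF R4[of j i k \<xi> a]] lists_comm
        by (simp add: eval_comm_word group_axioms X mem)
    next
      case (10 i j k a b)
      then show ?case using rel[OF R5[of i j a k b]] lists_comm
        by (simp add: eval_comm_word group_axioms X mem)
    next
      case (11 i j \<xi> \<zeta>)
      then have ij: "i \<notin> {j, - j}" by auto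
      from 11 show ?case
        using rel[OF R6[OF ij, of "fst \<xi>" "snd \<xi>" "fst \<zeta>" "snd \<zeta>"]] lists_comm
        by (simp add: eval_comm_word group_axioms X mem neg)
    next
      case (12 i j \<xi> b)
      then show ?case
        using rel[OF R8[of i "fst \<xi>" "snd \<xi>" j b]] lists_comm hact_in[OF flip_in[OF 12(4)], of b]
        by (simp add: eval_comm_word group_axioms X mem neg flip_def)
    next
      case (13 i j a b)
      then have "i \<noteq> 0" using assms by auto
      from 13 this show ?case
        using rel[OF R9[of i j a b, unfolded R9_parameter]] lists_comm nu_in[OF \<open>i \<noteq> 0\<close>]
        by (simp add: eval_comm_word group_axioms X mem neg)
    qed (auto simp: X mem assms)
  }
  {
    assume ?fam
    then interpret F: steinberg_family bar act B L G \<Omega> "\<lambda>i j a. X (X2 i j a)" "\<lambda>i \<xi>. X (X1 i \<xi>)" .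
    have X: "X g \<in> carrier G" if "g \<in> ?S" for g using that by (auto simp: root_gens_def plane_eq_iff)
    have lists_comm: "comm_word g h \<in> lists (letters ?S) \<longleftrightarrow> g \<in> ?S \<and> h \<in> ?S" for g h
      by (auto simp: comm_word_def)
    note mem = X2_in_root_gens X1_in_root_gens
    have "eval_word G X v = eval_word G X w"
      if "steinberg_rel v w" "v \<in> lists (letters ?S)" "w \<in> lists (letters ?S)" for v w
      using that
    proof (induction rule: steinberg_rel.induct)
      case (R0 i j a)
      then show ?case using F.x2_flip[of i j a] by (simp add: mem)
    next
      case (R1 i j a b)
      then show ?case by (simp add: mem F.x2_add)
    next
      case (R2 i \<xi> \<zeta>)
      then show ?case by (simp add: mem F.x1_add)
    next
      case (R3 h j i k a b)
      then show ?case using F.x2_x2_commute[of i j h k a b]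
        by (simp add: eval_comm_word F.group_axioms lists_comm mem)
    next
      case (R4 j i k \<xi> a)
      then show ?case using F.x1_x2_commute[of i \<xi> j k a]
        by (simp add: eval_comm_word F.group_axioms lists_comm mem)
    next
      case (R5 i j a k b)
      then show ?case
        by (simp add: eval_comm_word F.group_axioms lists_comm mem F.x2_x2)
    next
      case (R6 i j u a v b)
      then show ?case
        by (simp add: eval_comm_word F.group_axioms lists_comm mem F.x1_x1)
    next
      case (R7 i u a v b)
      then show ?case
        by (simp add: eval_comm_word F.group_axioms lists_comm mem F.x1_x1_same)
    next
      case (R8 i u a j b)
      then show ?case using F.x1_x2[of i j "(u, a)" b]
        by (simp add: eval_comm_word F.group_axioms lists_comm mem flip_def)
    next
      case (R9 i j a b)
      then show ?case unfolding R9_parameter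
        by (simp add: eval_comm_word F.group_axioms lists_comm mem F.x2_x2_long)
    qed
    then show "group G \<and> satisfies ?S steinberg_rel G X"
      using X F.group_axioms by (auto simp: satisfies_def)
  }
qed

end

section \<open>Lifting Steinberg relations to central extensions\<close>

text \<open>The two root elements in a relation involve at most four planes. The hypothesis \<open>fresh\<close> provides
  a further plane, through which one of them can be written as a commutator.\<close>

locale steinberg_lift = central_ext H G \<epsilon> + steinberg_family bar act B L G \<Omega> x2 x1
  for bar :: "'r::{ring,monoid_mult} \<Rightarrow> 'r" and act :: "'v::ab_group_add \<Rightarrow> 'r \<Rightarrow> 'v"
    and B L and H :: "'h monoid" and G :: "'g monoid" and \<epsilon> \<Omega> x2 x1 +
  assumes fresh: "\<exists>m\<in>\<Omega>. plane m \<noteq> plane i \<and> plane m \<noteq> plane j \<and> plane m \<noteq> plane h \<and> plane m \<noteq> plane k"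
begin

subsection \<open>Short roots\<close>

text \<open>With a fresh index \<open>m\<close> the second element is a commutator of \<open>x\<^sub>h\<^sub>m(b)\<close> and \<open>x\<^sub>m\<^sub>k(1)\<close>, both of which
  commute with the first element in \<open>G\<close>.\<close>

lemma cc_x2_x2:
  assumes "i \<in> \<Omega>" "j \<in> \<Omega>" "plane i \<noteq> plane j" "h \<in> \<Omega>" "k \<in> \<Omega>" "plane h \<noteq> plane k"
    and "h \<noteq> j" "h \<noteq> - i" "k \<noteq> i" "k \<noteq> - j"
  shows "cc (x2 i j a) (x2 h k b)"
proof -
  obtain m where m: "m \<in> \<Omega>" "plane m \<noteq> plane i" "plane m \<noteq> plane j" "plane m \<noteq> plane h" "plane m \<noteq> plane k"
    using fresh[of i j h k] by blast
  note ne = m(2-5)[THEN plane_neD]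
  have "cc (x2 i j a) (commutator G (x2 h m b) (x2 m k 1))"
  proof (rule cc_commutator)
    show "commutator G (x2 i j a) (x2 h m b) = \<one>\<^bsub>G\<^esub>" "commutator G (x2 i j a) (x2 m k 1) = \<one>\<^bsub>G\<^esub>"
      using assms m ne by (simp_all add: x2_x2_commute)
  qed (use assms m in auto)
  then show ?thesis using assms m by (simp add: x2_x2)
qed

lemma cc_x1_x2:
  assumes "i \<in> \<Omega>" "\<xi> \<in> L" "j \<in> \<Omega>" "k \<in> \<Omega>" "plane j \<noteq> plane k" "j \<noteq> - i" "k \<noteq> i"
  shows "cc (x1 i \<xi>) (x2 j k a)"
proof -
  obtain m where m: "m \<in> \<Omega>" "plane m \<noteq> plane i" "plane m \<noteq> plane j" "plane m \<noteq> plane k"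
    using fresh[of i j k k] by blast
  note ne = m(2-4)[THEN plane_neD]
  have "cc (x1 i \<xi>) (commutator G (x2 j m a) (x2 m k 1))"
  proof (rule cc_commutator)
    show "commutator G (x1 i \<xi>) (x2 j m a) = \<one>\<^bsub>G\<^esub>" "commutator G (x1 i \<xi>) (x2 m k 1) = \<one>\<^bsub>G\<^esub>"
      using assms m ne by (simp_all add: x1_x2_commute)
  qed (use assms m in auto)
  then show ?thesis using assms m by (simp add: x2_x2)
qed

lemmas cc_x2_x1 = cc_x1_x2[THEN cc_sym]

text \<open>Both sides arise from \<open>x\<^sub>i\<^sub>m(a)\<close>, \<open>x\<^sub>m\<^sub>j(b)\<close> and \<open>x\<^sub>j\<^sub>k(c)\<close> by bracketing to the right or to the left.\<close>

lemma cl_x2_shift: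
  assumes "i \<in> \<Omega>" "j \<in> \<Omega>" "k \<in> \<Omega>" "m \<in> \<Omega>"
    "plane i \<noteq> plane j" "plane i \<noteq> plane k" "plane i \<noteq> plane m" "plane j \<noteq> plane k" "plane j \<noteq> plane m" "plane k \<noteq> plane m"
  shows "cl (x2 i m a) (x2 m k (b * c)) = cl (x2 i j (a * b)) (x2 j k c)"
proof -
  note ne = assms(5-10)[THEN plane_neD] assms(1-4)[THEN nonzero]
  have "cl (x2 i m a) (commutator G (x2 m j b) (x2 j k c)) =
      cl (commutator G (x2 i m a) (x2 m j b)) (x2 j k c)"
    by (rule cl_hall) (use assms ne in \<open>simp_all add: x2_x2 cc_x2_x2\<close>)
  then show ?thesis using assms by (simp add: x2_x2)
qed

definition fresh_index :: "int \<Rightarrow> int \<Rightarrow> int"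
  where "fresh_index i j = (SOME m. m \<in> \<Omega> \<and> plane m \<noteq> plane i \<and> plane m \<noteq> plane j)"

lemma fresh_index: "fresh_index i j \<in> \<Omega>" "plane (fresh_index i j) \<noteq> plane i" "plane (fresh_index i j) \<noteq> plane j"
proof -
  have "\<exists>m. m \<in> \<Omega> \<and> plane m \<noteq> plane i \<and> plane m \<noteq> plane j" using fresh[of i i j j] by blast
  from someI_ex[OF this] show "fresh_index i j \<in> \<Omega>" "plane (fresh_index i j) \<noteq> plane i" "plane (fresh_index i j) \<noteq> plane j"
    by (simp_all add: fresh_index_def)
qed

definition y2 :: "int \<Rightarrow> int \<Rightarrow> 'r \<Rightarrow> 'h"
  where "y2 i j a = cl (x2 i (fresh_index i j) 1) (x2 (fresh_index i j) j a)"

text \<open>Shifting \<open>a\<close> to the second entry gives a commutator that depends on \<open>a b\<close> only. The intermediate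
  index \<open>l\<close> is there because \<open>j\<close> and the chosen index may lie in the same plane.\<close>

lemma cl_x2_x2:
  assumes "i \<in> \<Omega>" "j \<in> \<Omega>" "k \<in> \<Omega>" "plane i \<noteq> plane j" "plane j \<noteq> plane k" "plane i \<noteq> plane k"
  shows "cl (x2 i j a) (x2 j k b) = y2 i k (a * b)"
proof -
  let ?m = "fresh_index i k"
  obtain l where l: "l \<in> \<Omega>" "plane l \<noteq> plane i" "plane l \<noteq> plane j" "plane l \<noteq> plane k" "plane l \<noteq> plane ?m"
    using fresh[of i j k ?m] by blast
  have "cl (x2 i j a) (x2 j k b) = cl (x2 i l a) (x2 l k b)"
    using cl_x2_shift[of i l k j a 1 b] assms l by simp
  also have "\<dots> = y2 i k (a * b)"
    using cl_x2_shift[of i l k ?m 1 a b] assms l fresh_index[of i k] by (simp add: y2_def)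
  finally show ?thesis .
qed

lemma y2_closed [simp]: "i \<in> \<Omega> \<Longrightarrow> j \<in> \<Omega> \<Longrightarrow> plane i \<noteq> plane j \<Longrightarrow> y2 i j a \<in> carrier H"
  using fresh_index[of i j] by (simp add: y2_def)

lemma hom_y2 [simp]: "i \<in> \<Omega> \<Longrightarrow> j \<in> \<Omega> \<Longrightarrow> plane i \<noteq> plane j \<Longrightarrow> \<epsilon> (y2 i j a) = x2 i j a"
  using fresh_index[of i j] by (simp add: y2_def x2_x2)

lemma y2_add:
  assumes "i \<in> \<Omega>" "j \<in> \<Omega>" "plane i \<noteq> plane j"
  shows "y2 i j a \<odot> y2 i j b = y2 i j (a + b)"
proof -
  let ?m = "fresh_index i j"
  have m: "?m \<in> \<Omega>" "plane ?m \<noteq> plane i" "plane ?m \<noteq> plane j" by (rule fresh_index)+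
  note ne = m(2,3)[THEN plane_neD] assms(3)[THEN plane_neD] assms(1,2)[THEN nonzero]
  have "cl (x2 i ?m 1) (x2 ?m j a \<otimes>\<^bsub>G\<^esub> x2 ?m j b) = cl (x2 i ?m 1) (x2 ?m j a) \<odot> cl (x2 i ?m 1) (x2 ?m j b)"
    by (rule cl_mult_right) (use assms m ne in \<open>simp_all add: x2_x2 cc_x2_x2\<close>)
  then show ?thesis using assms m by (simp add: y2_def x2_add)
qed

lemma y2_zero: "i \<in> \<Omega> \<Longrightarrow> j \<in> \<Omega> \<Longrightarrow> plane i \<noteq> plane j \<Longrightarrow> y2 i j 0 = \<one>\<^bsub>H\<^esub>"
  using y2_add[of i j 0 0] by (simp add: H.r_cancel_one)

lemma y2_inv: "i \<in> \<Omega> \<Longrightarrow> j \<in> \<Omega> \<Longrightarrow> plane i \<noteq> plane j \<Longrightarrow> inv\<^bsub>H\<^esub> (y2 i j a) = y2 i j (- a)"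
  by (intro H.inv_equality) (simp_all add: y2_add y2_zero)

text \<open>Applying R0 to the two entries of the defining commutator interchanges their roles. The sign from
  this interchange is cancelled by \<open>\<epsilon>\<^sub>m \<epsilon>\<^sub>-\<^sub>m bar 1 = - 1\<close>.\<close>

lemma y2_flip:
  assumes "i \<in> \<Omega>" "j \<in> \<Omega>" "plane i \<noteq> plane j"
  shows "y2 i j a = y2 (-j) (-i) (eps (-j) * bar a * eps i)"
proof -
  let ?m = "fresh_index i j"
  have m: "?m \<in> \<Omega>" "plane ?m \<noteq> plane i" "plane ?m \<noteq> plane j" by (rule fresh_index)+
  have "y2 i j a = inv\<^bsub>H\<^esub> (cl (x2 ?m j a) (x2 i ?m 1))"
    using assms m by (simp add: y2_def cl_swap)
  also have "cl (x2 ?m j a) (x2 i ?m 1)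
    = cl (x2 (-j) (-?m) (eps (-j) * bar a * eps ?m)) (x2 (-?m) (-i) (eps (-?m) * lam * eps i))"
    using assms m x2_flip[of ?m j a] x2_flip[of i ?m 1] by simp
  also have "\<dots> = y2 (-j) (-i) (eps (-j) * bar a * eps ?m * (eps (-?m) * lam * eps i))"
    using assms m by (intro cl_x2_x2) auto
  also have "eps (-j) * bar a * eps ?m * (eps (-?m) * lam * eps i) = - (eps (-j) * bar a * eps i)"
    using nonzero[OF m(1)] by (simp add: mult.assoc eps_mult)
  finally show ?thesis using assms by (simp add: y2_inv)
qed

subsection \<open>Long roots\<close>

text \<open>By R8 the element \<open>x\<^sub>j(\<zeta>)\<close> is a commutator of \<open>x\<^sub>k(flip \<zeta>)\<close> and \<open>x\<^sub>-\<^sub>k\<^sub>,\<^sub>-\<^sub>j(1)\<close>, up to a short root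
  element whose lifts commute with those of \<open>x\<^sub>i(\<xi>)\<close>. The Hall--Witt identity reduces the claim to a commutator of
  two short root elements.\<close>

lemma cl_x1_x1:
  assumes "i \<in> \<Omega>" "j \<in> \<Omega>" "plane i \<noteq> plane j" "\<xi> \<in> L" "\<zeta> \<in> L"
  shows "cl (x1 i \<xi>) (x1 j \<zeta>) = y2 i (-j) (eps i * B (fst \<xi>) (fst \<zeta>))"
proof -
  obtain k where k: "k \<in> \<Omega>" "plane k \<noteq> plane i" "plane k \<noteq> plane j" using fresh[of i j j j] by blast
  note ne = k(2,3)[THEN plane_neD] assms(3)[THEN plane_neD] assms(1,2)[THEN nonzero] k(1)[THEN nonzero]
  let ?p = "x1 i \<xi>" and ?q = "x1 k (flip \<zeta>)" and ?r = "x2 (-k) (-j) 1" and ?c = "eps k * snd (flip \<zeta>) * 1"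
  have qr: "commutator G ?q ?r = x2 k (-j) ?c \<otimes>\<^bsub>G\<^esub> x1 j \<zeta>"
    using assms k x1_x2[of k "-j" "flip \<zeta>" 1] by (simp add: flip_in)
  have pq: "commutator G ?p ?q = x2 i (-k) (eps i * B (fst \<xi>) (fst \<zeta>))"
    using assms k by (simp add: x1_x1 flip_in)
  have s_r: "commutator G (x2 i (-k) (eps i * B (fst \<xi>) (fst \<zeta>))) ?r = x2 i (-j) (eps i * B (fst \<xi>) (fst \<zeta>))"
    using assms k by (simp add: x2_x2)
  have "cl ?p (commutator G ?q ?r) = cl (commutator G ?p ?q) ?r"
  proof (rule cl_hall)
    show "cc ?p ?r" using assms k ne by (simp add: cc_x1_x2)
    show "cc (commutator G ?p ?q) (commutator G ?q ?r)"
      unfolding pq qr using assms k ne by (simp add: cc_mult cc_x2_x2 cc_x2_x1)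
    show "cc (commutator G ?q ?r) (commutator G (commutator G ?p ?q) ?r)"
      unfolding pq qr s_r
      by (rule cc_sym) (use assms k ne in \<open>simp add: cc_mult cc_x2_x2 cc_x2_x1\<close>)
  qed (use assms k flip_in in simp_all)
  also have "cl (commutator G ?p ?q) ?r = y2 i (-j) (eps i * B (fst \<xi>) (fst \<zeta>))"
    unfolding pq using assms k by (simp add: cl_x2_x2)
  also have "cl ?p (commutator G ?q ?r) = cl ?p (x2 k (-j) ?c) \<odot> cl ?p (x1 j \<zeta>)"
    unfolding qr
  proof (rule cl_mult_right)
    show "cc (x2 k (-j) ?c) (commutator G ?p (x1 j \<zeta>))"
      using assms k ne by (simp add: x1_x1 cc_x2_x2)
  qed (use assms in auto)
  also have "cl ?p (x2 k (-j) ?c) = \<one>\<^bsub>H\<^esub>"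
    using cc_x1_x2[of i \<xi> k "-j" ?c] assms k ne by (simp add: cc_def)
  finally show ?thesis using assms by simp
qed

text \<open>The relation R8 with \<open>b = 1\<close>, solved for its long root factor. That the result does not depend on
  the auxiliary index \<open>k\<close> is shown only in \<open>y1_via_eq\<close>, after R9 and R8.\<close>

definition y1_via :: "int \<Rightarrow> int \<Rightarrow> 'v \<times> 'r \<Rightarrow> 'h"
  where "y1_via k j \<xi> = y2 k (-j) (eps k * bar (snd \<xi>)) \<odot> cl (x1 k (flip \<xi>)) (x2 (-k) (-j) 1)"

lemma y1_via_closed [simp]:
  "k \<in> \<Omega> \<Longrightarrow> j \<in> \<Omega> \<Longrightarrow> plane k \<noteq> plane j \<Longrightarrow> \<xi> \<in> L \<Longrightarrow> y1_via k j \<xi> \<in> carrier H"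
  by (simp add: y1_via_def flip_in)

lemma hom_y1_via [simp]:
  assumes "k \<in> \<Omega>" "j \<in> \<Omega>" "plane k \<noteq> plane j" "\<xi> \<in> L"
  shows "\<epsilon> (y1_via k j \<xi>) = x1 j \<xi>"
proof -
  have "\<epsilon> (y1_via k j \<xi>) = x2 k (-j) (eps k * bar (snd \<xi>)) \<otimes>\<^bsub>G\<^esub> (x2 k (-j) (- (eps k * bar (snd \<xi>))) \<otimes>\<^bsub>G\<^esub> x1 j \<xi>)"
    using assms x1_x2[of k "-j" "flip \<xi>" 1] by (simp add: y1_via_def flip_in)
  also have "\<dots> = x1 j \<xi>"
    using assms by (simp add: G.m_assoc[symmetric] x2_add x2_zero)
  finally show ?thesis .
qed

lemma cl_x1_x2_via:
  assumes "k \<in> \<Omega>" "j \<in> \<Omega>" "plane k \<noteq> plane j" "\<xi> \<in> L"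
  shows "cl (x1 k \<xi>) (x2 (-k) j 1) = y2 k j (eps k * snd \<xi>) \<odot> y1_via k (-j) (flip \<xi>)"
proof -
  have "y2 k j (eps k * snd \<xi>) \<odot> y1_via k (-j) (flip \<xi>)
    = y2 k j (eps k * snd \<xi>) \<odot> (y2 k j (- (eps k * snd \<xi>)) \<odot> cl (x1 k \<xi>) (x2 (-k) j 1))"
    using assms by (simp add: y1_via_def bar_bar)
  also have "\<dots> = cl (x1 k \<xi>) (x2 (-k) j 1)"
    using assms by (simp add: H.m_assoc[symmetric] y2_add y2_zero)
  finally show ?thesis by simp
qed

text \<open>The map \<open>flip\<close> reverses the order of a sum, so the defining commutator of \<open>\<xi> + \<zeta>\<close> has the first entry
  \<open>x\<^sub>k(flip \<zeta>) x\<^sub>k(flip \<xi>)\<close>. Expanding it conjugates the factor belonging to \<open>\<xi>\<close> by \<open>x\<^sub>k(flip \<zeta>)\<close>; by \<open>cl_x1_x1\<close>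
  this contributes the short root element with parameter \<open>B v u\<close>, for \<open>u\<close>, \<open>v\<close> the vectors of \<open>\<xi>\<close>, \<open>\<zeta>\<close>.\<close>

lemma y1_via_add:
  assumes "k \<in> \<Omega>" "j \<in> \<Omega>" "plane k \<noteq> plane j" "\<xi> \<in> L" "\<zeta> \<in> L"
  shows "y1_via k j \<xi> \<odot> y1_via k j \<zeta> = y1_via k j (hadd \<xi> \<zeta>)"
proof -
  note ne = assms(3)[THEN plane_neD] assms(1,2)[THEN nonzero]
  let ?a = "eps k * snd (flip \<xi>)" and ?b = "eps k * snd (flip \<zeta>)" and ?c = "eps k * B (fst \<zeta>) (fst \<xi>)"
  let ?P = "lift (x1 k (flip \<zeta>))" and ?Y = "y1_via k j \<xi>" and ?Z = "y1_via k j \<zeta>"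
  have P: "?P \<in> carrier H" "\<epsilon> ?P = x1 k (flip \<zeta>)" using lift assms flip_in by auto
  have Y: "?Y \<in> carrier H" "\<epsilon> ?Y = x1 j \<xi>" "?Z \<in> carrier H" "\<epsilon> ?Z = x1 j \<zeta>" using assms by auto
  have y2: "y2 k (-j) a \<in> carrier H" for a using assms by simp
  have Y_y2: "?Y \<odot> y2 k (-j) a = y2 k (-j) a \<odot> ?Y" for a
    using assms ne by (intro cc_commute) (simp_all add: cc_x1_x2)
  have P_y2: "?P \<odot> y2 k (-j) a = y2 k (-j) a \<odot> ?P" for a
    using assms ne P by (intro cc_commute) (simp_all add: cc_x1_x2 flip_in)
  have "commutator H ?P ?Y = y2 k (-j) ?c"
    using assms P by (simp add: commutator_eq_cl cl_x1_x1 flip_in)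
  then have PY: "?P \<odot> ?Y = y2 k (-j) ?c \<odot> (?Y \<odot> ?P)"
    using P Y y2 by (simp add: H.commutator_eq_iff)
  have "y2 k (-j) (- (eps k * bar (snd (hadd \<xi> \<zeta>)))) \<odot> y1_via k j (hadd \<xi> \<zeta>)
    = cl (x1 k (hadd (flip \<zeta>) (flip \<xi>))) (x2 (-k) (-j) 1)"
    using cl_x1_x2_via[of k "-j" "flip (hadd \<xi> \<zeta>)"] assms hadd_in[of \<xi> \<zeta>]
    by (simp add: flip_in flip_hadd[symmetric])
  also have "x1 k (hadd (flip \<zeta>) (flip \<xi>)) = x1 k (flip \<zeta>) \<otimes>\<^bsub>G\<^esub> x1 k (flip \<xi>)"
    using assms flip_in by (simp add: x1_add)
  also have "cl \<dots> (x2 (-k) (-j) 1) = commutator H (?P \<odot> lift (x1 k (flip \<xi>))) (lift (x2 (-k) (-j) 1))"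
    using assms P lift flip_in by (subst commutator_eq_cl) auto
  also have "\<dots> = ?P \<odot> cl (x1 k (flip \<xi>)) (x2 (-k) (-j) 1) \<odot> inv\<^bsub>H\<^esub> ?P \<odot> cl (x1 k (flip \<zeta>)) (x2 (-k) (-j) 1)"
    using assms P lift flip_in by (simp add: H.commutator_mult_left cl_def[symmetric])
  also have "\<dots> = ?P \<odot> (y2 k (-j) ?a \<odot> ?Y) \<odot> inv\<^bsub>H\<^esub> ?P \<odot> (y2 k (-j) ?b \<odot> ?Z)"
    using cl_x1_x2_via[of k "-j" "flip \<xi>"] cl_x1_x2_via[of k "-j" "flip \<zeta>"] assms flip_in by simp
  also have "?P \<odot> (y2 k (-j) ?a \<odot> ?Y) = y2 k (-j) ?a \<odot> (?P \<odot> ?Y)"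
    using P Y y2 P_y2 by (metis H.m_assoc)
  also have "\<dots> \<odot> inv\<^bsub>H\<^esub> ?P = y2 k (-j) ?a \<odot> y2 k (-j) ?c \<odot> ?Y"
    unfolding PY using P Y y2 by (simp add: H.m_assoc)
  also have "\<dots> \<odot> (y2 k (-j) ?b \<odot> ?Z) = (y2 k (-j) ?a \<odot> y2 k (-j) ?c \<odot> y2 k (-j) ?b) \<odot> (?Y \<odot> ?Z)"
    using Y y2 Y_y2 by (intro H.swap_middle) simp_all
  also have "y2 k (-j) ?a \<odot> y2 k (-j) ?c \<odot> y2 k (-j) ?b = y2 k (-j) (?a + ?c + ?b)"
    using assms by (simp add: y2_add)
  also have "?a + ?c + ?b = - (eps k * bar (snd (hadd \<xi> \<zeta>)))"
    by (simp add: hadd_def bar_add bar_form algebra_simps)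
  finally show ?thesis
    using assms Y y2 hadd_in[of \<xi> \<zeta>] by (metis H.left_cancel H.m_closed y1_via_closed)
qed

text \<open>The commutators of short root elements whose roots have a long sum. As for short sums, they depend
  only on the product of the parameters; \<open>y1_via_nu\<close> identifies them with long root elements.\<close>

definition long_comm :: "int \<Rightarrow> 'r \<Rightarrow> 'h"
  where "long_comm i c = cl (x2 i (fresh_index i i) 1) (x2 (fresh_index i i) (-i) c)"

lemma cl_long_shift:
  assumes "i \<in> \<Omega>" "j \<in> \<Omega>" "m \<in> \<Omega>" "plane i \<noteq> plane j" "plane i \<noteq> plane m" "plane j \<noteq> plane m"
  shows "cl (x2 i m a) (x2 m (-i) (b * c)) = cl (x2 i j (a * b)) (x2 j (-i) c)"
proof -
  note ne = assms(4-6)[THEN plane_neD] assms(1-3)[THEN nonzero]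
  have "cl (x2 i m a) (commutator G (x2 m j b) (x2 j (-i) c)) =
      cl (commutator G (x2 i m a) (x2 m j b)) (x2 j (-i) c)"
    by (rule cl_hall)
      (use assms ne in \<open>simp_all add: x2_x2 x2_x2_long nu_in cc_x2_x2 cc_x2_x1\<close>)
  then show ?thesis using assms by (simp add: x2_x2)
qed

lemma cl_x2_x2_long:
  assumes "i \<in> \<Omega>" "j \<in> \<Omega>" "plane i \<noteq> plane j"
  shows "cl (x2 i j a) (x2 j (-i) b) = long_comm i (a * b)"
proof -
  let ?m = "fresh_index i i"
  obtain l where l: "l \<in> \<Omega>" "plane l \<noteq> plane i" "plane l \<noteq> plane j" "plane l \<noteq> plane ?m"
    using fresh[of i j ?m ?m] by blast
  have "cl (x2 i j a) (x2 j (-i) b) = cl (x2 i l a) (x2 l (-i) b)"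
    using cl_long_shift[of i l j a 1 b] assms l by simp
  also have "\<dots> = long_comm i (a * b)"
    using cl_long_shift[of i l ?m 1 a b] assms l fresh_index[of i i] by (simp add: long_comm_def)
  finally show ?thesis .
qed

lemma long_comm_closed [simp]: "i \<in> \<Omega> \<Longrightarrow> long_comm i c \<in> carrier H"
  using fresh_index[of i i] by (simp add: long_comm_def)

lemma hom_long_comm [simp]: "i \<in> \<Omega> \<Longrightarrow> \<epsilon> (long_comm i c) = x1 i (0, nu i c)"
  using fresh_index[of i i] by (simp add: long_comm_def x2_x2_long)

lemma long_comm_add:
  assumes "i \<in> \<Omega>"
  shows "long_comm i a \<odot> long_comm i b = long_comm i (a + b)"
proof -
  let ?m = "fresh_index i i"
  have m: "?m \<in> \<Omega>" "plane ?m \<noteq> plane i" by (rule fresh_index)+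
  note ne = m(2)[THEN plane_neD] assms[THEN nonzero]
  have "cl (x2 i ?m 1) (x2 ?m (-i) a \<otimes>\<^bsub>G\<^esub> x2 ?m (-i) b) = cl (x2 i ?m 1) (x2 ?m (-i) a) \<odot> cl (x2 i ?m 1) (x2 ?m (-i) b)"
    by (rule cl_mult_right)
      (use assms m ne in \<open>simp_all add: x2_x2_long nu_in cc_x2_x1\<close>)
  then show ?thesis using assms m by (simp add: long_comm_def x2_add)
qed

lemma long_comm_inv: "i \<in> \<Omega> \<Longrightarrow> inv\<^bsub>H\<^esub> (long_comm i a) = long_comm i (- a)"
proof (rule H.inv_equality)
  assume i: "i \<in> \<Omega>"
  have "long_comm i 0 = \<one>\<^bsub>H\<^esub>" using long_comm_add[OF i, of 0 0] i by (simp add: H.r_cancel_one)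
  then show "long_comm i (- a) \<odot> long_comm i a = \<one>\<^bsub>H\<^esub>" using i by (simp add: long_comm_add)
qed auto

text \<open>The relation R9 for the elements built with an auxiliary index. For a suitable \<open>a\<close>, the long root
  element \<open>x\<^sub>k\<close> in the definition of \<open>y1_via\<close> is the image of the commutator \<open>S\<close> of lifts \<open>P\<close> and \<open>Q\<close> of
  \<open>x\<^sub>k\<^sub>m(a)\<close> and \<open>x\<^sub>m\<^sub>,\<^sub>-\<^sub>k(1)\<close>. Conjugation by a lift \<open>R\<close> of \<open>x\<^sub>-\<^sub>k\<^sub>,\<^sub>-\<^sub>i(1)\<close> multiplies \<open>P\<close> by \<open>p = y\<^sub>i\<^sub>m(c)\<close> and \<open>Q\<close> by
  \<open>q = y\<^sub>m\<^sub>,\<^sub>-\<^sub>i(-1)\<close>. The commutator of \<open>p P\<close> and \<open>q Q\<close> has four factors: \<open>S\<close> itself, two short root elements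
  that cancel against the short factor of \<open>y1_via\<close>, and the commutator of \<open>p\<close> and \<open>q\<close>, which is \<open>long_comm i (- c)\<close>.\<close>

lemma y1_via_nu:
  assumes "k \<in> \<Omega>" "i \<in> \<Omega>" "plane k \<noteq> plane i"
  shows "y1_via k i (0, nu i c) = long_comm i c"
proof -
  obtain m where m: "m \<in> \<Omega>" "plane m \<noteq> plane i" "plane m \<noteq> plane k" using fresh[of i k k k] by blast
  note ne = m(2,3)[THEN plane_neD] assms(3)[THEN plane_neD] assms(1,2)[THEN nonzero] m(1)[THEN nonzero]
  \<comment> \<open>The solution of \<open>nu k a = - nu i c\<close>.\<close>
  define a where "a = eps k * lam * eps (- i) * c"
  define e where "e = eps k * bar c * eps i"
  let ?P = "lift (x2 k m a)" and ?Q = "lift (x2 m (-k) 1)" and ?R = "lift (x2 (-k) (-i) 1)"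
  let ?S = "commutator H ?P ?Q" and ?p = "y2 i m c" and ?q = "y2 m (-i) (- 1)"
  have in_H [simp]: "?P \<in> carrier H" "?Q \<in> carrier H" "?R \<in> carrier H" "?p \<in> carrier H" "?q \<in> carrier H"
    and eps_PQR [simp]: "\<epsilon> ?P = x2 k m a" "\<epsilon> ?Q = x2 m (-k) 1" "\<epsilon> ?R = x2 (-k) (-i) 1"
      "\<epsilon> ?p = x2 i m c" "\<epsilon> ?q = x2 m (-i) (- 1)"
    using lift assms m by simp_all
  have nu_a: "nu k a = - nu i c" using ne by (simp add: a_def nu_change)
  have \<epsilon>S: "\<epsilon> ?S = x1 k (flip (0, nu i c))"
    using assms m ne nu_a by (simp add: hom_commutator x2_x2_long flip_def bar_nu)
  have "commutator H ?R ?P = inv\<^bsub>H\<^esub> (cl (x2 k m a) (x2 (-k) (-i) 1))"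
    using assms m by (simp add: commutator_eq_cl cl_swap)
  also have "\<dots> = inv\<^bsub>H\<^esub> (cl (x2 (-m) (-k) (eps (-m) * bar a * eps k)) (x2 (-k) (-i) 1))"
    using assms m x2_flip[of k m a] by simp
  also have "\<dots> = y2 (-m) (-i) (- (eps (-m) * bar a * eps k))"
    using assms m by (simp add: cl_x2_x2 y2_inv)
  also have "\<dots> = ?p"
    using assms m ne y2_flip[of "-m" "-i" "- (eps (-m) * bar a * eps k)"] eps_flip_aux[of i k m c]
    by (simp add: a_def)
  finally have RP: "commutator H ?R ?P = ?p" .
  have "commutator H ?R ?Q = inv\<^bsub>H\<^esub> (cl (x2 m (-k) 1) (x2 (-k) (-i) 1))"
    using assms m by (simp add: commutator_eq_cl cl_swap)
  also have "\<dots> = ?q" using assms m by (simp add: cl_x2_x2 y2_inv)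
  finally have RQ: "commutator H ?R ?Q = ?q" .
  have Pq: "commutator H ?P ?q = y2 k (-i) (- a)"
    using assms m by (simp add: commutator_eq_cl cl_x2_x2)
  have pq: "commutator H ?p ?q = long_comm i (- c)"
    using assms m by (simp add: commutator_eq_cl cl_x2_x2_long)
  have pQ: "commutator H ?p ?Q = y2 k (-i) e"
    using assms m y2_flip[of i "-k" c] by (simp add: commutator_eq_cl cl_x2_x2 e_def)
  have "?R \<odot> ?S \<odot> inv\<^bsub>H\<^esub> ?R = commutator H (?R \<odot> ?P \<odot> inv\<^bsub>H\<^esub> ?R) (?R \<odot> ?Q \<odot> inv\<^bsub>H\<^esub> ?R)"
    by (simp add: H.conj_commutator)
  also have "?R \<odot> ?P \<odot> inv\<^bsub>H\<^esub> ?R = ?p \<odot> ?P"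
    unfolding RP[symmetric] by (simp add: commutator_def H.m_assoc)
  also have "?R \<odot> ?Q \<odot> inv\<^bsub>H\<^esub> ?R = ?q \<odot> ?Q"
    unfolding RQ[symmetric] by (simp add: commutator_def H.m_assoc)
  also have "commutator H (?p \<odot> ?P) (?q \<odot> ?Q) =
    commutator H ?P ?q \<odot> ?S \<odot> (commutator H ?p ?q \<odot> commutator H ?p ?Q)"
  proof (rule H.commutator_mult_mult)
    show "?q \<odot> ?S = ?S \<odot> ?q" "?p \<odot> ?S = ?S \<odot> ?p"
      using assms m ne by (intro cc_commute; simp add: \<epsilon>S flip_in nu_in cc_x2_x1)+
    show "?p \<odot> commutator H ?P ?q = commutator H ?P ?q \<odot> ?p"
      unfolding Pq using assms m ne by (intro cc_commute) (simp_all add: cc_x2_x2)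
    show "?q \<odot> commutator H ?p ?Q = commutator H ?p ?Q \<odot> ?q"
      unfolding pQ using assms m ne by (intro cc_commute) (simp_all add: cc_x2_x2)
  qed simp_all
  finally have RS: "?R \<odot> ?S \<odot> inv\<^bsub>H\<^esub> ?R = y2 k (-i) (- a) \<odot> ?S \<odot> (long_comm i (- c) \<odot> y2 k (-i) e)"
    by (simp add: Pq pq pQ)
  have d_y2: "long_comm i x \<odot> y2 k (-i) t = y2 k (-i) t \<odot> long_comm i x" for x t
    using assms ne by (intro cc_commute) (simp_all add: cc_x1_x2 nu_in)
  have S_d: "?S \<odot> long_comm i x = long_comm i x \<odot> ?S" for x
    using assms ne by (intro cc_commute) (simp_all add: \<epsilon>S cc_def cl_x1_x1 flip_in nu_in y2_zero)
  have S_y2: "?S \<odot> y2 k (-i) t = y2 k (-i) t \<odot> ?S" for t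
    using assms ne by (intro cc_commute) (simp_all add: \<epsilon>S cc_x1_x2 flip_in nu_in)
  have [simp]: "?S \<in> carrier H" "y2 k (-i) t \<in> carrier H" "long_comm i x \<in> carrier H" for t x
    using assms by simp_all
  have "?S \<odot> (long_comm i (- c) \<odot> y2 k (-i) e) = (long_comm i (- c) \<odot> y2 k (-i) e) \<odot> ?S"
    by (rule H.commute_mult) (simp_all add: S_d S_y2)
  then have "?R \<odot> ?S \<odot> inv\<^bsub>H\<^esub> ?R = y2 k (-i) (- a) \<odot> (y2 k (-i) e \<odot> long_comm i (- c)) \<odot> ?S"
    unfolding RS by (simp add: H.m_assoc d_y2)
  then have "commutator H ?R ?S = y2 k (-i) (- a) \<odot> (y2 k (-i) e \<odot> long_comm i (- c))"
    by (simp add: commutator_def[of H ?R] H.m_assoc)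
  also have "\<dots> = y2 k (-i) (- a + e) \<odot> long_comm i (- c)"
    using assms by (simp add: H.m_assoc[symmetric] y2_add)
  finally have "commutator H ?S ?R = inv\<^bsub>H\<^esub> (y2 k (-i) (- a + e) \<odot> long_comm i (- c))"
    using H.commutator_swap[of ?R ?S] by simp
  also have "\<dots> = y2 k (-i) (a - e) \<odot> long_comm i c"
    using assms by (simp add: H.inv_mult_group long_comm_inv y2_inv d_y2)
  finally have "commutator H ?S ?R = y2 k (-i) (a - e) \<odot> long_comm i c" .
  then have "cl (x1 k (flip (0, nu i c))) (x2 (-k) (-i) 1) = y2 k (-i) (a - e) \<odot> long_comm i c"
    using commutator_eq_cl[of ?S ?R] by (simp only: \<epsilon>S eps_PQR in_H H.commutator_closed)
  moreover have "eps k * bar (nu i c) = e - a"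
    using assms nonzero by (simp add: bar_nu nu_eps a_def e_def)
  ultimately show ?thesis
    using assms by (simp add: y1_via_def H.m_assoc[symmetric] y2_add y2_zero)
qed

text \<open>The relation R8 for the elements built with an auxiliary index. The Hall--Witt identity is applied to
  lifts \<open>P\<close>, \<open>Q\<close>, \<open>R\<close> of \<open>x\<^sub>i(\<xi>)\<close>, \<open>x\<^sub>-\<^sub>i\<^sub>,\<^sub>-\<^sub>k(b)\<close>, \<open>x\<^sub>-\<^sub>k\<^sub>,\<^sub>j(1)\<close>. The commutator \<open>S\<close> of \<open>P\<close> and \<open>Q\<close> is a short factor \<open>Y\<close>
  times a long factor \<open>Z\<close>. The commutator of \<open>Y\<close> with \<open>T = y\<^sub>-\<^sub>i\<^sub>,\<^sub>j(b)\<close> cancels against the short part of the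
  commutator of \<open>Z\<close> with \<open>R\<close>. What is left is conjugated by \<open>T\<close>, and the resulting R9 term changes the parameter
  \<open>hact \<xi> b\<close> into \<open>hact (flip \<xi>) b\<close>.\<close>

lemma cl_x1_x2_via_any:
  assumes "i \<in> \<Omega>" "j \<in> \<Omega>" "k \<in> \<Omega>" "plane i \<noteq> plane j" "plane i \<noteq> plane k" "plane j \<noteq> plane k" "\<xi> \<in> L"
  shows "cl (x1 i \<xi>) (x2 (-i) j b) = y2 i j (eps i * snd \<xi> * b) \<odot> y1_via k (-j) (hact (flip \<xi>) b)"
proof -
  note ne = assms(4-6)[THEN plane_neD] assms(1-3)[THEN nonzero]
  note L = assms(7) flip_in[OF assms(7)] hact_in[OF assms(7)] hact_in[OF flip_in[OF assms(7)]]
  define g where "g = eps i * snd \<xi> * b"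
  define w where "w = eps k * (bar b * mu * bar (snd \<xi>) * b)"
  define n where "n = nu (-j) (eps (-j) * bar b * eps (-i) * g)"
  have n: "(0, n) \<in> L" using ne by (simp add: n_def nu_in)
  let ?P = "lift (x1 i \<xi>)" and ?Q = "lift (x2 (-i) (-k) b)" and ?R = "lift (x2 (-k) j 1)"
  let ?S = "commutator H ?P ?Q" and ?T = "y2 (-i) j b" and ?Y = "y2 i (-k) g" and ?W = "y1_via k (-j)"
  let ?Z = "inv\<^bsub>H\<^esub> ?Y \<odot> ?S"
  have in_H [simp]: "?P \<in> carrier H" "?Q \<in> carrier H" "?R \<in> carrier H" "?T \<in> carrier H" "?Y \<in> carrier H"
      "y2 k j t \<in> carrier H" "y2 i j t \<in> carrier H"
    and \<epsilon>_PQR [simp]: "\<epsilon> ?P = x1 i \<xi>" "\<epsilon> ?Q = x2 (-i) (-k) b" "\<epsilon> ?R = x2 (-k) j 1"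
    for t
    using lift assms by simp_all
  have W_in [simp]: "?W \<zeta> \<in> carrier H" if "\<zeta> \<in> L" for \<zeta> using assms that by simp
  have S: "?S = ?Y \<odot> ?Z" by simp
  have \<epsilon>S: "\<epsilon> ?S = x2 i (-k) g \<otimes>\<^bsub>G\<^esub> x1 k (hact (flip \<xi>) b)"
    using assms x1_x2[of i "-k" \<xi> b] by (simp add: hom_commutator g_def)
  have \<epsilon>Z: "\<epsilon> ?Z = x1 k (hact (flip \<xi>) b)"
    using assms L by (simp add: \<epsilon>S)
  have Z [simp]: "?Z \<in> carrier H" by simp
  have QR: "commutator H ?Q ?R = ?T"
    using assms by (simp add: commutator_eq_cl cl_x2_x2)
  have PR: "?P \<odot> ?R = ?R \<odot> ?P"
    using assms ne by (intro cc_commute) (simp_all add: cc_x1_x2)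
  have YT: "commutator H ?Y ?T = y2 k j w"
  proof -
    have "commutator H ?Y ?T = cl (x2 i (-k) g) (x2 (-i) j b)"
      using assms by (simp add: commutator_eq_cl)
    also have "\<dots> = cl (x2 k (-i) (eps k * bar g * eps i)) (x2 (-i) j b)"
      using assms x2_flip[of i "-k" g] by simp
    also have "\<dots> = y2 k j w"
      using assms ne by (simp add: cl_x2_x2 g_def w_def eps_act_aux)
    finally show ?thesis .
  qed
  have ZT: "?Z \<odot> ?T = ?T \<odot> ?Z"
    by (rule cc_commute) (use assms ne L in \<open>simp_all add: \<epsilon>Z cc_x1_x2 del: hom_mult hom_inv\<close>)
  have "commutator H ?S ?T = commutator H (?Y \<odot> ?Z) ?T" using S by simp
  also have "\<dots> = ?Y \<odot> commutator H ?Z ?T \<odot> inv\<^bsub>H\<^esub> ?Y \<odot> commutator H ?Y ?T"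
    by (rule H.commutator_mult_left) simp_all
  also have "commutator H ?Z ?T = \<one>\<^bsub>H\<^esub>" using ZT H.commutator_eq_one_iff[OF Z in_H(4)] by blast
  finally have ST: "commutator H ?S ?T = y2 k j w" by (simp add: YT)
  have ZR: "commutator H ?Z ?R = y2 k j (- w) \<odot> ?W (hact \<xi> b)"
  proof -
    have "commutator H ?Z ?R = cl (x1 k (hact (flip \<xi>) b)) (x2 (-k) j 1)"
      using commutator_eq_cl[OF Z in_H(3)] by (simp only: \<epsilon>Z \<epsilon>_PQR)
    also have "\<dots> = y2 k j (eps k * snd (hact (flip \<xi>) b)) \<odot> ?W (hact \<xi> b)"
      using assms L cl_x1_x2_via[of k j "hact (flip \<xi>) b"] by (simp add: flip_hact)
    also have "eps k * snd (hact (flip \<xi>) b) = - w" by (simp add: w_def)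
    finally show ?thesis .
  qed
  have Y_comm: "?Y \<odot> (y2 k j (- w) \<odot> ?W (hact \<xi> b)) = (y2 k j (- w) \<odot> ?W (hact \<xi> b)) \<odot> ?Y"
    using assms ne L by (intro cc_commute) (simp_all add: cc_mult cc_x2_x2 cc_x2_x1)
  have YR: "commutator H ?Y ?R = y2 i j g"
    using assms by (simp add: commutator_eq_cl cl_x2_x2)
  have "commutator H ?S ?R = commutator H (?Y \<odot> ?Z) ?R" using S by simp
  also have "\<dots> = ?Y \<odot> commutator H ?Z ?R \<odot> inv\<^bsub>H\<^esub> ?Y \<odot> commutator H ?Y ?R"
    by (rule H.commutator_mult_left) simp_all
  also have "?Y \<odot> commutator H ?Z ?R \<odot> inv\<^bsub>H\<^esub> ?Y = y2 k j (- w) \<odot> ?W (hact \<xi> b)"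
    unfolding ZR using L by (intro H.conj_eq_self Y_comm) simp_all
  finally have SR: "commutator H ?S ?R = y2 k j (- w) \<odot> ?W (hact \<xi> b) \<odot> y2 i j g"
    by (simp add: YR)
  have T_comm: "?T \<odot> (y2 k j (- w) \<odot> ?W (hact \<xi> b)) = (y2 k j (- w) \<odot> ?W (hact \<xi> b)) \<odot> ?T"
    using assms ne L by (intro cc_commute) (simp_all add: cc_mult cc_x2_x2 cc_x2_x1)
  have "commutator H ?T (y2 i j g) = cl (x2 (-i) j b) (x2 i j g)"
    using assms by (simp add: commutator_eq_cl)
  also have "\<dots> = cl (x2 (-j) i (eps (-j) * bar b * eps (-i))) (x2 i j g)"
    using assms x2_flip[of "-i" j b] by simp
  also have "\<dots> = long_comm (-j) (eps (-j) * bar b * eps (-i) * g)"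
    using assms cl_x2_x2_long[of "-j" i _ g] by simp
  also have "\<dots> = ?W (0, n)"
    using assms by (simp add: n_def y1_via_nu)
  finally have Tg: "?T \<odot> y2 i j g = ?W (0, n) \<odot> (y2 i j g \<odot> ?T)"
    using n by (simp add: H.commutator_eq_iff)
  have "cl (x1 i \<xi>) (x2 (-i) j b) = commutator H ?P (commutator H ?Q ?R)"
    unfolding QR using assms by (simp add: commutator_eq_cl)
  also have "\<dots> = commutator H ?S ?T \<odot> (?T \<odot> commutator H ?S ?R \<odot> inv\<^bsub>H\<^esub> ?T)"
    using H.commutator_hall[of ?P ?Q ?R] PR by (simp add: QR)
  also have "?T \<odot> commutator H ?S ?R = (?T \<odot> (y2 k j (- w) \<odot> ?W (hact \<xi> b))) \<odot> y2 i j g"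
    unfolding SR using L by (simp add: H.m_assoc)
  also have "\<dots> = y2 k j (- w) \<odot> ?W (hact \<xi> b) \<odot> (?T \<odot> y2 i j g)"
    unfolding T_comm using L by (simp add: H.m_assoc)
  also have "\<dots> \<odot> inv\<^bsub>H\<^esub> ?T = y2 k j (- w) \<odot> (?W (hact \<xi> b) \<odot> ?W (0, n) \<odot> y2 i j g)"
    unfolding Tg using L n by (simp add: H.m_assoc)
  also have "?W (hact \<xi> b) \<odot> ?W (0, n) = ?W (hadd (hact \<xi> b) (0, n))"
    using assms L n by (intro y1_via_add) simp_all
  also have "hadd (hact \<xi> b) (0, n) = hact (flip \<xi>) b"
    using ne nu_act_aux[of i j b "snd \<xi>"] by (intro prod_eqI) (simp_all add: hadd_def n_def g_def)
  also have "?W (hact (flip \<xi>) b) \<odot> y2 i j g = y2 i j g \<odot> ?W (hact (flip \<xi>) b)"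
    using assms ne L by (intro cc_commute) (simp_all add: cc_x1_x2)
  also have "commutator H ?S ?T \<odot> (y2 k j (- w) \<odot> (y2 i j g \<odot> ?W (hact (flip \<xi>) b)))
      = y2 i j g \<odot> ?W (hact (flip \<xi>) b)"
    unfolding ST using assms L y2_inv[of k j w, symmetric] by simp
  finally show ?thesis by (simp add: g_def)
qed

definition y1 :: "int \<Rightarrow> 'v \<times> 'r \<Rightarrow> 'h"
  where "y1 j \<xi> = y1_via (fresh_index j j) j \<xi>"

text \<open>For different planes the commutator in R8 with \<open>b = 1\<close> has been computed twice, by \<open>cl_x1_x2_via\<close> with
  the index \<open>i\<close> and by \<open>cl_x1_x2_via_any\<close> with the index \<open>l\<close>. The general case goes through a third plane.\<close>

lemma y1_via_eq:
  assumes "k \<in> \<Omega>" "j \<in> \<Omega>" "plane k \<noteq> plane j" "\<xi> \<in> L"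
  shows "y1_via k j \<xi> = y1 j \<xi>"
proof -
  have indep: "y1_via i j \<xi> = y1_via l j \<xi>"
    if "i \<in> \<Omega>" "l \<in> \<Omega>" "plane i \<noteq> plane j" "plane i \<noteq> plane l" "plane j \<noteq> plane l" for i l
  proof (rule H.left_cancel[of "y2 i (-j) (eps i * snd (flip \<xi>))"])
    show "y2 i (-j) (eps i * snd (flip \<xi>)) \<odot> y1_via i j \<xi> = y2 i (-j) (eps i * snd (flip \<xi>)) \<odot> y1_via l j \<xi>"
      using assms that cl_x1_x2_via[of i "-j" "flip \<xi>"] cl_x1_x2_via_any[of i "-j" l "flip \<xi>" 1]
      by (simp add: flip_in)
  qed (use assms that in simp_all)
  let ?m = "fresh_index j j"
  obtain l where l: "l \<in> \<Omega>" "plane l \<noteq> plane k" "plane l \<noteq> plane j" "plane l \<noteq> plane ?m"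
    using fresh[of k j ?m ?m] by blast
  have "y1_via k j \<xi> = y1_via l j \<xi>" using assms l by (intro indep) auto
  moreover have "y1_via ?m j \<xi> = y1_via l j \<xi>" using assms l fresh_index[of j j] by (intro indep) auto
  ultimately show ?thesis by (simp add: y1_def)
qed

lemma y1_closed [simp]: "j \<in> \<Omega> \<Longrightarrow> \<xi> \<in> L \<Longrightarrow> y1 j \<xi> \<in> carrier H"
  using fresh_index[of j j] by (simp add: y1_def)

lemma hom_y1 [simp]: "j \<in> \<Omega> \<Longrightarrow> \<xi> \<in> L \<Longrightarrow> \<epsilon> (y1 j \<xi>) = x1 j \<xi>"
  using fresh_index[of j j] by (simp add: y1_def)

theorem lifted_family: "steinberg_family bar act B L H \<Omega> y2 y1"
proof (unfold_locales, goal_cases)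
  case (5 i j a)
  then show ?case by (rule y2_flip)
next
  case (6 i j a b)
  then show ?case by (rule y2_add)
next
  case (7 i \<xi> \<zeta>)
  then show ?case using fresh_index[of i i] by (simp add: y1_def y1_via_add)
next
  case (8 i j h k a b)
  then show ?case using cc_x2_x2[of i j h k a b] by (simp add: commutator_eq_cl cc_def)
next
  case (9 i \<xi> j k a)
  then show ?case using cc_x1_x2[of i \<xi> j k a] by (simp add: commutator_eq_cl cc_def)
next
  case (10 i j k a b)
  then show ?case by (simp add: commutator_eq_cl cl_x2_x2)
next
  case (11 i j \<xi> \<zeta>)
  then show ?case by (simp add: commutator_eq_cl cl_x1_x1)
next
  case (12 i j \<xi> b)
  obtain k where k: "k \<in> \<Omega>" "plane k \<noteq> plane i" "plane k \<noteq> plane j" using fresh[of i j j j] by blast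
  have "cl (x1 i \<xi>) (x2 (-i) j b) = y2 i j (eps i * snd \<xi> * b) \<odot> y1_via k (-j) (hact (flip \<xi>) b)"
    using 12 k by (intro cl_x1_x2_via_any) auto
  then show ?case
    using 12 k y1_via_eq[of k "-j" "hact (flip \<xi>) b"] by (simp add: commutator_eq_cl hact_in flip_in)
next
  case (13 i j a b)
  then show ?case
    using fresh_index[of i i] by (simp add: commutator_eq_cl cl_x2_x2_long y1_def y1_via_nu)
qed (auto simp: zero_notin)

end

section \<open>Elementary transvections\<close>

context odd_quadratic_space
begin

text \<open>The transvections in coordinates. The form enters only through \<open>\<epsilon>\<^sub>-\<^sub>i (e\<^sub>i, e\<^sub>-\<^sub>i) = - 1\<close>, and the rank not
  at all, so the Steinberg relations become identities between maps on all coordinate functions.\<close>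

definition t2 :: "int \<Rightarrow> int \<Rightarrow> 'r \<Rightarrow> ('r, 'v) hyp_vec \<Rightarrow> ('r, 'v) hyp_vec"
  where "t2 i j a w = ((\<lambda>k. fst w k + (if k = i then a * fst w j else 0)
      + (if k = - j then eps (-j) * bar a * eps i * fst w (-i) else 0)), snd w)"

definition t1 :: "int \<Rightarrow> 'v \<times> 'r \<Rightarrow> ('r, 'v) hyp_vec \<Rightarrow> ('r, 'v) hyp_vec"
  where "t1 i \<xi> w = ((\<lambda>k. fst w k + (if k = i then eps i * (snd \<xi> * fst w (-i) - B (fst \<xi>) (snd w)) else 0)),
      snd w - act (fst \<xi>) (fst w (-i)))"

lemma fst_t2: "fst (t2 i j a w) k = fst w k + (if k = i then a * fst w j else 0)
      + (if k = - j then eps (-j) * bar a * eps i * fst w (-i) else 0)"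
  and snd_t2: "snd (t2 i j a w) = snd w"
  and fst_t1: "fst (t1 i \<xi> w) k = fst w k + (if k = i then eps i * (snd \<xi> * fst w (-i) - B (fst \<xi>) (snd w)) else 0)"
  and snd_t1: "snd (t1 i \<xi> w) = snd w - act (fst \<xi>) (fst w (-i))"
  by (simp_all add: t2_def t1_def)

lemmas t_apply = fst_t2 snd_t2 fst_t1 snd_t1

lemma hyp_vec_eqI: "(\<And>k. fst w k = fst w' k) \<Longrightarrow> snd w = snd w' \<Longrightarrow> w = (w' :: ('r, 'v) hyp_vec)"
  by (intro prod_eqI ext)

lemma eps_twice: "i \<noteq> 0 \<Longrightarrow> j \<noteq> 0 \<Longrightarrow> eps i * bar (eps (- j) * bar a * eps i) * eps (- j) = a"
  by (auto simp: eps_def bar_mult bar_bar mult.assoc)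

lemma t2_flip: "i \<noteq> 0 \<Longrightarrow> j \<noteq> 0 \<Longrightarrow> plane i \<noteq> plane j \<Longrightarrow> t2 (-j) (-i) (eps (-j) * bar a * eps i) w = t2 i j a w"
  by (intro hyp_vec_eqI) (auto simp: t_apply eps_twice dest: plane_neD)

lemma t2_zero: "t2 i j 0 w = w"
  by (intro hyp_vec_eqI) (auto simp: t_apply)

lemma t1_zero: "t1 i (0, 0) w = w"
  by (intro hyp_vec_eqI) (auto simp: t_apply)

lemma t2_add:
  assumes "i \<noteq> 0" "j \<noteq> 0" "plane i \<noteq> plane j"
  shows "t2 i j a (t2 i j b w) = t2 i j (a + b) w"
proof (rule hyp_vec_eqI)
  note ne = assms(3)[THEN plane_neD]
  fix k show "fst (t2 i j a (t2 i j b w)) k = fst (t2 i j (a + b) w) k"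
    using assms ne by (simp add: t_apply bar_add algebra_simps)
qed (simp add: t_apply)

lemma t1_add:
  assumes "i \<noteq> 0"
  shows "t1 i \<xi> (t1 i \<zeta> w) = t1 i (hadd \<xi> \<zeta>) w"
proof (rule hyp_vec_eqI)
  fix k show "fst (t1 i \<xi> (t1 i \<zeta> w)) k = fst (t1 i (hadd \<xi> \<zeta>) w) k"
    using assms by (simp add: t_apply hadd_def form_add_left form_diff form_act_right algebra_simps)
qed (use assms in \<open>simp add: t_apply hadd_def act_add_left\<close>)

lemma t2_t2_commute:
  assumes "i \<noteq> 0" "j \<noteq> 0" "h \<noteq> 0" "k \<noteq> 0" "plane i \<noteq> plane j" "plane h \<noteq> plane k" "h \<noteq> j" "h \<noteq> - i" "k \<noteq> i" "k \<noteq> - j"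
  shows "t2 i j a (t2 h k b w) = t2 h k b (t2 i j a w)"
proof (rule hyp_vec_eqI)
  have ne: "j \<noteq> h" "i \<noteq> - h" "- h \<noteq> i" "- i \<noteq> h" "i \<noteq> k" "- j \<noteq> k" "j \<noteq> - k" "- k \<noteq> j"
    using assms(7-10) by auto
  fix l show "fst (t2 i j a (t2 h k b w)) l = fst (t2 h k b (t2 i j a w)) l"
    using assms ne plane_neD[OF assms(5)] plane_neD[OF assms(6)] by (simp add: t_apply algebra_simps)
qed (simp add: t_apply)

lemma t1_t2_commute:
  assumes "i \<noteq> 0" "j \<noteq> 0" "k \<noteq> 0" "plane j \<noteq> plane k" "j \<noteq> - i" "k \<noteq> i"
  shows "t1 i \<xi> (t2 j k a w) = t2 j k a (t1 i \<xi> w)"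
proof (rule hyp_vec_eqI)
  have ne: "- j \<noteq> i" "- i \<noteq> j" "i \<noteq> - j" "i \<noteq> k" "- i \<noteq> - k" using assms by auto
  fix l show "fst (t1 i \<xi> (t2 j k a w)) l = fst (t2 j k a (t1 i \<xi> w)) l"
    using assms ne plane_neD[OF assms(4)] by (simp add: t_apply algebra_simps)
  show "snd (t1 i \<xi> (t2 j k a w)) = snd (t2 j k a (t1 i \<xi> w))"
    using assms ne by (simp add: t_apply)
qed

lemma t2_t2:
  assumes "i \<noteq> 0" "j \<noteq> 0" "k \<noteq> 0" "plane i \<noteq> plane j" "plane j \<noteq> plane k" "plane i \<noteq> plane k"
  shows "t2 i j a (t2 j k b w) = t2 i k (a * b) (t2 j k b (t2 i j a w))"
proof (rule hyp_vec_eqI)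
  note ne = assms(4-6)[THEN plane_neD]
  have e: "eps (- k) * (bar (a * b) * (eps i * x))
      = - (eps (- k) * (bar b * (eps j * (eps (- j) * (bar a * (eps i * x))))))" for x
    using assms by (auto simp: eps_def bar_mult mult.assoc)
  fix l show "fst (t2 i j a (t2 j k b w)) l = fst (t2 i k (a * b) (t2 j k b (t2 i j a w))) l"
    using assms ne by (simp add: t_apply e algebra_simps)
qed (simp add: t_apply)

lemma t1_t1:
  assumes "i \<noteq> 0" "j \<noteq> 0" "plane i \<noteq> plane j"
  shows "t1 i \<xi> (t1 j \<zeta> w) = t2 i (-j) (eps i * B (fst \<xi>) (fst \<zeta>)) (t1 j \<zeta> (t1 i \<xi> w))"
proof (rule hyp_vec_eqI)
  note ne = assms(3)[THEN plane_neD]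
  have e: "eps j * (bar (eps i * B (fst \<xi>) (fst \<zeta>)) * (eps i * x)) = - (eps j * (B (fst \<zeta>) (fst \<xi>) * x))" for x
    using assms by (auto simp: eps_def bar_mult bar_form mult.assoc)
  fix l show "fst (t1 i \<xi> (t1 j \<zeta> w)) l = fst (t2 i (-j) (eps i * B (fst \<xi>) (fst \<zeta>)) (t1 j \<zeta> (t1 i \<xi> w))) l"
    using assms ne by (simp add: t_apply e form_diff form_act_right algebra_simps)
qed (use assms plane_neD[OF assms(3)] in \<open>simp add: t_apply\<close>)

text \<open>The terms of third order match because \<open>a = bar a + B u u\<close> for \<open>(u, a) \<in> L\<close>.\<close>

lemma t1_t2:
  assumes "i \<noteq> 0" "j \<noteq> 0" "plane i \<noteq> plane j" "\<xi> \<in> L"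
  shows "t1 i \<xi> (t2 (-i) j b w) = t2 i j (eps i * snd \<xi> * b) (t1 (-j) (hact (flip \<xi>) b) (t2 (-i) j b (t1 i \<xi> w)))"
proof (rule hyp_vec_eqI)
  note ne = assms(3)[THEN plane_neD]
  obtain u a where \<xi>: "\<xi> = (u, a)" by (cases \<xi>)
  have L: "a = bar a + B u u" using in_L_snd[OF assms(4)] \<xi> by simp
  have e1: "eps i * (eps (-i) * x) = - (mu * x)" "eps j * (eps (-j) * x) = - (mu * x)"
      "eps (-j) * (eps j * x) = - (mu * x)" "eps (-i) * (eps i * x) = - (mu * x)" for x
    using assms by (auto simp: eps_def)
  have e3: "bar (eps i * (a * b)) * (eps i * x) = bar b * (mu * (bar a * x))" for x
    using assms by (auto simp: eps_def bar_mult bar_bar mult.assoc)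
  have e4: "mu * (B u u * x) = mu * (a * x) - mu * (bar a * x)" for x
    using L by (metis add_diff_cancel_left' left_diff_distrib right_diff_distrib)
  fix l show "fst (t1 i \<xi> (t2 (-i) j b w)) l
      = fst (t2 i j (eps i * snd \<xi> * b) (t1 (-j) (hact (flip \<xi>) b) (t2 (-i) j b (t1 i \<xi> w)))) l"
    using assms ne
    by (simp add: t_apply \<xi> form_diff form_act_right form_act_left mult.assoc e1 e3 distrib_left distrib_right
      left_diff_distrib right_diff_distrib e4)
  show "snd (t1 i \<xi> (t2 (-i) j b w))
      = snd (t2 i j (eps i * snd \<xi> * b) (t1 (-j) (hact (flip \<xi>) b) (t2 (-i) j b (t1 i \<xi> w))))"
    using assms ne by (simp add: t_apply \<xi> act_add_right act_mult)
qed

lemma t2_t2_long: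
  assumes "i \<noteq> 0" "j \<noteq> 0" "plane i \<noteq> plane j"
  shows "t2 i j a (t2 j (-i) b w) = t1 i (0, nu i (a * b)) (t2 j (-i) b (t2 i j a w))"
proof (rule hyp_vec_eqI)
  note ne = assms(3)[THEN plane_neD]
  have e: "eps i * (nu i (a * b) * x) = a * (b * x) - eps i * (bar b * (eps j * (eps (-j) * (bar a * (eps i * x)))))" for x
    using assms by (auto simp: eps_def nu_def bar_mult mult.assoc algebra_simps)
  fix l show "fst (t2 i j a (t2 j (-i) b w)) l = fst (t1 i (0, nu i (a * b)) (t2 j (-i) b (t2 i j a w))) l"
    using assms ne by (simp add: t_apply mult.assoc e distrib_left)
qed (use assms in \<open>simp add: t_apply\<close>)

lemma finite_Omega [simp]: "finite (Omega n)"
  by (rule finite_subset[of _ "{- int n..int n}"]) (auto simp: Omega_def)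

lemma Omega_minus [simp]: "- i \<in> Omega n \<longleftrightarrow> i \<in> Omega n"
  by (auto simp: Omega_def)

lemma zero_notin_Omega [simp]: "0 \<notin> Omega n"
  by (simp add: Omega_def)

lemma Omega_nonzero: "i \<in> Omega n \<Longrightarrow> i \<noteq> 0"
  by (simp add: Omega_def)

lemma hyp_form_basis_vec:
  assumes "i \<in> Omega n"
  shows "hyp_form n (basis_vec i) w = gram i (- i) * fst w (- i)"
proof -
  have "(\<Sum>q\<in>Omega n. gram i q * fst w q) = (\<Sum>q\<in>Omega n. if q = - i then gram i (- i) * fst w (- i) else 0)"
    by (intro sum.cong) (auto simp: gram_def)
  also have "\<dots> = gram i (- i) * fst w (- i)" using assms by (simp add: sum.delta)
  finally have *: "(\<Sum>q\<in>Omega n. gram i q * fst w q) = gram i (- i) * fst w (- i)" .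
  have "(\<Sum>p\<in>Omega n. \<Sum>q\<in>Omega n. bar (fst (basis_vec i :: ('r, 'v) hyp_vec) p) * mu * gram p q * fst w q)
      = (\<Sum>p\<in>Omega n. if p = i then (\<Sum>q\<in>Omega n. gram i q * fst w q) else 0)"
    by (intro sum.cong) (auto simp: basis_vec_def)
  also have "\<dots> = gram i (- i) * fst w (- i)" using assms by (simp add: sum.delta *)
  finally show ?thesis by (simp add: hyp_form_def basis_vec_def)
qed

lemma hyp_form_embed_vec: "hyp_form n (embed_vec u) w = B u (snd w)"
  by (simp add: hyp_form_def embed_vec_def zero_fun_def)

lemma gram_eps: "i \<noteq> 0 \<Longrightarrow> mu * (gram i (- i) * x) = eps i * x" "i \<noteq> 0 \<Longrightarrow> eps (- i) * (gram i (- i) * x) = - x"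
  by (auto simp: gram_def eps_def)

lemma T2_eq_t2:
  assumes "i \<in> Omega n" "j \<in> Omega n"
  shows "T2 n i j a = restrict (t2 i j a) (hyp_space n)"
proof -
  have "w + hyp_act (basis_vec (-j)) (eps (-j) * bar a * mu * hyp_form n (basis_vec i) w)
           - hyp_act (basis_vec i) (a * eps j * hyp_form n (basis_vec (-j)) w) = t2 i j a w" for w
  proof (rule hyp_vec_eqI)
    fix k
    show "fst (w + hyp_act (basis_vec (-j)) (eps (-j) * bar a * mu * hyp_form n (basis_vec i) w)
           - hyp_act (basis_vec i) (a * eps j * hyp_form n (basis_vec (-j)) w)) k = fst (t2 i j a w) k"
      using assms gram_eps(1)[OF Omega_nonzero[OF assms(1)]] gram_eps(2)[of "-j"] Omega_nonzero[OF assms(2)]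
      by (simp add: t_apply hyp_act_def basis_vec_def[abs_def] hyp_form_basis_vec[unfolded basis_vec_def] mult.assoc)
  qed (simp add: t_apply hyp_act_def basis_vec_def)
  then show ?thesis by (simp add: T2_def)
qed

lemma T1_eq_t1:
  assumes "i \<in> Omega n"
  shows "T1 n i \<xi> = restrict (t1 i \<xi>) (hyp_space n)"
proof -
  obtain u b where \<xi>: "\<xi> = (u, b)" by (cases \<xi>)
  have "w - hyp_act (basis_vec i) (eps i * hyp_form n (embed_vec u) w)
           - hyp_act (basis_vec i) (eps i * b * eps (-i) * hyp_form n (basis_vec i) w)
           + hyp_act (embed_vec u) (eps (-i) * hyp_form n (basis_vec i) w) = t1 i \<xi> w" for w
  proof (rule hyp_vec_eqI)
    note e = gram_eps(2)[OF Omega_nonzero[OF assms]]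
    fix k
    show "fst (w - hyp_act (basis_vec i) (eps i * hyp_form n (embed_vec u) w)
           - hyp_act (basis_vec i) (eps i * b * eps (-i) * hyp_form n (basis_vec i) w)
           + hyp_act (embed_vec u) (eps (-i) * hyp_form n (basis_vec i) w)) k = fst (t1 i \<xi> w) k"
      using assms e by (simp add: t_apply \<xi> hyp_act_def basis_vec_def[abs_def] embed_vec_def[abs_def]
          hyp_form_basis_vec[unfolded basis_vec_def] hyp_form_embed_vec[unfolded embed_vec_def] mult.assoc
          right_diff_distrib)
    show "snd (w - hyp_act (basis_vec i) (eps i * hyp_form n (embed_vec u) w)
           - hyp_act (basis_vec i) (eps i * b * eps (-i) * hyp_form n (basis_vec i) w)
           + hyp_act (embed_vec u) (eps (-i) * hyp_form n (basis_vec i) w)) = snd (t1 i \<xi> w)"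
      using assms e by (simp add: t_apply \<xi> hyp_act_def basis_vec_def[abs_def] embed_vec_def[abs_def]
          hyp_form_basis_vec[unfolded basis_vec_def])
  qed
  then show ?thesis by (simp add: T1_def \<xi>)
qed

lemma t2_in: "i \<in> Omega n \<Longrightarrow> j \<in> Omega n \<Longrightarrow> w \<in> hyp_space n \<Longrightarrow> t2 i j a w \<in> hyp_space n"
  by (auto simp: hyp_space_def t_apply)

lemma t1_in: "i \<in> Omega n \<Longrightarrow> w \<in> hyp_space n \<Longrightarrow> t1 i \<xi> w \<in> hyp_space n"
  by (auto simp: hyp_space_def t_apply)

end

lemma restrict_in_Bij:
  assumes "\<And>w. w \<in> S \<Longrightarrow> F w \<in> S" "\<And>w. w \<in> S \<Longrightarrow> F' w \<in> S"
    "\<And>w. w \<in> S \<Longrightarrow> F (F' w) = w" "\<And>w. w \<in> S \<Longrightarrow> F' (F w) = w"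
  shows "restrict F S \<in> Bij S"
proof -
  have "bij_betw (restrict F S) S S"
    by (rule bij_betw_byWitness[where f' = F']) (use assms in auto)
  then show ?thesis by (simp add: Bij_def)
qed

lemma BijGroup_mult_restrict:
  assumes "restrict F S \<in> Bij S" "restrict F' S \<in> Bij S"
  shows "restrict F S \<otimes>\<^bsub>BijGroup S\<^esub> restrict F' S = restrict (\<lambda>w. F (F' w)) S"
proof -
  have "F' w \<in> S" if "w \<in> S" for w
    using assms(2) that by (auto simp: Bij_def bij_betw_def)
  then show ?thesis using assms by (auto simp: BijGroup_def compose_def restrict_def fun_eq_iff)
qed

context odd_quadratic_space
begin

lemma T2_in_Bij:
  assumes "i \<in> Omega n" "j \<in> Omega n" "plane i \<noteq> plane j"
  shows "T2 n i j a \<in> Bij (hyp_space n)"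
proof -
  have "t2 i j a (t2 i j (- a) w) = w" "t2 i j (- a) (t2 i j a w) = w" for w
    using assms by (simp_all add: t2_add t2_zero Omega_nonzero)
  then show ?thesis
    unfolding T2_eq_t2[OF assms(1,2)]
    by (intro restrict_in_Bij[where F' = "t2 i j (- a)"]) (use assms in \<open>auto intro: t2_in\<close>)
qed

lemma T1_in_Bij:
  assumes "i \<in> Omega n"
  shows "T1 n i \<xi> \<in> Bij (hyp_space n)"
proof -
  let ?\<zeta> = "(- fst \<xi>, - snd \<xi> + B (fst \<xi>) (fst \<xi>))"
  have "t1 i \<xi> (t1 i ?\<zeta> w) = w" "t1 i ?\<zeta> (t1 i \<xi> w) = w" for w
    using assms by (simp_all add: t1_add Omega_nonzero hadd_def t1_zero)
  then show ?thesis
    unfolding T1_eq_t1[OF assms]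
    by (intro restrict_in_Bij[where F' = "t1 i ?\<zeta>"]) (use assms in \<open>auto intro: t1_in\<close>)
qed

lemma gen_T_simps [simp]: "gen_T n (X2 i j a) = T2 n i j a" "gen_T n (X1 i \<xi>) = T1 n i \<xi>"
  by (simp_all add: gen_T_def)

lemma gen_T_in_Bij: "g \<in> steinberg_gens n \<Longrightarrow> gen_T n g \<in> carrier (BijGroup (hyp_space n))"
  by (cases g) (auto simp: BijGroup_def steinberg_gens_eq X2_in_root_gens X1_in_root_gens T2_in_Bij T1_in_Bij)

lemma carrier_EU: "carrier (EU n) = generate (BijGroup (hyp_space n)) (gen_T n ` steinberg_gens n)"
proof -
  have "carrier (BijGroup (hyp_space n)) \<inter> gen_T n ` steinberg_gens n = gen_T n ` steinberg_gens n"
    using gen_T_in_Bij by blast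
  then show ?thesis by (simp add: EU_def carrier_subgroup_generated)
qed

lemma group_EU: "group (EU n)"
  unfolding EU_def by (rule group.group_subgroup_generated[OF group_BijGroup])

lemma gen_T_in_EU: "g \<in> steinberg_gens n \<Longrightarrow> gen_T n g \<in> carrier (EU n)"
  unfolding carrier_EU by (blast intro: generate.incl)

lemma carrier_EU_Bij: "carrier (EU n) \<subseteq> Bij (hyp_space n)"
proof -
  have "carrier (BijGroup (hyp_space n)) = Bij (hyp_space n)" by (simp add: BijGroup_def)
  then show ?thesis
    unfolding EU_def using group.carrier_subgroup_generated_subset[OF group_BijGroup] by metis
qed

lemma mult_EU: "x \<otimes>\<^bsub>EU n\<^esub> y = x \<otimes>\<^bsub>BijGroup (hyp_space n)\<^esub> y"
  by (simp add: EU_def)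

lemma one_EU: "\<one>\<^bsub>EU n\<^esub> = restrict (\<lambda>w. w) (hyp_space n)"
  by (simp add: EU_def BijGroup_def)

lemma EU_mult_restrict:
  assumes "restrict F (hyp_space n) \<in> carrier (EU n)" "restrict F' (hyp_space n) \<in> carrier (EU n)"
  shows "restrict F (hyp_space n) \<otimes>\<^bsub>EU n\<^esub> restrict F' (hyp_space n) = restrict (\<lambda>w. F (F' w)) (hyp_space n)"
  using assms carrier_EU_Bij[of n] by (simp add: mult_EU BijGroup_mult_restrict subset_iff)

lemma T_in_EU:
  "i \<in> Omega n \<Longrightarrow> j \<in> Omega n \<Longrightarrow> plane i \<noteq> plane j \<Longrightarrow> T2 n i j a \<in> carrier (EU n)"
  "i \<in> Omega n \<Longrightarrow> \<xi> \<in> L \<Longrightarrow> T1 n i \<xi> \<in> carrier (EU n)"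
  using gen_T_in_EU[of "X2 i j a" n] gen_T_in_EU[of "X1 i \<xi>" n]
  by (simp_all add: steinberg_gens_eq X2_in_root_gens X1_in_root_gens)

lemma EU_family: "steinberg_family bar act B L (EU n) (Omega n) (T2 n) (T1 n)"
proof -
  let ?S = "hyp_space n"
  interpret EU: group "EU n" by (rule group_EU)
  note nz = Omega_nonzero
  have in2: "restrict (t2 i j a) ?S \<in> carrier (EU n)"
    if "i \<in> Omega n" "j \<in> Omega n" "plane i \<noteq> plane j" for i j a
    using T_in_EU(1)[OF that] that by (simp add: T2_eq_t2)
  have in1: "restrict (t1 i \<xi>) ?S \<in> carrier (EU n)" if "i \<in> Omega n" "\<xi> \<in> L" for i \<xi>
    using T_in_EU(2)[OF that] that by (simp add: T1_eq_t1)
  have mult: "restrict (\<lambda>w. F (F' w)) ?S \<in> carrier (EU n)"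
    "restrict F ?S \<otimes>\<^bsub>EU n\<^esub> restrict F' ?S = restrict (\<lambda>w. F (F' w)) ?S"
    if "restrict F ?S \<in> carrier (EU n)" "restrict F' ?S \<in> carrier (EU n)" for F F'
    using EU_mult_restrict[OF that] EU.m_closed[OF that] by simp_all
  note simps = T2_eq_t2 T1_eq_t1 EU.commutator_eq_iff in2 in1 mult nu_in hact_in flip_in hadd_in nz
  show ?thesis
  proof (unfold_locales, goal_cases)
    case (5 i j a)
    then show ?case by (simp add: T2_eq_t2 t2_flip nz fun_eq_iff restrict_def)
  next
    case (6 i j a b)
    then show ?case by (simp add: simps t2_add)
  next
    case (7 i \<xi> \<zeta>)
    then show ?case by (simp add: simps t1_add)
  next
    case (8 i j h k a b)
    then show ?case
      by (simp add: T2_eq_t2 EU.commutator_eq_one_iff in2 mult nz t2_t2_commute[of i j h k])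
  next
    case (9 i \<xi> j k a)
    then show ?case
      by (simp add: T2_eq_t2 T1_eq_t1 EU.commutator_eq_one_iff in2 in1 mult nz t1_t2_commute[of i j k])
  next
    case (10 i j k a b)
    then show ?case by (simp add: simps t2_t2[of i j k])
  next
    case (11 i j \<xi> \<zeta>)
    then show ?case by (simp add: simps t1_t1[of i j])
  next
    case (12 i j \<xi> b)
    then have rhs: "T2 n i j (eps i * snd \<xi> * b) \<otimes>\<^bsub>EU n\<^esub> T1 n (- j) (hact (flip \<xi>) b)
      = restrict (\<lambda>w. t2 i j (eps i * snd \<xi> * b) (t1 (- j) (hact (flip \<xi>) b) w)) ?S"
      and closed: "restrict (\<lambda>w. t2 i j (eps i * snd \<xi> * b) (t1 (- j) (hact (flip \<xi>) b) w)) ?S \<in> carrier (EU n)"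
      by (simp_all add: simps)
    show ?case unfolding rhs using 12 closed by (simp add: simps t1_t2[of i j])
  next
    case (13 i j a b)
    then show ?case by (simp add: simps t2_t2_long[of i j])
  qed (auto simp: T_in_EU nz dest: Omega_nonzero)
qed

lemma gen_T_satisfies: "satisfies (steinberg_gens n) steinberg_rel (EU n) (gen_T n)"
  using EU_family[of n] steinberg_family_iff[of "Omega n" "EU n" "gen_T n"]
  by (simp add: steinberg_gens_eq)

section \<open>The Steinberg group as a universal central extension\<close>

lemma steinberg_family_gens:
  fixes G :: "'g monoid"
  assumes "0 \<notin> \<Omega>" "\<And>i. i \<in> \<Omega> \<Longrightarrow> - i \<in> \<Omega>" "group G" "satisfies (root_gens L \<Omega>) steinberg_rel G X"
  shows "steinberg_family bar act B L G \<Omega> (\<lambda>i j a. X (X2 i j a)) (\<lambda>i \<xi>. X (X1 i \<xi>))"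
  using steinberg_family_iff[OF assms(1,2), of G X] assms(3,4) by blast

text \<open>A short root element is a commutator by R5, and a long one is a commutator up to a short one by R8.\<close>

lemma steinberg_perfect:
  fixes G :: "'g monoid"
  assumes \<Omega>: "0 \<notin> \<Omega>" "\<And>i. i \<in> \<Omega> \<Longrightarrow> - i \<in> \<Omega>"
    and fresh: "\<And>i j. \<exists>m\<in>\<Omega>. plane m \<noteq> plane i \<and> plane m \<noteq> plane j"
    and G: "group G" and X: "satisfies (root_gens L \<Omega>) steinberg_rel G X"
    and gens: "generate G (X ` root_gens L \<Omega>) = carrier G"
  shows "carrier G \<subseteq> derived G (carrier G)"
proof -
  interpret steinberg_family bar act B L G \<Omega> "\<lambda>i j a. X (X2 i j a)" "\<lambda>i \<xi>. X (X1 i \<xi>)"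
    using steinberg_family_gens[OF \<Omega> G X] .
  interpret D: subgroup "derived G (carrier G)" G
    by (rule derived_is_subgroup) simp
  have comm: "commutator G x y \<in> derived G (carrier G)" if "x \<in> carrier G" "y \<in> carrier G" for x y
    unfolding derived_def commutator_def using that by (blast intro: generate.incl)
  have short: "X (X2 i j a) \<in> derived G (carrier G)" if ij: "i \<in> \<Omega>" "j \<in> \<Omega>" "plane i \<noteq> plane j" for i j a
  proof -
    obtain m where m: "m \<in> \<Omega>" "plane m \<noteq> plane i" "plane m \<noteq> plane j" using fresh by blast
    then show ?thesis using comm[of "X (X2 i m a)" "X (X2 m j 1)"] ij by (simp add: x2_x2)
  qed
  have "X g \<in> derived G (carrier G)" if g: "g \<in> root_gens L \<Omega>" for g
  proof (cases g)
    case (X2 i j a)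
    then show ?thesis using g short by (simp add: X2_in_root_gens)
  next
    case (X1 j \<xi>)
    then have j: "j \<in> \<Omega>" and \<xi>: "\<xi> \<in> L" using g by (simp_all add: X1_in_root_gens)
    obtain m where m: "m \<in> \<Omega>" "plane m \<noteq> plane j" using fresh by blast
    let ?s = "X (X2 m (-j) (eps m * snd (flip \<xi>)))" and ?c = "commutator G (X (X1 m (flip \<xi>))) (X (X2 (-m) (-j) 1))"
    have "?c = ?s \<otimes>\<^bsub>G\<^esub> X (X1 j \<xi>)" using m j \<xi> x1_x2[of m "-j" "flip \<xi>" 1] by (simp add: flip_in)
    then have "X (X1 j \<xi>) = inv\<^bsub>G\<^esub> ?s \<otimes>\<^bsub>G\<^esub> ?c" using m j \<xi> by simp
    moreover have "?s \<in> derived G (carrier G)" "?c \<in> derived G (carrier G)"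
      using m j \<xi> by (simp_all add: short comm flip_in)
    ultimately show ?thesis using X1 D.m_inv_closed D.m_closed by metis
  qed
  then have "generate G (X ` root_gens L \<Omega>) \<subseteq> derived G (carrier G)"
    by (intro generate_subgroup_incl D.subgroup_axioms) blast
  then show ?thesis using gens by simp
qed

text \<open>The lifts required by \<open>universal_central_extensionI\<close> are those of \<open>lifted_family\<close>, applied to the images
  of the generators in \<open>G\<close>.\<close>

lemma steinberg_universal:
  fixes E :: "'e monoid" and G :: "'g monoid"
  assumes \<Omega>: "0 \<notin> \<Omega>" "\<And>i. i \<in> \<Omega> \<Longrightarrow> - i \<in> \<Omega>"
    and fresh: "\<And>i j h k. \<exists>m\<in>\<Omega>. plane m \<noteq> plane i \<and> plane m \<noteq> plane j \<and> plane m \<noteq> plane h \<and> plane m \<noteq> plane k"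
    and ext: "central_extension E G p" and X: "satisfies (root_gens L \<Omega>) steinberg_rel E X"
    and gens: "generate E (X ` root_gens L \<Omega>) = carrier E"
    and univ: "\<And>(H :: 'h monoid) Y. group H \<Longrightarrow> satisfies (root_gens L \<Omega>) steinberg_rel H Y \<Longrightarrow>
      \<exists>\<phi> \<in> hom E H. \<forall>g \<in> root_gens L \<Omega>. \<phi> (X g) = Y g"
  shows "universal_central_extension TYPE('h) E G p"
proof (rule universal_central_extensionI[where X = X and S = "root_gens L \<Omega>" and rel = steinberg_rel])
  interpret E: central_ext E G p using ext by (simp add: central_extension_iff)
  have "\<exists>m\<in>\<Omega>. plane m \<noteq> plane i \<and> plane m \<noteq> plane j" for i j using fresh[of i j j j] by blast
  then show "carrier E \<subseteq> derived E (carrier E)"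
    by (intro steinberg_perfect[OF \<Omega> _ E.H.group_axioms X gens])
  have pX: "satisfies (root_gens L \<Omega>) steinberg_rel G (p \<circ> X)"
    using satisfies_hom(1)[OF X E.homh E.H.group_axioms E.G.group_axioms] .
  fix H :: "'h monoid" and \<epsilon> assume H: "central_extension H G \<epsilon>"
  interpret H: central_ext H G \<epsilon> using H by (simp add: central_extension_iff)
  interpret steinberg_family bar act B L G \<Omega> "\<lambda>i j a. (p \<circ> X) (X2 i j a)" "\<lambda>i \<xi>. (p \<circ> X) (X1 i \<xi>)"
    using steinberg_family_gens[OF \<Omega> E.G.group_axioms pX] .
  interpret steinberg_lift bar act B L H G \<epsilon> \<Omega> "\<lambda>i j a. (p \<circ> X) (X2 i j a)" "\<lambda>i \<xi>. (p \<circ> X) (X1 i \<xi>)"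
    by unfold_locales (rule fresh)
  define Y where "Y = (\<lambda>g. case g of X2 i j a \<Rightarrow> y2 i j a | X1 i \<xi> \<Rightarrow> y1 i \<xi>)"
  have "steinberg_family bar act B L H \<Omega> (\<lambda>i j a. Y (X2 i j a)) (\<lambda>i \<xi>. Y (X1 i \<xi>))"
    using lifted_family by (simp add: Y_def del: o_apply)
  then have "satisfies (root_gens L \<Omega>) steinberg_rel H Y"
    using steinberg_family_iff[OF \<Omega>, of H Y] by blast
  moreover have "\<epsilon> (Y g) = (p \<circ> X) g" if "g \<in> root_gens L \<Omega>" for g
    using that by (cases g) (simp_all add: Y_def X2_in_root_gens X1_in_root_gens del: o_apply)
  ultimately show "\<exists>Y. satisfies (root_gens L \<Omega>) steinberg_rel H Y \<and> (\<forall>g\<in>root_gens L \<Omega>. \<epsilon> (Y g) = p (X g))"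
    by auto
qed (use ext gens univ in auto)

abbreviation stu_gen :: "nat \<Rightarrow> ('r, 'v) steinberg_gen \<Rightarrow> ('r, 'v) stu_elem"
  where "stu_gen n \<equiv> gen_class (steinberg_gens n) steinberg_rel"

lemma group_StU: "group (StU n)"
  by (simp add: StU_def group_presented_group)

lemma stu_gen_satisfies: "satisfies (steinberg_gens n) steinberg_rel (StU n) (stu_gen n)"
  unfolding StU_def by (rule satisfies_gen_class)

lemma StU_generated: "generate (StU n) (stu_gen n ` steinberg_gens n) = carrier (StU n)"
  unfolding StU_def by (rule presented_group_generated)

lemma StU_lift:
  assumes "group H" "satisfies (steinberg_gens n) steinberg_rel H Y"
  shows "presented_lift H Y \<in> hom (StU n) H" "g \<in> steinberg_gens n \<Longrightarrow> presented_lift H Y (stu_gen n g) = Y g"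
  using group.presented_lift_hom[OF assms] group.presented_lift_gen[OF assms] by (simp_all add: StU_def)

lemma proj_hom: "proj n \<in> hom (StU n) (EU n)"
  unfolding proj_def by (rule StU_lift[OF group_EU gen_T_satisfies])

lemma proj_gen: "g \<in> steinberg_gens n \<Longrightarrow> proj n (stu_gen n g) = gen_T n g"
  unfolding proj_def by (rule StU_lift[OF group_EU gen_T_satisfies])

lemma stu_gen_closed: "g \<in> steinberg_gens n \<Longrightarrow> stu_gen n g \<in> carrier (StU n)"
  using stu_gen_satisfies by (auto simp: satisfies_def)

lemma group_hom_proj: "group_hom (StU n) (EU n) (proj n)"
  by (simp add: group_hom_def group_hom_axioms_def group_StU group_EU proj_hom)

lemma proj_epi: "proj n \<in> epi (StU n) (EU n)"
proof -
  let ?Bij = "BijGroup (hyp_space n) :: ('r, 'v) eu_elem monoid"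
  have "carrier (EU n) \<subseteq> carrier ?Bij" using carrier_EU_Bij by (simp add: BijGroup_def)
  then have "proj n \<in> hom (StU n) ?Bij" using proj_hom[of n] by (auto simp: hom_def mult_EU)
  then interpret group_hom "StU n" ?Bij "proj n"
    by (simp add: group_hom_def group_hom_axioms_def group_StU group_BijGroup)
  have "proj n ` carrier (StU n) = generate ?Bij (proj n ` stu_gen n ` steinberg_gens n)"
    unfolding StU_generated[symmetric] by (rule generate_img[symmetric]) (use stu_gen_closed in blast)
  also have "proj n ` stu_gen n ` steinberg_gens n = gen_T n ` steinberg_gens n"
    by (simp add: image_image proj_gen)
  finally show ?thesis using proj_hom by (simp add: epi_def carrier_EU)
qed

text \<open>Of the five planes with numbers \<open>1\<close> to \<open>5\<close>, four given indices meet at most four.\<close>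

lemma Omega_fresh:
  assumes "5 \<le> n"
  shows "\<exists>m\<in>Omega n. plane m \<noteq> plane i \<and> plane m \<noteq> plane j \<and> plane m \<noteq> plane h \<and> plane m \<noteq> plane k"
proof -
  have "card {\<bar>i\<bar>, \<bar>j\<bar>, \<bar>h\<bar>, \<bar>k\<bar>} \<le> 4"
    using card_insert_le_m1[of 4] by (simp add: card_insert_if)
  then have "\<not> {1..5::int} \<subseteq> {\<bar>i\<bar>, \<bar>j\<bar>, \<bar>h\<bar>, \<bar>k\<bar>}"
    using card_mono[of "{\<bar>i\<bar>, \<bar>j\<bar>, \<bar>h\<bar>, \<bar>k\<bar>}" "{1..5::int}"] by auto
  then obtain m where "m \<in> {1..5::int}" "m \<notin> {\<bar>i\<bar>, \<bar>j\<bar>, \<bar>h\<bar>, \<bar>k\<bar>}" by blast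
  then have m: "1 \<le> m" "m \<le> 5" "m \<notin> {\<bar>i\<bar>, \<bar>j\<bar>, \<bar>h\<bar>, \<bar>k\<bar>}" by simp_all
  have \<Omega>: "m \<in> Omega n" using m(1,2) assms by (simp add: Omega_def)
  have ne: "plane m \<noteq> plane l" if "\<bar>l\<bar> \<noteq> m" for l
    using m(1) that by (auto simp: plane_eq_iff)
  show ?thesis using m(3) by (intro bexI[OF _ \<Omega>] conjI ne) auto
qed

lemma StU_universal:
  assumes "5 \<le> n" "K2U n \<subseteq> center (StU n)"
  shows "universal_central_extension TYPE('h) (StU n) (EU n) (proj n)"
proof (rule steinberg_universal[where \<Omega> = "Omega n" and X = "stu_gen n"])
  show "central_extension (StU n) (EU n) (proj n)"
    using assms(2) by (simp add: central_extension_def group_StU group_EU proj_epi K2U_def)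
  fix H :: "'h monoid" and Y
  assume "group H" "satisfies (root_gens L (Omega n)) steinberg_rel H Y"
  then show "\<exists>\<phi>\<in>hom (StU n) H. \<forall>g\<in>root_gens L (Omega n). \<phi> (stu_gen n g) = Y g"
    using StU_lift[of H n Y] by (auto simp: steinberg_gens_eq)
qed (use Omega_fresh[OF assms(1)] stu_gen_satisfies[of n] StU_generated[of n] in
    \<open>simp_all add: steinberg_gens_eq\<close>)

end

section \<open>Centrality of stable kernels\<close>

context steinberg_family
begin

text \<open>The analogue of the unipotent radical of the parabolic subgroup that stabilizes the line spanned by
  \<open>e\<^sub>m\<close>.\<close>

definition radical_gens :: "int \<Rightarrow> 'g set"
  where "radical_gens m = {x2 m j a | j a. j \<in> \<Omega> \<and> plane m \<noteq> plane j} \<union> {x1 m \<xi> | \<xi>. \<xi> \<in> L}"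

definition radical :: "int \<Rightarrow> 'g set"
  where "radical m = generate G (radical_gens m)"

text \<open>The root elements that do not involve the plane of \<open>m\<close>. In the elementary group they fix
  \<open>e\<^sub>m\<close> and \<open>e\<^sub>-\<^sub>m\<close>.\<close>

definition levi_gens :: "int \<Rightarrow> 'g set"
  where "levi_gens m = {x2 i j a | i j a. i \<in> \<Omega> \<and> j \<in> \<Omega> \<and> plane i \<noteq> plane j \<and> plane m \<noteq> plane i \<and> plane m \<noteq> plane j}
    \<union> {x1 i \<xi> | i \<xi>. i \<in> \<Omega> \<and> plane m \<noteq> plane i \<and> \<xi> \<in> L}"

lemma radical_gens_closed: "m \<in> \<Omega> \<Longrightarrow> radical_gens m \<subseteq> carrier G"
  by (auto simp: radical_gens_def)

lemma levi_gens_closed: "levi_gens m \<subseteq> carrier G"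
  by (auto simp: levi_gens_def)

lemma subgroup_radical: "m \<in> \<Omega> \<Longrightarrow> subgroup (radical m) G"
  unfolding radical_def by (intro generate_is_subgroup radical_gens_closed)

lemma x2_in_radical: "j \<in> \<Omega> \<Longrightarrow> plane m \<noteq> plane j \<Longrightarrow> x2 m j a \<in> radical m"
  unfolding radical_def radical_gens_def by (blast intro: generate.incl)

lemma x1_in_radical: "\<xi> \<in> L \<Longrightarrow> x1 m \<xi> \<in> radical m"
  unfolding radical_def radical_gens_def by (blast intro: generate.incl)

lemma x2_in_radical_neg: "m \<in> \<Omega> \<Longrightarrow> j \<in> \<Omega> \<Longrightarrow> plane m \<noteq> plane j \<Longrightarrow> x2 j (-m) a \<in> radical m"
  using x2_flip[of j "-m" a] x2_in_radical[of "-j" m] by simp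

lemma levi_commutator_radical:
  assumes m: "m \<in> \<Omega>" and g: "g \<in> levi_gens m" and u: "u \<in> radical_gens m"
  shows "commutator G g u \<in> radical m"
proof -
  interpret R: subgroup "radical m" G using m by (rule subgroup_radical)
  note nz = nonzero
  consider (s) i j a where "g = x2 i j a" "i \<in> \<Omega>" "j \<in> \<Omega>" "plane i \<noteq> plane j" "plane m \<noteq> plane i" "plane m \<noteq> plane j"
    | (l) i \<xi> where "g = x1 i \<xi>" "i \<in> \<Omega>" "plane m \<noteq> plane i" "\<xi> \<in> L"
    using g by (auto simp: levi_gens_def)
  then show ?thesis
  proof cases
    case s
    note ne = s(4-6)[THEN plane_neD]
    consider (s') k b where "u = x2 m k b" "k \<in> \<Omega>" "plane m \<noteq> plane k" | (l') \<zeta> where "u = x1 m \<zeta>" "\<zeta> \<in> L"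
      using u by (auto simp: radical_gens_def)
    then show ?thesis
    proof cases
      case s'
      note ne' = s'(3)[THEN plane_neD]
      consider "k = i" | "k = - j" | "k \<noteq> i" "k \<noteq> - j" by blast
      then show ?thesis
      proof cases
        case 1
        have "commutator G g u = inv (commutator G (x2 m i b) (x2 i j a))"
          using s s' 1 m by (simp add: commutator_swap)
        also have "\<dots> = inv (x2 m j (b * a))" using s m by (simp add: x2_x2)
        finally show ?thesis using s by (simp add: R.m_inv_closed x2_in_radical)
      next
        case 2
        have "commutator G g u = commutator G (x2 i j a) (x2 j (-m) (eps j * bar b * eps m))"
          using s s' 2 m x2_flip[of m "-j" b] by simp
        also have "\<dots> = x2 i (-m) (a * (eps j * bar b * eps m))" using s m by (simp add: x2_x2)
        finally show ?thesis using s m by (simp add: x2_in_radical_neg)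
      next
        case 3
        then show ?thesis using s s' m ne x2_x2_commute[of i j m k a b] by simp
      qed
    next
      case l'
      have "commutator G u g = \<one>" using s l' m ne x1_x2_commute[of m \<zeta> i j a] by simp
      moreover have "commutator G g u = inv (commutator G u g)" using s l' m commutator_swap[of u g] by simp
      ultimately show ?thesis by simp
    qed
  next
    case l
    note ne = l(3)[THEN plane_neD]
    consider (s') k b where "u = x2 m k b" "k \<in> \<Omega>" "plane m \<noteq> plane k" | (l') \<zeta> where "u = x1 m \<zeta>" "\<zeta> \<in> L"
      using u by (auto simp: radical_gens_def)
    then show ?thesis
    proof cases
      case s'
      show ?thesis
      proof (cases "k = i")
        case True
        have "commutator G g u = commutator G (x1 i \<xi>) (x2 (-i) (-m) (eps (-i) * bar b * eps m))"
          using l s' True m x2_flip[of m i b] by simp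
        then show ?thesis
          using l m x1_x2[of i "-m" \<xi> "eps (-i) * bar b * eps m"]
          by (simp add: R.m_closed x2_in_radical_neg x1_in_radical hact_in flip_in)
      next
        case False
        then show ?thesis using l s' m ne x1_x2_commute[of i \<xi> m k b] by simp
      qed
    next
      case l'
      then show ?thesis using l m x1_x1[of i m \<xi> \<zeta>] by (simp add: x2_in_radical_neg)
    qed
  qed
qed

definition normalizes :: "int \<Rightarrow> 'g \<Rightarrow> bool"
  where "normalizes m g \<longleftrightarrow> g \<in> carrier G \<and> (\<forall>u \<in> radical m. g \<otimes> u \<otimes> inv g \<in> radical m)"

lemma levi_normalizes:
  assumes m: "m \<in> \<Omega>" and g: "g \<in> levi_gens m"
  shows "normalizes m g"
  unfolding normalizes_def
proof (intro conjI ballI)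
  interpret R: subgroup "radical m" G using m by (rule subgroup_radical)
  show g_in: "g \<in> carrier G" using g levi_gens_closed by blast
  have gens: "h \<in> carrier G \<and> h \<in> radical m \<and> g \<otimes> h \<otimes> inv g \<in> radical m" if "h \<in> radical_gens m" for h
  proof -
    have h: "h \<in> carrier G" "h \<in> radical m"
      using that radical_gens_closed[OF m] generate.incl[of h "radical_gens m" G] by (auto simp: radical_def)
    have "g \<otimes> h \<otimes> inv g = commutator G g h \<otimes> h"
      using g_in h by (simp add: commutator_def m_assoc)
    then show ?thesis using levi_commutator_radical[OF m g that] h by (simp add: R.m_closed)
  qed
  fix u assume "u \<in> radical m"
  then have "u \<in> generate G (radical_gens m)" by (simp add: radical_def)
  then have "u \<in> carrier G \<and> g \<otimes> u \<otimes> inv g \<in> radical m"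
  proof (induction rule: generate.induct)
    case one
    then show ?case using g_in by (simp add: R.one_closed)
  next
    case (incl h)
    then show ?case using gens by blast
  next
    case (inv h)
    then have h: "h \<in> carrier G" "g \<otimes> h \<otimes> inv g \<in> radical m" using gens by blast+
    have "g \<otimes> inv h \<otimes> inv g = inv (g \<otimes> h \<otimes> inv g)"
      using g_in h by (simp add: inv_mult_group m_assoc)
    then show ?case using h R.m_inv_closed by simp
  next
    case (eng h1 h2)
    then have "g \<otimes> (h1 \<otimes> h2) \<otimes> inv g = (g \<otimes> h1 \<otimes> inv g) \<otimes> (g \<otimes> h2 \<otimes> inv g)"
      using g_in by (simp add: m_assoc)
    then show ?case using eng R.m_closed by simp
  qed
  then show "g \<otimes> u \<otimes> inv g \<in> radical m" by simp
qed

lemma normalizes_one: "m \<in> \<Omega> \<Longrightarrow> normalizes m \<one>"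
  using subgroup.mem_carrier[OF subgroup_radical] by (simp add: normalizes_def)

lemma normalizes_mult:
  assumes m: "m \<in> \<Omega>" and g: "normalizes m g" "normalizes m h"
  shows "normalizes m (g \<otimes> h)"
proof -
  have "g \<otimes> h \<otimes> u \<otimes> inv (g \<otimes> h) = g \<otimes> (h \<otimes> u \<otimes> inv h) \<otimes> inv g" if "u \<in> radical m" for u
    using that subgroup.mem_carrier[OF subgroup_radical[OF m] that] g
    by (simp add: normalizes_def inv_mult_group m_assoc)
  then show ?thesis using g by (simp add: normalizes_def)
qed

lemma levi_gens_inv: "g \<in> levi_gens m \<Longrightarrow> inv g \<in> levi_gens m"
  unfolding levi_gens_def
proof (elim UnE CollectE exE conjE)
  fix i j a assume "g = x2 i j a" "i \<in> \<Omega>" "j \<in> \<Omega>" "plane i \<noteq> plane j" "plane m \<noteq> plane i" "plane m \<noteq> plane j"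
  then show "inv g \<in> {x2 i j a | i j a. i \<in> \<Omega> \<and> j \<in> \<Omega> \<and> plane i \<noteq> plane j \<and> plane m \<noteq> plane i \<and> plane m \<noteq> plane j}
    \<union> {x1 i \<xi> | i \<xi>. i \<in> \<Omega> \<and> plane m \<noteq> plane i \<and> \<xi> \<in> L}"
    using x2_inv[of i j a] by blast
next
  fix i \<xi> assume "g = x1 i \<xi>" "i \<in> \<Omega>" "plane m \<noteq> plane i" "\<xi> \<in> L"
  then show "inv g \<in> {x2 i j a | i j a. i \<in> \<Omega> \<and> j \<in> \<Omega> \<and> plane i \<noteq> plane j \<and> plane m \<noteq> plane i \<and> plane m \<noteq> plane j}
    \<union> {x1 i \<xi> | i \<xi>. i \<in> \<Omega> \<and> plane m \<noteq> plane i \<and> \<xi> \<in> L}"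
    using x1_inv[of i \<xi>] hinv_in[of \<xi>] by blast
qed

lemma levi_generated_normalizes:
  assumes m: "m \<in> \<Omega>" and g: "g \<in> generate G (levi_gens m)"
  shows "normalizes m g"
  using g
  by (induction rule: generate.induct)
    (simp_all add: m levi_normalizes levi_gens_inv normalizes_one normalizes_mult)

text \<open>The elements of the radical have a normal form: short root elements in a fixed order, followed by a
  long root element. This holds because two short generators commute up to some \<open>x\<^sub>m(0, z)\<close>, and the long
  ones commute with the short ones.\<close>

definition short_prod :: "int \<Rightarrow> (int \<Rightarrow> 'r) \<Rightarrow> int list \<Rightarrow> 'g"
  where "short_prod m c js = foldr (\<lambda>j g. x2 m j (c j) \<otimes> g) js \<one>"

lemma short_prod_Nil [simp]: "short_prod m c [] = \<one>"
  and short_prod_Cons [simp]: "short_prod m c (j # js) = x2 m j (c j) \<otimes> short_prod m c js"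
  by (simp_all add: short_prod_def)

lemma short_prod_closed:
  "m \<in> \<Omega> \<Longrightarrow> \<forall>j\<in>set js. j \<in> \<Omega> \<and> plane m \<noteq> plane j \<Longrightarrow> short_prod m c js \<in> carrier G"
  by (induction js) simp_all

lemma short_prod_cong: "\<forall>j\<in>set js. c j = c' j \<Longrightarrow> short_prod m c js = short_prod m c' js"
  by (induction js) simp_all

lemma x1_short_prod_commute:
  assumes "m \<in> \<Omega>" "\<xi> \<in> L" "\<forall>j\<in>set js. j \<in> \<Omega> \<and> plane m \<noteq> plane j"
  shows "x1 m \<xi> \<otimes> short_prod m c js = short_prod m c js \<otimes> x1 m \<xi>"
  using assms(3)
proof (induction js)
  case (Cons j js)
  then have j: "j \<in> \<Omega>" "plane m \<noteq> plane j" by simp_all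
  have "commutator G (x1 m \<xi>) (x2 m j (c j)) = \<one>"
    using assms j plane_neD[OF j(2)] nonzero[OF assms(1)] by (intro x1_x2_commute) auto
  then have "x1 m \<xi> \<otimes> x2 m j (c j) = x2 m j (c j) \<otimes> x1 m \<xi>"
    using assms j by (simp add: commutator_eq_one_iff)
  then show ?case unfolding short_prod_Cons
    using Cons assms j short_prod_closed[of m js c] by (intro commute_mult) simp_all
qed (use assms in simp)

lemma short_commutator_long:
  assumes "m \<in> \<Omega>" "j \<in> \<Omega>" "k \<in> \<Omega>" "plane m \<noteq> plane j" "plane m \<noteq> plane k" "k \<noteq> j"
  shows "\<exists>z. (0, z) \<in> L \<and> commutator G (x2 m j a) (x2 m k b) = x1 m (0, z)"
proof (cases "k = - j")
  case True
  have "commutator G (x2 m j a) (x2 m k b) = commutator G (x2 m j a) (x2 j (-m) (eps j * bar b * eps m))"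
    using assms True x2_flip[of m "-j" b] by simp
  then show ?thesis using assms nu_in nonzero by (auto simp: x2_x2_long)
next
  case False
  then show ?thesis using assms plane_neD[OF assms(4)] plane_neD[OF assms(5)] nonzero[OF assms(1)] zero_in
    by (intro exI[of _ 0]) (simp add: x2_x2_commute x1_zero)
qed

lemma x2_short_prod:
  assumes "m \<in> \<Omega>" "distinct js" "\<forall>j\<in>set js. j \<in> \<Omega> \<and> plane m \<noteq> plane j" "j \<in> set js"
  shows "\<exists>c' z. (0, z) \<in> L \<and> x2 m j a \<otimes> short_prod m c js = short_prod m c' js \<otimes> x1 m (0, z)"
  using assms(2-4)
proof (induction js)
  case (Cons k ks)
  then have k: "k \<in> \<Omega>" "plane m \<noteq> plane k" "k \<notin> set ks" and ks: "\<forall>j\<in>set ks. j \<in> \<Omega> \<and> plane m \<noteq> plane j"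
    and j: "j \<in> \<Omega>" "plane m \<noteq> plane j" by auto
  note [simp] = assms(1) short_prod_closed[OF assms(1) ks] k(1,2) j
  show ?case
  proof (cases "j = k")
    case True
    have "x2 m j a \<otimes> short_prod m c (k # ks) = x2 m k (a + c k) \<otimes> short_prod m c ks"
      using True by (simp add: m_assoc[symmetric] x2_add)
    also have "short_prod m c ks = short_prod m (c(k := a + c k)) ks"
      using k by (intro short_prod_cong) auto
    also have "x2 m k (a + c k) \<otimes> \<dots> = short_prod m (c(k := a + c k)) (k # ks) \<otimes> x1 m (0, 0)"
      by (simp add: x1_zero)
    finally show ?thesis using zero_in by blast
  next
    case False
    obtain z where z: "(0, z) \<in> L" "commutator G (x2 m j a) (x2 m k (c k)) = x1 m (0, z)"
      using short_commutator_long[of m j k a "c k"] False by auto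
    obtain c' z' where IH: "(0, z') \<in> L" "x2 m j a \<otimes> short_prod m c ks = short_prod m c' ks \<otimes> x1 m (0, z')"
      using Cons False ks by auto
    let ?c = "c'(k := c k)"
    have c': "short_prod m c' ks = short_prod m ?c ks" using k by (intro short_prod_cong) auto
    have "x2 m j a \<otimes> short_prod m c (k # ks) = (x2 m j a \<otimes> x2 m k (c k)) \<otimes> short_prod m c ks"
      by (simp add: m_assoc)
    also have "x2 m j a \<otimes> x2 m k (c k) = x1 m (0, z) \<otimes> (x2 m k (c k) \<otimes> x2 m j a)"
      using z by (simp add: commutator_eq_iff)
    also have "\<dots> \<otimes> short_prod m c ks = x1 m (0, z) \<otimes> short_prod m ?c (k # ks) \<otimes> x1 m (0, z')"
      using z IH by (simp add: m_assoc c')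
    also have "x1 m (0, z) \<otimes> short_prod m ?c (k # ks) = short_prod m ?c (k # ks) \<otimes> x1 m (0, z)"
      using z k ks by (intro x1_short_prod_commute) simp_all
    also have "\<dots> \<otimes> x1 m (0, z') = short_prod m ?c (k # ks) \<otimes> (x1 m (0, z) \<otimes> x1 m (0, z'))"
      using z IH by (simp add: m_assoc)
    also have "x1 m (0, z) \<otimes> x1 m (0, z') = x1 m (0, z + z')" using z IH by (simp add: x1_add hadd_def)
    finally have "x2 m j a \<otimes> short_prod m c (k # ks) = short_prod m ?c (k # ks) \<otimes> x1 m (0, z + z')" .
    moreover have "(0, z + z') \<in> L" using hadd_in[OF z(1) IH(1)] by (simp add: hadd_def)
    ultimately show ?thesis by blast
  qed
qed simp

lemma radical_gens_inv: "m \<in> \<Omega> \<Longrightarrow> u \<in> radical_gens m \<Longrightarrow> inv u \<in> radical_gens m"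
  unfolding radical_gens_def
proof (elim UnE CollectE exE conjE)
  fix j a assume "m \<in> \<Omega>" "u = x2 m j a" "j \<in> \<Omega>" "plane m \<noteq> plane j"
  then show "inv u \<in> {x2 m j a | j a. j \<in> \<Omega> \<and> plane m \<noteq> plane j} \<union> {x1 m \<xi> | \<xi>. \<xi> \<in> L}"
    using x2_inv[of m j a] by blast
next
  fix \<xi> assume "m \<in> \<Omega>" "u = x1 m \<xi>" "\<xi> \<in> L"
  then show "inv u \<in> {x2 m j a | j a. j \<in> \<Omega> \<and> plane m \<noteq> plane j} \<union> {x1 m \<xi> | \<xi>. \<xi> \<in> L}"
    using x1_inv[of m \<xi>] hinv_in[of \<xi>] by blast
qed

lemma radical_normal_form:
  assumes m: "m \<in> \<Omega>" and js: "distinct js" "set js = {j \<in> \<Omega>. plane m \<noteq> plane j}" and u: "u \<in> radical m"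
  shows "\<exists>c \<xi>. \<xi> \<in> L \<and> u = short_prod m c js \<otimes> x1 m \<xi>"
proof -
  define N where "N = {short_prod m c js \<otimes> x1 m \<xi> | c \<xi>. \<xi> \<in> L}"
  have js': "\<forall>j\<in>set js. j \<in> \<Omega> \<and> plane m \<noteq> plane j" using js by simp
  note [simp] = m short_prod_closed[OF m js']
  have gens: "g \<in> carrier G \<and> (\<forall>v\<in>N. g \<otimes> v \<in> N)" if g: "g \<in> radical_gens m" for g
  proof (intro conjI ballI)
    show g_in: "g \<in> carrier G" using g radical_gens_closed[OF m] by blast
    fix v assume "v \<in> N"
    then obtain c \<xi> where v: "v = short_prod m c js \<otimes> x1 m \<xi>" "\<xi> \<in> L" unfolding N_def by blast
    from g consider (s) j a where "g = x2 m j a" "j \<in> set js" | (l) \<zeta> where "g = x1 m \<zeta>" "\<zeta> \<in> L"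
      unfolding js(2) by (auto simp: radical_gens_def)
    then show "g \<otimes> v \<in> N"
    proof cases
      case s
      obtain c' z where c': "(0, z) \<in> L" "x2 m j a \<otimes> short_prod m c js = short_prod m c' js \<otimes> x1 m (0, z)"
        using x2_short_prod[OF m js(1) js' s(2)] by blast
      have "g \<otimes> v = (x2 m j a \<otimes> short_prod m c js) \<otimes> x1 m \<xi>" using s v g_in by (simp add: m_assoc)
      also have "\<dots> = short_prod m c' js \<otimes> x1 m (hadd (0, z) \<xi>)"
        unfolding c'(2) using c' v by (simp add: m_assoc x1_add)
      finally show ?thesis using hadd_in[OF c'(1) v(2)] unfolding N_def by blast
    next
      case l
      have "g \<otimes> v = (x1 m \<zeta> \<otimes> short_prod m c js) \<otimes> x1 m \<xi>" using l v by (simp add: m_assoc)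
      also have "\<dots> = short_prod m c js \<otimes> x1 m (hadd \<zeta> \<xi>)"
        unfolding x1_short_prod_commute[OF m l(2) js'] using l v by (simp add: m_assoc x1_add)
      finally show ?thesis using hadd_in[OF l(2) v(2)] unfolding N_def by blast
    qed
  qed
  have N_closed: "N \<subseteq> carrier G" by (auto simp: N_def)
  have "u \<in> carrier G \<and> (\<forall>v\<in>N. u \<otimes> v \<in> N)"
    using u unfolding radical_def
  proof (induction rule: generate.induct)
    case one
    then show ?case using N_closed by auto
  next
    case (incl h)
    then show ?case by (rule gens)
  next
    case (inv h)
    then show ?case by (intro gens radical_gens_inv m)
  next
    case (eng h1 h2)
    have "h1 \<otimes> h2 \<otimes> v = h1 \<otimes> (h2 \<otimes> v)" if "v \<in> N" for v
      using that N_closed eng by (intro m_assoc) blast+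
    then show ?case using eng by simp
  qed
  moreover have "short_prod m (\<lambda>_. 0) js = \<one>"
    using js' by (induction js) (simp_all add: x2_zero)
  then have "\<one> = short_prod m (\<lambda>_. 0) js \<otimes> x1 m (0, 0)" by (simp add: x1_zero)
  then have "\<one> \<in> N" unfolding N_def using zero_in by blast
  ultimately have "u \<otimes> \<one> \<in> N" "u \<in> carrier G" by blast+
  then have "u \<in> N" by simp
  then show ?thesis unfolding N_def by blast
qed

text \<open>By R0 the short root elements with one index \<open>m\<close> or \<open>- m\<close> lie in one of the two radicals. The other
  short root elements are commutators of these by R5, and the long ones are obtained from R8.\<close>

lemma radicals_generate:
  assumes m: "m \<in> \<Omega>" and C: "subgroup C G" "radical m \<subseteq> C" "radical (- m) \<subseteq> C"
  shows "i \<in> \<Omega> \<Longrightarrow> j \<in> \<Omega> \<Longrightarrow> plane i \<noteq> plane j \<Longrightarrow> x2 i j a \<in> C" and "i \<in> \<Omega> \<Longrightarrow> \<xi> \<in> L \<Longrightarrow> x1 i \<xi> \<in> C"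
proof -
  interpret C: subgroup C G by (rule C)
  have comm: "commutator G x y \<in> C" if "x \<in> C" "y \<in> C" for x y
    using that by (simp add: commutator_def C.m_closed C.m_inv_closed)
  have row: "x2 k j a \<in> C" "x2 j k a \<in> C" if "plane k = plane m" "j \<in> \<Omega>" "plane m \<noteq> plane j" for k j a
  proof -
    have "k = m \<or> k = - m" using that(1) by (simp add: plane_eq_iff)
    moreover have "x2 m j a \<in> C" "x2 (-m) j a \<in> C" "x2 j (-m) a \<in> C" "x2 j m a \<in> C"
      using that m C x2_in_radical[of j m a] x2_in_radical[of j "-m" a] x2_in_radical_neg[of m j a]
        x2_in_radical_neg[of "-m" j a] by auto
    ultimately show "x2 k j a \<in> C" "x2 j k a \<in> C" by auto
  qed
  show "x2 i j a \<in> C" if ij: "i \<in> \<Omega>" "j \<in> \<Omega>" "plane i \<noteq> plane j"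
  proof -
    consider "plane i = plane m" | "plane j = plane m" | "plane i \<noteq> plane m" "plane j \<noteq> plane m" by blast
    then show ?thesis
    proof cases
      case 1
      then show ?thesis using ij row(1)[of i j] by simp
    next
      case 2
      then show ?thesis using ij row(2)[of j i] by simp
    next
      case 3
      then show ?thesis using comm[of "x2 i m a" "x2 m j 1"] row(2)[of m i] row(1)[of m j] ij m by (simp add: x2_x2)
    qed
  qed
  show "x1 i \<xi> \<in> C" if i: "i \<in> \<Omega>" "\<xi> \<in> L"
  proof (cases "plane i = plane m")
    case True
    then have "i = m \<or> i = - m" by (simp add: plane_eq_iff)
    then show ?thesis using C x1_in_radical[OF i(2), of m] x1_in_radical[OF i(2), of "- m"] by blast
  next
    case False
    let ?s = "x2 m (-i) (eps m * snd (flip \<xi>))" and ?c = "commutator G (x1 m (flip \<xi>)) (x2 (-m) (-i) 1)"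
    have "?c = ?s \<otimes> x1 i \<xi>" using m i False x1_x2[of m "-i" "flip \<xi>" 1] by (simp add: flip_in)
    then have "x1 i \<xi> = inv ?s \<otimes> ?c" using m i False by simp
    moreover have "?s \<in> C" using row(1)[of m "-i"] i False by simp
    moreover have "x1 m (flip \<xi>) \<in> C" using x1_in_radical[of "flip \<xi>" m] C i flip_in by blast
    moreover have "x2 (-m) (-i) 1 \<in> C" using row(1)[of "-m" "-i"] i False by simp
    ultimately show ?thesis using comm C.m_closed C.m_inv_closed by metis
  qed
qed

text \<open>The commutator of \<open>g\<close> with an element of a radical lies in that radical and maps to \<open>1\<close>, so it is
  trivial.\<close>

lemma central_if_normalizes:
  assumes m: "m \<in> \<Omega>" and \<pi>: "group_hom G E \<pi>"
    and inj: "\<And>k u. k \<in> {m, - m} \<Longrightarrow> u \<in> radical k \<Longrightarrow> \<pi> u = \<one>\<^bsub>E\<^esub> \<Longrightarrow> u = \<one>"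
    and norm: "normalizes m g" "normalizes (- m) g" and g: "\<pi> g = \<one>\<^bsub>E\<^esub>"
    and gens: "\<And>C. subgroup C G \<Longrightarrow> (\<And>i j a. i \<in> \<Omega> \<Longrightarrow> j \<in> \<Omega> \<Longrightarrow> plane i \<noteq> plane j \<Longrightarrow> x2 i j a \<in> C) \<Longrightarrow>
      (\<And>i \<xi>. i \<in> \<Omega> \<Longrightarrow> \<xi> \<in> L \<Longrightarrow> x1 i \<xi> \<in> C) \<Longrightarrow> carrier G \<subseteq> C"
  shows "g \<in> center G"
proof -
  interpret \<pi>: group_hom G E \<pi> by (rule \<pi>)
  have g_in: "g \<in> carrier G" using norm by (simp add: normalizes_def)
  define C where "C = {x \<in> carrier G. g \<otimes> x = x \<otimes> g}"
  have C: "subgroup C G"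
  proof (rule subgroupI)
    show "C \<noteq> {}" using g_in by (auto simp: C_def)
    fix x assume x: "x \<in> C"
    then have x': "x \<in> carrier G" "g \<otimes> x = x \<otimes> g" by (auto simp: C_def)
    have "inv x \<otimes> (g \<otimes> x) \<otimes> inv x = inv x \<otimes> (x \<otimes> g) \<otimes> inv x" using x' by simp
    then show "inv x \<in> C" using x'(1) g_in by (simp add: C_def m_assoc)
    fix y assume "y \<in> C"
    then show "x \<otimes> y \<in> C" using x' g_in by (simp add: C_def commute_mult)
  qed (auto simp: C_def)
  have rad: "radical k \<subseteq> C" if k: "k \<in> {m, - m}" for k
  proof
    fix u assume u: "u \<in> radical k"
    have "k \<in> \<Omega>" using k m by auto
    then interpret R: subgroup "radical k" G by (rule subgroup_radical)
    have u_in: "u \<in> carrier G" using u by simp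
    have "normalizes k g" using k norm by auto
    then have "commutator G g u \<in> radical k"
      using u by (simp add: commutator_def normalizes_def R.m_inv_closed R.m_closed)
    moreover have "\<pi> (commutator G g u) = \<one>\<^bsub>E\<^esub>"
      using g_in u_in g by (simp add: commutator_def)
    ultimately have "commutator G g u = \<one>" using inj k by blast
    then show "u \<in> C" using g_in u_in by (simp add: C_def commutator_eq_one_iff)
  qed
  have "carrier G \<subseteq> C" using radicals_generate[OF m C rad rad] by (intro gens C) simp_all
  then show ?thesis using g_in by (auto simp: C_def center_def)
qed

end

context odd_quadratic_space
begin

lemma X2_in_gens: "X2 i j a \<in> steinberg_gens n \<longleftrightarrow> i \<in> Omega n \<and> j \<in> Omega n \<and> plane i \<noteq> plane j"
  and X1_in_gens: "X1 i \<xi> \<in> steinberg_gens n \<longleftrightarrow> i \<in> Omega n \<and> \<xi> \<in> L"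
  by (simp_all add: steinberg_gens_eq X2_in_root_gens X1_in_root_gens)

abbreviation stu_x2 :: "nat \<Rightarrow> int \<Rightarrow> int \<Rightarrow> 'r \<Rightarrow> ('r, 'v) stu_elem"
  where "stu_x2 n i j a \<equiv> stu_gen n (X2 i j a)"

abbreviation stu_x1 :: "nat \<Rightarrow> int \<Rightarrow> 'v \<times> 'r \<Rightarrow> ('r, 'v) stu_elem"
  where "stu_x1 n i \<xi> \<equiv> stu_gen n (X1 i \<xi>)"

lemma StU_family: "steinberg_family bar act B L (StU n) (Omega n) (stu_x2 n) (stu_x1 n)"
  using steinberg_family_gens[of "Omega n" "StU n" "stu_gen n"] stu_gen_satisfies[of n] group_StU[of n]
  by (simp add: steinberg_gens_eq)

lemma proj_x2: "i \<in> Omega n \<Longrightarrow> j \<in> Omega n \<Longrightarrow> plane i \<noteq> plane j \<Longrightarrow> proj n (stu_x2 n i j a) = restrict (t2 i j a) (hyp_space n)"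
  by (simp add: proj_gen X2_in_gens T2_eq_t2)

lemma proj_x1: "i \<in> Omega n \<Longrightarrow> \<xi> \<in> L \<Longrightarrow> proj n (stu_x1 n i \<xi>) = restrict (t1 i \<xi>) (hyp_space n)"
  by (simp add: proj_gen X1_in_gens T1_eq_t1)

lemma t2_foldr:
  assumes "m \<noteq> 0" "fst w (- m) = 0" "\<forall>j\<in>set js. plane m \<noteq> plane j"
  shows "fst (foldr (\<lambda>j. t2 m j (c j)) js w) l = fst w l + (if l = m then \<Sum>j\<leftarrow>js. c j * fst w j else 0)"
  using assms(3)
proof (induction js arbitrary: l)
  case (Cons j js)
  then show ?case using assms(1,2) plane_neD[of m j] by (simp add: t_apply add.commute add.left_commute)
qed simp

text \<open>The parameters of the normal form can be read off from the action: the coordinate with index \<open>m\<close> of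
  the image of \<open>e\<^sub>j\<close> is the coefficient \<open>c j\<close>, and when these vanish the image of \<open>e\<^sub>-\<^sub>m\<close> determines \<open>\<xi>\<close>.\<close>

lemma proj_injective_on_radical:
  assumes m: "m \<in> Omega n"
    and u: "u \<in> steinberg_family.radical L (StU n) (Omega n) (stu_x2 n) (stu_x1 n) m"
    and proj_u: "proj n u = \<one>\<^bsub>EU n\<^esub>"
  shows "u = \<one>\<^bsub>StU n\<^esub>"
proof -
  interpret F: steinberg_family bar act B L "StU n" "Omega n" "stu_x2 n" "stu_x1 n" by (rule StU_family)
  interpret P: group_hom "StU n" "EU n" "proj n" by (rule group_hom_proj)
  have "finite {j \<in> Omega n. plane m \<noteq> plane j}" by simp
  then obtain js where js: "distinct js" "set js = {j \<in> Omega n. plane m \<noteq> plane j}"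
    using finite_distinct_list by metis
  obtain c \<xi> where \<xi>: "\<xi> \<in> L" and u_eq: "u = F.short_prod m c js \<otimes>\<^bsub>StU n\<^esub> stu_x1 n m \<xi>"
    using F.radical_normal_form[OF m js u] by blast
  let ?S = "hyp_space n"
  have m0: "m \<noteq> 0" using m by (rule Omega_nonzero)
  have proj_eq: "proj n (F.short_prod m c ks \<otimes>\<^bsub>StU n\<^esub> stu_x1 n m \<xi>)
      = restrict (\<lambda>w. foldr (\<lambda>j. t2 m j (c j)) ks (t1 m \<xi> w)) ?S"
    if "\<forall>j\<in>set ks. j \<in> Omega n \<and> plane m \<noteq> plane j" for ks
    using that
  proof (induction ks)
    case Nil
    then show ?case using m \<xi> by (simp add: proj_x1)
  next
    case (Cons j ks)
    then have j: "j \<in> Omega n" "plane m \<noteq> plane j" and ks: "\<forall>j\<in>set ks. j \<in> Omega n \<and> plane m \<noteq> plane j" by simp_all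
    let ?v = "F.short_prod m c ks \<otimes>\<^bsub>StU n\<^esub> stu_x1 n m \<xi>"
    have v: "?v \<in> carrier (StU n)" using F.short_prod_closed[OF m ks] m \<xi> by simp
    have x: "stu_x2 n m j (c j) \<in> carrier (StU n)" using m j by simp
    have "F.short_prod m c (j # ks) \<otimes>\<^bsub>StU n\<^esub> stu_x1 n m \<xi> = stu_x2 n m j (c j) \<otimes>\<^bsub>StU n\<^esub> ?v"
      using F.short_prod_closed[OF m ks, of c] x m \<xi> by (simp add: F.m_assoc)
    then have "proj n (F.short_prod m c (j # ks) \<otimes>\<^bsub>StU n\<^esub> stu_x1 n m \<xi>) = proj n (stu_x2 n m j (c j)) \<otimes>\<^bsub>EU n\<^esub> proj n ?v"
      using P.hom_mult[OF x v] by (simp only:)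
    also have "\<dots> = restrict (t2 m j (c j)) ?S \<otimes>\<^bsub>EU n\<^esub> restrict (\<lambda>w. foldr (\<lambda>j. t2 m j (c j)) ks (t1 m \<xi> w)) ?S"
      by (simp only: Cons.IH[OF ks] proj_x2[OF m j])
    also have "\<dots> = restrict (\<lambda>w. t2 m j (c j) (foldr (\<lambda>j. t2 m j (c j)) ks (t1 m \<xi> w))) ?S"
      using P.hom_closed[OF x] P.hom_closed[OF v] unfolding Cons.IH[OF ks] proj_x2[OF m j]
      by (rule EU_mult_restrict)
    finally show ?case by simp
  qed
  have js': "\<forall>j\<in>set js. j \<in> Omega n \<and> plane m \<noteq> plane j" using js by simp
  have id: "foldr (\<lambda>j. t2 m j (c j)) js (t1 m \<xi> w) = w" if "w \<in> ?S" for w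
    using fun_cong[OF proj_u[unfolded u_eq proj_eq[OF js'] one_EU], of w] that by simp
  have c0: "c j = 0" if j: "j \<in> set js" for j
  proof -
    let ?w = "basis_vec j :: ('r, 'v) hyp_vec"
    have j': "j \<in> Omega n" "plane m \<noteq> plane j" using j js by auto
    note ne = plane_neD[OF j'(2)]
    have w: "?w \<in> ?S" using j' by (auto simp: basis_vec_def hyp_space_def)
    have "t1 m \<xi> ?w = ?w"
      using ne by (intro hyp_vec_eqI) (simp_all add: t_apply basis_vec_def)
    then have "fst ?w m = fst (foldr (\<lambda>j. t2 m j (c j)) js ?w) m" using id[OF w] by simp
    also have "\<dots> = (\<Sum>i\<leftarrow>js. c i * fst ?w i)"
      using ne js' m0 by (subst t2_foldr) (auto simp: basis_vec_def)
    also have "\<dots> = (\<Sum>i\<leftarrow>js. if i = j then c j else 0)"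
      by (intro arg_cong[where f = sum_list] map_cong) (auto simp: basis_vec_def)
    also have "\<dots> = c j" using js(1) j by (simp add: sum_list_distinct_conv_sum_set)
    finally show ?thesis using ne by (simp add: basis_vec_def)
  qed
  have "F.short_prod m c ks = \<one>\<^bsub>StU n\<^esub>" if "set ks \<subseteq> set js" for ks
    using that by (induction ks) (simp_all add: c0 js' F.x2_zero m)
  then have u_x1: "u = stu_x1 n m \<xi>" using u_eq m \<xi> by simp
  have id1: "t1 m \<xi> w = w" if "w \<in> ?S" for w
    using fun_cong[OF proj_u[unfolded u_x1 proj_x1[OF m \<xi>] one_EU], of w] that by simp
  let ?w = "basis_vec (- m) :: ('r, 'v) hyp_vec"
  have w: "?w \<in> ?S" using m by (auto simp: basis_vec_def hyp_space_def)
  have "snd (t1 m \<xi> ?w) = snd ?w" "fst (t1 m \<xi> ?w) m = fst ?w m" using id1[OF w] by simp_all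
  then have "fst \<xi> = 0" "eps m * snd \<xi> = 0" using m0 by (simp_all add: t_apply basis_vec_def act_one)
  moreover have "snd \<xi> = 0"
  proof (cases "m > 0")
    case True
    then have "lam * (mu * snd \<xi>) = 0" using \<open>eps m * snd \<xi> = 0\<close> by (simp only: eps_def if_True mult_zero_right)
    then show ?thesis by simp
  qed (use \<open>eps m * snd \<xi> = 0\<close> in \<open>simp add: eps_def\<close>)
  ultimately have "\<xi> = (0, 0)" by (simp add: prod_eq_iff)
  then show ?thesis using u_x1 F.x1_zero[OF m] by simp
qed

subsection \<open>Stabilization\<close>

lemma Omega_mono: "m \<le> n \<Longrightarrow> Omega m \<subseteq> Omega n"
  by (auto simp: Omega_def)

lemma root_gens_mono: "\<Omega> \<subseteq> \<Omega>' \<Longrightarrow> root_gens L \<Omega> \<subseteq> root_gens L \<Omega>'"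
  by (auto simp: root_gens_def)

lemma steinberg_gens_mono: "m \<le> n \<Longrightarrow> steinberg_gens m \<subseteq> steinberg_gens n"
  by (simp add: steinberg_gens_eq Omega_mono root_gens_mono)

lemma stu_stab_hom: "stu_stab n \<in> hom (StU n) (StU (Suc n))"
  and stu_stab_gen: "g \<in> steinberg_gens n \<Longrightarrow> stu_stab n (stu_gen n g) = stu_gen (Suc n) g"
  unfolding stu_stab_def
  using StU_lift[OF group_StU satisfies_mono[OF steinberg_gens_mono stu_gen_satisfies[of "Suc n"]], of n] by simp_all

text \<open>The map \<open>eu_stab n g\<close> before its restriction to the space of rank \<open>n + 1\<close>.\<close>

definition stab_raw :: "nat \<Rightarrow> ('r, 'v) eu_elem \<Rightarrow> ('r, 'v) hyp_vec \<Rightarrow> ('r, 'v) hyp_vec"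
  where "stab_raw n g w = g (hyp_trunc n w) + (w - hyp_trunc n w)"

lemma eu_stab_eq: "eu_stab n g = restrict (stab_raw n g) (hyp_space (Suc n))"
  by (simp add: eu_stab_def stab_raw_def[abs_def])

lemma hyp_trunc_in: "hyp_trunc n w \<in> hyp_space n"
  by (simp add: hyp_trunc_def hyp_space_def)

lemma hyp_trunc_stab_raw:
  assumes "g (hyp_trunc n w) \<in> hyp_space n"
  shows "hyp_trunc n (stab_raw n g w) = g (hyp_trunc n w)"
  using assms by (intro hyp_vec_eqI) (auto simp: hyp_trunc_def stab_raw_def hyp_space_def)

lemma stab_raw_in:
  assumes "g (hyp_trunc n w) \<in> hyp_space n" "w \<in> hyp_space (Suc n)"
  shows "stab_raw n g w \<in> hyp_space (Suc n)"
  using assms Omega_mono[of n "Suc n"] by (auto simp: stab_raw_def hyp_space_def hyp_trunc_def)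

lemma stab_raw_comp:
  assumes "h (hyp_trunc n w) \<in> hyp_space n"
  shows "stab_raw n g (stab_raw n h w) = stab_raw n (\<lambda>w. g (h w)) w"
  using hyp_trunc_stab_raw[of h n w, OF assms] by (simp add: stab_raw_def)

lemma Bij_in: "g \<in> Bij (S :: 'x set) \<Longrightarrow> w \<in> S \<Longrightarrow> g w \<in> S"
  by (auto simp: Bij_def bij_betw_def)

lemma eu_stab_Bij:
  fixes g :: "('r, 'v) eu_elem"
  assumes g: "g \<in> Bij (hyp_space n)"
  shows "eu_stab n g \<in> Bij (hyp_space (Suc n))"
proof -
  let ?S = "hyp_space n :: ('r, 'v) hyp_vec set" and ?h = "\<lambda>w. inv_into (hyp_space n) g w :: ('r, 'v) hyp_vec"
  have bij: "bij_betw g ?S ?S" using g by (simp add: Bij_def)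
  have h: "?h w \<in> ?S" "g (?h w) = w" "?h (g w) = w" if "w \<in> ?S" for w
    using bij that by (auto simp: bij_betw_def inv_into_into f_inv_into_f)
  have raw_id: "stab_raw n f w = w" if "f (hyp_trunc n w) = hyp_trunc n w" for f w
    using that by (simp add: stab_raw_def)
  show ?thesis unfolding eu_stab_eq
  proof (rule restrict_in_Bij[where F' = "stab_raw n ?h"])
    fix w :: "('r, 'v) hyp_vec" assume w: "w \<in> hyp_space (Suc n)"
    have g_in: "g (hyp_trunc n w) \<in> ?S" using Bij_in[OF g hyp_trunc_in] .
    have h_in: "?h (hyp_trunc n w) \<in> ?S" using h(1)[OF hyp_trunc_in] .
    show "stab_raw n g w \<in> hyp_space (Suc n)" "stab_raw n ?h w \<in> hyp_space (Suc n)"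
      using stab_raw_in[of g n w, OF g_in w] stab_raw_in[of ?h n w, OF h_in w] .
    show "stab_raw n g (stab_raw n ?h w) = w" "stab_raw n ?h (stab_raw n g w) = w"
      using stab_raw_comp[of ?h n w g, OF h_in] stab_raw_comp[of g n w ?h, OF g_in]
      by (simp_all add: raw_id h hyp_trunc_in)
  qed
qed

lemma eu_stab_Bij_hom: "eu_stab n \<in> hom (BijGroup (hyp_space n :: ('r, 'v) hyp_vec set)) (BijGroup (hyp_space (Suc n)))"
proof (rule homI)
  fix g h :: "('r, 'v) eu_elem"
  assume "g \<in> carrier (BijGroup (hyp_space n))" "h \<in> carrier (BijGroup (hyp_space n))"
  then have g: "g \<in> Bij (hyp_space n)" and h: "h \<in> Bij (hyp_space n)" by (simp_all add: BijGroup_def)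
  have "eu_stab n g \<otimes>\<^bsub>BijGroup (hyp_space (Suc n))\<^esub> eu_stab n h
      = restrict (\<lambda>w. stab_raw n g (stab_raw n h w)) (hyp_space (Suc n))"
    using eu_stab_Bij[OF g] eu_stab_Bij[OF h] unfolding eu_stab_eq by (rule BijGroup_mult_restrict)
  also have "\<dots> = restrict (stab_raw n (\<lambda>w. g (h w))) (hyp_space (Suc n))"
    using stab_raw_comp[of h n, OF Bij_in[OF h hyp_trunc_in]] by simp
  also have "\<dots> = eu_stab n (g \<otimes>\<^bsub>BijGroup (hyp_space n)\<^esub> h)"
    using g h by (auto simp: eu_stab_eq BijGroup_def compose_def stab_raw_def hyp_trunc_in)
  finally show "eu_stab n (g \<otimes>\<^bsub>BijGroup (hyp_space n)\<^esub> h)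
      = eu_stab n g \<otimes>\<^bsub>BijGroup (hyp_space (Suc n))\<^esub> eu_stab n h" by simp
qed (simp add: BijGroup_def eu_stab_Bij)

lemma eu_stab_gen:
  assumes "g \<in> steinberg_gens n"
  shows "eu_stab n (gen_T n g) = gen_T (Suc n) g"
proof (cases g)
  case (X2 i j a)
  then have ij: "i \<in> Omega n" "j \<in> Omega n" using assms by (simp_all add: X2_in_gens)
  then have ij': "i \<in> Omega (Suc n)" "j \<in> Omega (Suc n)" using Omega_mono[of n "Suc n"] by auto
  have "stab_raw n (restrict (t2 i j a) (hyp_space n)) = t2 i j a"
    using ij by (intro ext[of "stab_raw n _"] hyp_vec_eqI) (auto simp: stab_raw_def hyp_trunc_in t_apply, auto simp: hyp_trunc_def)
  then show ?thesis using X2 ij ij' by (simp add: T2_eq_t2 eu_stab_eq)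
next
  case (X1 i \<xi>)
  then have i: "i \<in> Omega n" using assms by (simp_all add: X1_in_gens)
  then have i': "i \<in> Omega (Suc n)" using Omega_mono[of n "Suc n"] by auto
  have "stab_raw n (restrict (t1 i \<xi>) (hyp_space n)) = t1 i \<xi>"
    using i by (intro ext[of "stab_raw n _"] hyp_vec_eqI) (auto simp: stab_raw_def hyp_trunc_in t_apply, auto simp: hyp_trunc_def)
  then show ?thesis using X1 i i' by (simp add: T1_eq_t1 eu_stab_eq)
qed

lemma eu_stab_hom: "eu_stab n \<in> hom (EU n) (EU (Suc n))"
proof -
  interpret S: group_hom "BijGroup (hyp_space n :: ('r, 'v) hyp_vec set)" "BijGroup (hyp_space (Suc n))" "eu_stab n"
    by (simp add: group_hom_def group_hom_axioms_def group_BijGroup eu_stab_Bij_hom)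
  have "eu_stab n ` carrier (EU n) = generate (BijGroup (hyp_space (Suc n))) (eu_stab n ` gen_T n ` steinberg_gens n)"
    unfolding carrier_EU by (rule S.generate_img[symmetric]) (use gen_T_in_Bij in blast)
  also have "eu_stab n ` gen_T n ` steinberg_gens n = gen_T (Suc n) ` steinberg_gens n"
    by (simp add: image_image eu_stab_gen)
  also have "generate (BijGroup (hyp_space (Suc n))) (gen_T (Suc n) ` steinberg_gens n) \<subseteq> carrier (EU (Suc n))"
    unfolding carrier_EU using steinberg_gens_mono[of n "Suc n"]
    by (intro group.mono_generate[OF group_BijGroup]) auto
  finally have "eu_stab n ` carrier (EU n) \<subseteq> carrier (EU (Suc n))" .
  moreover have "carrier (EU n) \<subseteq> carrier (BijGroup (hyp_space n))"
    using carrier_EU_Bij by (simp add: BijGroup_def)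
  ultimately show ?thesis by (intro homI) (simp_all add: mult_EU S.hom_mult subset_iff image_subset_iff)
qed

lemma proj_stu_stab:
  assumes "x \<in> carrier (StU n)"
  shows "proj (Suc n) (stu_stab n x) = eu_stab n (proj n x)"
proof -
  have "group_hom (StU n) (EU (Suc n)) (proj (Suc n) \<circ> stu_stab n)"
    "group_hom (StU n) (EU (Suc n)) (eu_stab n \<circ> proj n)"
    using hom_compose[OF stu_stab_hom proj_hom] hom_compose[OF proj_hom eu_stab_hom]
    by (simp_all add: group_hom_def group_hom_axioms_def group_StU group_EU)
  moreover have "stu_gen n ` steinberg_gens n \<subseteq> carrier (StU n)" using stu_gen_closed by blast
  ultimately have "(proj (Suc n) \<circ> stu_stab n) x = (eu_stab n \<circ> proj n) x"
    by (rule hom_eq_on_generate)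
      (use assms steinberg_gens_mono[of n "Suc n"] in
        \<open>auto simp: StU_generated stu_stab_gen proj_gen eu_stab_gen subset_iff\<close>)
  then show ?thesis by simp
qed

text \<open>All elements that come from rank \<open>n\<close> normalize the two radicals attached to the new hyperbolic plane of
  rank \<open>n + 1\<close>, because their generators do not involve this plane.\<close>

lemma stab_K2U_central:
  assumes x: "x \<in> K2U n"
  shows "stu_stab n x \<in> center (StU (Suc n))"
proof -
  let ?n = "Suc n"
  interpret F: steinberg_family bar act B L "StU ?n" "Omega ?n" "stu_x2 ?n" "stu_x1 ?n" by (rule StU_family)
  interpret S: group_hom "StU n" "StU ?n" "stu_stab n"
    by (simp add: group_hom_def group_hom_axioms_def group_StU stu_stab_hom)
  interpret E: group_hom "EU n" "EU ?n" "eu_stab n"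
    by (simp add: group_hom_def group_hom_axioms_def group_EU eu_stab_hom)
  have x_in: "x \<in> carrier (StU n)" and proj_x: "proj n x = \<one>\<^bsub>EU n\<^esub>" using x by (auto simp: K2U_def kernel_def)
  define m where "m = int ?n"
  have m: "m \<in> Omega ?n" by (simp add: m_def Omega_def)
  have stab_x: "stu_stab n x \<in> generate (StU ?n) (F.levi_gens k)" if k: "k \<in> {m, - m}" for k
  proof -
    have "stu_stab n x \<in> stu_stab n ` generate (StU n) (stu_gen n ` steinberg_gens n)"
      using x_in by (simp add: StU_generated)
    also have "\<dots> = generate (StU ?n) (stu_stab n ` stu_gen n ` steinberg_gens n)"
      by (rule S.generate_img[symmetric]) (use stu_gen_closed in blast)
    also have "stu_stab n ` stu_gen n ` steinberg_gens n = stu_gen ?n ` steinberg_gens n"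
      by (simp add: image_image stu_stab_gen)
    also have "generate (StU ?n) \<dots> \<subseteq> generate (StU ?n) (F.levi_gens k)"
    proof (rule F.mono_generate, rule image_subsetI)
      fix g assume g: "g \<in> steinberg_gens n"
      have new: "i \<in> Omega ?n \<and> plane k \<noteq> plane i" if "i \<in> Omega n" for i
        using that k by (auto simp: m_def Omega_def plane_def)
      show "stu_gen ?n g \<in> F.levi_gens k"
      proof (cases g)
        case (X2 i j a)
        then show ?thesis using g new unfolding F.levi_gens_def by (auto simp: X2_in_gens)
      next
        case (X1 i \<xi>)
        then have "i \<in> Omega ?n" "plane k \<noteq> plane i" "\<xi> \<in> L" using g new by (simp_all add: X1_in_gens)
        then show ?thesis unfolding F.levi_gens_def X1 by blast
      qed
    qed
    finally show ?thesis .
  qed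
  show ?thesis
  proof (rule F.central_if_normalizes[OF m group_hom_proj])
    show "u = \<one>\<^bsub>StU ?n\<^esub>" if "k \<in> {m, - m}" "u \<in> F.radical k" "proj ?n u = \<one>\<^bsub>EU ?n\<^esub>" for k u
      using that m by (intro proj_injective_on_radical[of k]) auto
    show "F.normalizes m (stu_stab n x)" "F.normalizes (- m) (stu_stab n x)"
      using m stab_x by (auto intro!: F.levi_generated_normalizes)
    show "proj ?n (stu_stab n x) = \<one>\<^bsub>EU ?n\<^esub>" using x_in proj_x by (simp add: proj_stu_stab)
    fix C assume C: "subgroup C (StU ?n)"
      and x2: "\<And>i j a. i \<in> Omega ?n \<Longrightarrow> j \<in> Omega ?n \<Longrightarrow> plane i \<noteq> plane j \<Longrightarrow> stu_x2 ?n i j a \<in> C"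
      and x1: "\<And>i \<xi>. i \<in> Omega ?n \<Longrightarrow> \<xi> \<in> L \<Longrightarrow> stu_x1 ?n i \<xi> \<in> C"
    have "stu_gen ?n g \<in> C" if "g \<in> steinberg_gens ?n" for g
      using that x1 x2 by (cases g) (simp_all add: X2_in_gens X1_in_gens)
    then have "stu_gen ?n ` steinberg_gens ?n \<subseteq> C" by blast
    from F.generate_subgroup_incl[OF this C] show "carrier (StU ?n) \<subseteq> C" by (simp only: StU_generated)
  qed
qed

lemma StU_schur_multiplier:
  assumes "5 \<le> n" "K2U n \<subseteq> center (StU n)"
  shows "schur_multiplier TYPE('h) TYPE('u) (K2U n) (StU n) (EU n) (proj n)"
  using StU_universal[OF assms] StU_universal[OF assms] StU_universal[OF assms]
  by (rule schur_multiplier_kernel) (simp add: K2U_def)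

lemma K2U_central_if_surjective:
  assumes "n > 0" "stu_stab (n - 1) ` K2U (n - 1) = K2U n"
  shows "K2U n \<subseteq> center (StU n)"
proof
  fix x assume "x \<in> K2U n"
  then obtain y where "y \<in> K2U (n - 1)" "x = stu_stab (n - 1) y" using assms(2) by blast
  then show "x \<in> center (StU n)" using stab_K2U_central[of y "n - 1"] assms(1) by simp
qed

section \<open>The stable groups\<close>

sublocale stu: group_sequence "\<lambda>k. StU (k + 3)" "\<lambda>k. stu_stab (k + 3)"
proof (rule group_sequence.intro)
  show "stu_stab (k + 3) \<in> hom (StU (k + 3)) (StU (Suc k + 3))" for k
    using stu_stab_hom[of "k + 3"] by (simp only: add_Suc)
qed (rule group_StU)

sublocale eu: group_sequence "\<lambda>k. EU (k + 3)" "\<lambda>k. eu_stab (k + 3)"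
proof (rule group_sequence.intro)
  show "eu_stab (k + 3) \<in> hom (EU (k + 3)) (EU (Suc k + 3))" for k
    using eu_stab_hom[of "k + 3"] by (simp only: add_Suc)
qed (rule group_EU)

lemma StU_inf_eq: "StU_inf = stu.lim"
  and EU_inf_eq: "EU_inf = eu.lim"
  by (simp_all add: StU_inf_def EU_inf_def)

lemma proj_stab_shift:
  "x \<in> carrier (StU (k + 3)) \<Longrightarrow> proj (Suc k + 3) (stu_stab (k + 3) x) = eu_stab (k + 3) (proj (k + 3) x)"
  unfolding add_Suc by (rule proj_stu_stab)

lemma proj_inf_in:
  assumes "x \<in> carrier (StU (k + 3))"
  shows "proj_inf (stu.lim_in k x) = eu.lim_in k (proj (k + 3) x)"
  unfolding proj_inf_def
  by (rule direct_limit_map_in[OF stu.group_sequence_axioms eu.group_sequence_axioms])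
    (rule proj_hom, erule proj_stab_shift, rule assms)

lemma proj_inf_hom: "proj_inf \<in> hom StU_inf EU_inf"
  unfolding StU_inf_eq EU_inf_eq
proof (rule homI)
  have proj_in: "proj n x \<in> carrier (EU n)" if "x \<in> carrier (StU n)" for n x
    using hom_in_carrier[OF proj_hom that] .
  fix A assume A: "A \<in> carrier stu.lim"
  then show "proj_inf A \<in> carrier eu.lim"
    by (elim stu.lim_carrierE) (simp add: proj_inf_in eu.lim_in_closed proj_in)
  fix A' assume "A' \<in> carrier stu.lim"
  with A obtain n x y where x: "x \<in> carrier (StU (n + 3))" "y \<in> carrier (StU (n + 3))"
    and eq: "A = stu.lim_in n x" "A' = stu.lim_in n y"
    using stu.lim_common_level[of A A' 0] by metis
  have xy: "x \<otimes>\<^bsub>StU (n + 3)\<^esub> y \<in> carrier (StU (n + 3))"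
    using x group_StU by (simp add: group.is_monoid monoid.m_closed)
  have "proj_inf (A \<otimes>\<^bsub>stu.lim\<^esub> A') = eu.lim_in n (proj (n + 3) (x \<otimes>\<^bsub>StU (n + 3)\<^esub> y))"
    unfolding eq stu.lim_in_mult_same[OF x] using xy by (rule proj_inf_in)
  also have "proj (n + 3) (x \<otimes>\<^bsub>StU (n + 3)\<^esub> y) = proj (n + 3) x \<otimes>\<^bsub>EU (n + 3)\<^esub> proj (n + 3) y"
    using x by (rule hom_mult[OF proj_hom])
  also have "eu.lim_in n \<dots> = proj_inf A \<otimes>\<^bsub>eu.lim\<^esub> proj_inf A'"
    unfolding eq proj_inf_in[OF x(1)] proj_inf_in[OF x(2)]
    by (rule eu.lim_in_mult_same[symmetric]) (use x proj_in in auto)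
  finally show "proj_inf (A \<otimes>\<^bsub>stu.lim\<^esub> A') = proj_inf A \<otimes>\<^bsub>eu.lim\<^esub> proj_inf A'" .
qed

lemma proj_inf_epi: "proj_inf \<in> epi StU_inf EU_inf"
proof -
  have "A \<in> proj_inf ` carrier StU_inf" if A: "A \<in> carrier EU_inf" for A
  proof -
    obtain n y where y: "y \<in> carrier (EU (n + 3))" "A = eu.lim_in n y"
      using A unfolding EU_inf_eq by (rule eu.lim_carrierE)
    then have "y \<in> proj (n + 3) ` carrier (StU (n + 3))" using proj_epi[of "n + 3"] by (simp add: epi_def)
    then obtain x where "x \<in> carrier (StU (n + 3))" "y = proj (n + 3) x" by blast
    then show ?thesis
      using y by (intro image_eqI[of _ _ "stu.lim_in n x"]) (simp_all add: proj_inf_in StU_inf_eq stu.lim_in_closed)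
  qed
  moreover have "proj_inf ` carrier StU_inf \<subseteq> carrier EU_inf"
    using hom_carrier[OF proj_inf_hom] .
  ultimately show ?thesis using proj_inf_hom by (auto simp: epi_def)
qed

lemma proj_trans_to:
  assumes "x \<in> carrier (StU (m + 3))" "m \<le> k"
  shows "proj (k + 3) (stu.trans_to m k x) = eu.trans_to m k (proj (m + 3) x)"
  using assms(2)
proof (induction k rule: dec_induct)
  case (step k)
  have "stu.trans_to m k x \<in> carrier (StU (k + 3))" using step(1) assms(1) by (rule stu.trans_to_closed)
  then show ?case
    using step proj_stab_shift[of "stu.trans_to m k x" k]
    by (simp add: stu.trans_to_Suc_right eu.trans_to_Suc_right)
qed simp

text \<open>Equality in a direct limit is witnessed at some level. At such a level the representative of an
  element of the kernel lies in the kernel of the projection of that level.\<close>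

lemma K2U_inf_kernel: "K2U_inf = kernel StU_inf EU_inf proj_inf"
proof
  show "K2U_inf \<subseteq> kernel StU_inf EU_inf proj_inf"
  proof
    fix A assume "A \<in> K2U_inf"
    then obtain k x where x: "x \<in> K2U (k + 3)" "A = stu.lim_in k x"
      by (auto simp: K2U_inf_def stu.lim_in_def)
    then show "A \<in> kernel StU_inf EU_inf proj_inf"
      by (auto simp: K2U_def kernel_def proj_inf_in StU_inf_eq EU_inf_eq stu.lim_in_closed eu.lim_one[of k])
  qed
  show "kernel StU_inf EU_inf proj_inf \<subseteq> K2U_inf"
  proof
    fix A assume A: "A \<in> kernel StU_inf EU_inf proj_inf"
    then have "A \<in> carrier stu.lim" by (simp add: kernel_def StU_inf_eq)
    then obtain n x where x: "x \<in> carrier (StU (n + 3))" "A = stu.lim_in n x" by (rule stu.lim_carrierE)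
    have one: "\<one>\<^bsub>EU k\<^esub> \<in> carrier (EU k)" for k using group_EU by (simp add: group.is_monoid)
    have px: "proj (n + 3) x \<in> carrier (EU (n + 3))" using hom_in_carrier[OF proj_hom x(1)] .
    have "eu.lim_in n (proj (n + 3) x) = eu.lim_in n \<one>\<^bsub>EU (n + 3)\<^esub>"
      using A x by (simp add: kernel_def EU_inf_eq proj_inf_in eu.lim_one[of n])
    then obtain k where k: "n \<le> k" "eu.trans_to n k (proj (n + 3) x) = eu.trans_to n k \<one>\<^bsub>EU (n + 3)\<^esub>"
      using eu.lim_in_eq_iff[OF px one] by blast
    have "eu.trans_to n k \<one>\<^bsub>EU (n + 3)\<^esub> = \<one>\<^bsub>EU (k + 3)\<^esub>"
      using hom_one[OF eu.trans_to_hom[OF k(1)]] group_EU by simp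
    then have "stu.trans_to n k x \<in> K2U (k + 3)"
      using k x stu.trans_to_closed[OF k(1) x(1)] by (simp add: K2U_def kernel_def proj_trans_to)
    moreover have "A = stu.lim_in k (stu.trans_to n k x)"
      using k x by (simp add: stu.lim_in_trans_to)
    ultimately show "A \<in> K2U_inf" by (auto simp: K2U_inf_def stu.lim_in_def)
  qed
qed

lemma stu_stab_K2U: "x \<in> K2U n \<Longrightarrow> stu_stab n x \<in> K2U (Suc n)"
  using hom_in_carrier[OF stu_stab_hom] hom_one[OF eu_stab_hom group_EU group_EU]
  by (auto simp: K2U_def kernel_def proj_stu_stab)

lemma stab_K2U_shift:
  assumes "x \<in> K2U (k + 3)"
  shows "stu_stab (k + 3) x \<in> K2U (Suc k + 3)" and "stu_stab (k + 3) x \<in> center (StU (Suc k + 3))"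
  unfolding add_Suc using assms by (rule stu_stab_K2U, rule stab_K2U_central)

text \<open>A representative of the kernel is central at the next level, and its image there is again in the
  kernel. It is therefore central at all later levels, where it can be compared with any given element.\<close>

lemma K2U_inf_central: "K2U_inf \<subseteq> center StU_inf"
proof
  fix A assume "A \<in> K2U_inf"
  then obtain k x where x: "x \<in> K2U (k + 3)" and A: "A = stu.lim_in k x"
    by (auto simp: K2U_inf_def stu.lim_in_def)
  have x_in: "x \<in> carrier (StU (k + 3))" using x by (simp add: K2U_def kernel_def)
  have K2U: "stu.trans_to k l x \<in> K2U (l + 3)" if "k \<le> l" for l
    using that
  proof (induction l rule: dec_induct)
    case (step l)
    then show ?case using stab_K2U_shift(1)[OF step(3)] by (simp add: stu.trans_to_Suc_right)
  qed (simp add: x)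
  have central: "stu.trans_to k (Suc l) x \<in> center (StU (Suc l + 3))" if "k \<le> l" for l
    using that stab_K2U_shift(2)[OF K2U[OF that]] by (simp add: stu.trans_to_Suc_right)
  have "A \<otimes>\<^bsub>stu.lim\<^esub> C = C \<otimes>\<^bsub>stu.lim\<^esub> A" if C: "C \<in> carrier stu.lim" for C
  proof -
    obtain n y where y: "y \<in> carrier (StU (n + 3))" "C = stu.lim_in n y" using C by (rule stu.lim_carrierE)
    let ?l = "Suc (max k n)"
    let ?x = "stu.trans_to k ?l x" and ?y = "stu.trans_to n ?l y"
    have x': "?x \<in> carrier (StU (?l + 3))" and y': "?y \<in> carrier (StU (?l + 3))"
      by (rule stu.trans_to_closed; use x_in y in simp)+
    have "?x \<in> center (StU (?l + 3))" by (rule central) simp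
    then have "?x \<otimes>\<^bsub>StU (?l + 3)\<^esub> ?y = ?y \<otimes>\<^bsub>StU (?l + 3)\<^esub> ?x" using y' by (simp only: center_iff)
    moreover have "A = stu.lim_in ?l ?x" "C = stu.lim_in ?l ?y"
      unfolding A y(2) by (rule stu.lim_in_trans_to[symmetric]; use x_in y in simp)+
    ultimately show ?thesis using stu.lim_in_mult_same[OF x' y'] stu.lim_in_mult_same[OF y' x'] by simp
  qed
  then show "A \<in> center StU_inf" using x_in by (simp add: center_iff StU_inf_eq A stu.lim_in_closed)
qed

text \<open>Level \<open>k\<close> of the direct limit has rank \<open>k + 3\<close>, so \<open>g\<close> is a generator at level \<open>gen_level g\<close>, with room to
  spare.\<close>

definition gen_level :: "('r, 'v) steinberg_gen \<Rightarrow> nat"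
  where "gen_level g = (case g of X2 i j a \<Rightarrow> max (plane i) (plane j) | X1 i \<xi> \<Rightarrow> plane i)"

definition stu_inf_gen :: "('r, 'v) steinberg_gen \<Rightarrow> (nat \<times> ('r, 'v) stu_elem) set"
  where "stu_inf_gen g = stu.lim_in (gen_level g) (stu_gen (gen_level g + 3) g)"

lemma in_gens_iff:
  "g \<in> steinberg_gens n \<longleftrightarrow> g \<in> root_gens L (- {0}) \<and> gen_level g \<le> n"
  by (cases g) (auto simp: X2_in_gens X1_in_gens X2_in_root_gens X1_in_root_gens gen_level_def Omega_def plane_def)

lemma stu_inf_gen_eq:
  assumes "g \<in> root_gens L (- {0})" "gen_level g \<le> k"
  shows "stu_inf_gen g = stu.lim_in k (stu_gen (k + 3) g)"
  using assms(2)
proof (induction k rule: dec_induct)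
  case base
  then show ?case by (simp add: stu_inf_gen_def)
next
  case (step k)
  have "g \<in> steinberg_gens (k + 3)" using assms step by (simp add: in_gens_iff)
  then show ?case
    using step stu.lim_in_trans_to[of k "Suc k" "stu_gen (k + 3) g"] stu_stab_gen[of g "k + 3"] stu_gen_closed[of g "k + 3"]
    by (simp add: stu.trans_to_Suc)
qed

text \<open>A relation involves only finitely many generators, so it holds at a finite level.\<close>

lemma word_level:
  assumes "w \<in> lists (letters (root_gens L (- {0})))"
  shows "\<exists>k. w \<in> lists (letters (steinberg_gens k))"
  using assms
proof (induction w)
  case (Cons l w)
  then obtain k where k: "w \<in> lists (letters (steinberg_gens k))" by blast
  from Cons(1) obtain g where g: "g \<in> root_gens L (- {0})" "l = Pos g \<or> l = Neg g"
    by (auto elim!: letters_cases)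
  let ?k = "max k (gen_level g)"
  have "letters (steinberg_gens k) \<subseteq> letters (steinberg_gens ?k)"
    using steinberg_gens_mono[of k ?k] by (auto simp: letters_def)
  then have "w \<in> lists (letters (steinberg_gens ?k))" using k lists_mono by blast
  moreover have "g \<in> steinberg_gens ?k" using g by (simp add: in_gens_iff)
  ultimately show ?case using g(2) by (intro exI[of _ ?k]) auto
qed auto

lemma stu_inf_gen_satisfies: "satisfies (root_gens L (- {0})) steinberg_rel StU_inf stu_inf_gen"
  unfolding satisfies_def
proof (intro conjI ballI impI)
  show "stu_inf_gen ` root_gens L (- {0}) \<subseteq> carrier StU_inf"
  proof (rule image_subsetI)
    fix g assume "g \<in> root_gens L (- {0})"
    then have "g \<in> steinberg_gens (gen_level g + 3)" by (simp add: in_gens_iff)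
    then show "stu_inf_gen g \<in> carrier StU_inf"
      by (simp add: stu_inf_gen_def StU_inf_eq stu.lim_in_closed stu_gen_closed)
  qed
  fix v w assume vw: "v \<in> lists (letters (root_gens L (- {0})))" "w \<in> lists (letters (root_gens L (- {0})))"
    and rel: "steinberg_rel v w"
  obtain k where "v @ w \<in> lists (letters (steinberg_gens k))"
    using word_level[of "v @ w"] vw by auto
  then have k: "v \<in> lists (letters (steinberg_gens k))" "w \<in> lists (letters (steinberg_gens k))" by simp_all
  have sat: "satisfies (steinberg_gens k) steinberg_rel StU_inf (stu.lim_in k \<circ> stu_gen (k + 3))"
    unfolding StU_inf_eq
    by (rule satisfies_hom(1)[OF satisfies_mono[OF steinberg_gens_mono stu_gen_satisfies] stu.lim_in_hom group_StU stu.group_lim])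
      simp
  have gen: "(stu.lim_in k \<circ> stu_gen (k + 3)) g = stu_inf_gen g" if "g \<in> steinberg_gens k" for g
    using that stu_inf_gen_eq[of g k] by (simp add: in_gens_iff)
  have "satisfies (steinberg_gens k) steinberg_rel StU_inf stu_inf_gen"
    using satisfies_cong[OF gen sat] .
  then show "eval_word StU_inf stu_inf_gen v = eval_word StU_inf stu_inf_gen w"
    using k rel unfolding satisfies_def by blast
qed

lemma StU_inf_generated: "generate StU_inf (stu_inf_gen ` root_gens L (- {0})) = carrier StU_inf"
proof
  interpret lim: group StU_inf unfolding StU_inf_eq by (rule stu.group_lim)
  have sub: "stu_inf_gen ` root_gens L (- {0}) \<subseteq> carrier StU_inf"
    using stu_inf_gen_satisfies by (simp add: satisfies_def)
  then show "generate StU_inf (stu_inf_gen ` root_gens L (- {0})) \<subseteq> carrier StU_inf"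
    using lim.generate_in_carrier by blast
  show "carrier StU_inf \<subseteq> generate StU_inf (stu_inf_gen ` root_gens L (- {0}))"
  proof
    fix A assume "A \<in> carrier StU_inf"
    then obtain n x where x: "x \<in> carrier (StU (n + 3))" "A = stu.lim_in n x"
      unfolding StU_inf_eq by (rule stu.lim_carrierE)
    interpret h: group_hom "StU (n + 3)" StU_inf "stu.lim_in n"
      unfolding StU_inf_eq using stu.lim_in_hom[of n] by (simp add: group_hom_def group_hom_axioms_def group_StU stu.group_lim)
    have "A \<in> stu.lim_in n ` generate (StU (n + 3)) (stu_gen (n + 3) ` steinberg_gens (n + 3))"
      using x by (simp add: StU_generated)
    also have "\<dots> = generate StU_inf (stu.lim_in n ` stu_gen (n + 3) ` steinberg_gens (n + 3))"
      by (rule h.generate_img[symmetric]) (use stu_gen_closed in blast)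
    also have "\<dots> \<subseteq> generate StU_inf (stu_inf_gen ` root_gens L (- {0}))"
    proof (rule lim.mono_generate, clarify)
      fix g assume g: "g \<in> steinberg_gens (n + 3)"
      let ?k = "n + 3"
      have "stu.lim_in n (stu_gen (n + 3) g) = stu.lim_in ?k (stu_gen (?k + 3) g)"
      proof -
        have "stu.trans_to n (n + d) (stu_gen (n + 3) g) = stu_gen (n + d + 3) g" for d
        proof (induction d)
          case (Suc d)
          have "g \<in> steinberg_gens (n + d + 3)" using g steinberg_gens_mono[of "n + 3" "n + d + 3"] by auto
          then show ?case using Suc stu.trans_to_Suc_right[of n "n + d"] stu_stab_gen[of g "n + d + 3"] by simp
        qed simp
        then show ?thesis
          using stu.lim_in_trans_to[of n ?k "stu_gen (n + 3) g"] stu_gen_closed[OF g] by simp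
      qed
      also have "\<dots> = stu_inf_gen g" using g stu_inf_gen_eq[of g ?k] by (simp add: in_gens_iff)
      finally show "stu.lim_in n (stu_gen (n + 3) g) \<in> stu_inf_gen ` root_gens L (- {0})"
        using g by (simp add: in_gens_iff)
    qed
    finally show "A \<in> generate StU_inf (stu_inf_gen ` root_gens L (- {0}))" .
  qed
qed

text \<open>At every level the presentation gives the homomorphism prescribed on generators. These homomorphisms
  are compatible with stabilization because they agree on generators.\<close>

lemma StU_inf_lift:
  fixes H :: "'h monoid"
  assumes H: "group H" and Y: "satisfies (root_gens L (- {0})) steinberg_rel H Y"
  shows "\<exists>\<phi>\<in>hom StU_inf H. \<forall>g\<in>root_gens L (- {0}). \<phi> (stu_inf_gen g) = Y g"
proof -
  have sub: "steinberg_gens n \<subseteq> root_gens L (- {0})" for n by (auto simp: in_gens_iff)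
  have Y_n: "satisfies (steinberg_gens n) steinberg_rel H Y" for n
    using satisfies_mono[OF sub Y] .
  define \<phi> where "\<phi> = (presented_lift H Y :: ('r, 'v) stu_elem \<Rightarrow> 'h)"
  have \<phi>_hom: "\<phi> \<in> hom (StU n) H" for n
    unfolding \<phi>_def by (rule StU_lift(1)[OF H Y_n])
  have \<phi>_gen: "\<phi> (stu_gen n g) = Y g" if "g \<in> steinberg_gens n" for n g
    unfolding \<phi>_def by (rule StU_lift(2)[OF H Y_n that])
  have stab: "\<phi> (stu_stab n x) = \<phi> x" if x: "x \<in> carrier (StU n)" for n x
  proof -
    have "group_hom (StU n) H (\<phi> \<circ> stu_stab n)" "group_hom (StU n) H \<phi>"
      using hom_compose[OF stu_stab_hom \<phi>_hom] \<phi>_hom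
      by (simp_all add: group_hom_def group_hom_axioms_def group_StU H)
    moreover have "stu_gen n ` steinberg_gens n \<subseteq> carrier (StU n)" using stu_gen_closed by blast
    ultimately have "(\<phi> \<circ> stu_stab n) x = \<phi> x"
      by (rule hom_eq_on_generate)
        (use x steinberg_gens_mono[of n "Suc n"] in \<open>auto simp: StU_generated stu_stab_gen \<phi>_gen subset_iff\<close>)
    then show ?thesis by simp
  qed
  obtain \<psi> where \<psi>: "\<psi> \<in> hom stu.lim H" "\<And>n x. x \<in> carrier (StU (n + 3)) \<Longrightarrow> \<psi> (stu.lim_in n x) = \<phi> x"
    using stu.lim_lift[of "\<lambda>_. \<phi>" H, OF \<phi>_hom stab] by blast
  have "\<psi> (stu_inf_gen g) = Y g" if "g \<in> root_gens L (- {0})" for g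
  proof -
    have "g \<in> steinberg_gens (gen_level g + 3)" using that by (simp add: in_gens_iff)
    then show ?thesis unfolding stu_inf_gen_def by (simp add: \<psi>(2) stu_gen_closed \<phi>_gen)
  qed
  then show ?thesis using \<psi>(1) by (auto simp: StU_inf_eq)
qed

lemma StU_inf_universal: "universal_central_extension TYPE('h) StU_inf EU_inf proj_inf"
proof (rule steinberg_universal[where \<Omega> = "- {0}" and X = stu_inf_gen])
  show "central_extension StU_inf EU_inf proj_inf"
    using K2U_inf_central proj_inf_epi stu.group_lim eu.group_lim
    by (simp add: central_extension_def K2U_inf_kernel StU_inf_eq EU_inf_eq)
  fix i j h k :: int
  obtain m where "m \<in> Omega 5" "plane m \<noteq> plane i \<and> plane m \<noteq> plane j \<and> plane m \<noteq> plane h \<and> plane m \<noteq> plane k"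
    using Omega_fresh[of 5 i j h k] by auto
  then show "\<exists>m\<in>- {0}. plane m \<noteq> plane i \<and> plane m \<noteq> plane j \<and> plane m \<noteq> plane h \<and> plane m \<noteq> plane k"
    using Omega_nonzero by (intro bexI[of _ m]) auto
qed (use stu_inf_gen_satisfies StU_inf_generated StU_inf_lift in auto)

lemma StU_inf_schur_multiplier: "schur_multiplier TYPE('h) TYPE('u) K2U_inf StU_inf EU_inf proj_inf"
  using StU_inf_universal StU_inf_universal StU_inf_universal
  by (rule schur_multiplier_kernel) (rule K2U_inf_kernel)

end

theorem theorem3:
  fixes bar :: "'r::{ring,monoid_mult} \<Rightarrow> 'r"
    and act :: "'v::ab_group_add \<Rightarrow> 'r \<Rightarrow> 'v"
    and B :: "'v \<Rightarrow> 'v \<Rightarrow> 'r"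
    and L :: "('v \<times> 'r) set"
  assumes "odd_quadratic_space bar act B L"
  shows
    "(\<forall>n\<ge>5.
       (odd_quadratic_space.K2U bar act B L n \<subseteq>
          center (odd_quadratic_space.StU bar act B L n) \<longrightarrow>
        schur_multiplier TYPE('h) TYPE('u)
          (odd_quadratic_space.K2U bar act B L n)
          (odd_quadratic_space.StU bar act B L n)
          (odd_quadratic_space.EU bar act B L n)
          (odd_quadratic_space.proj bar act B L n)) \<and>
       (odd_quadratic_space.stu_stab bar act B L (n - 1) `
          odd_quadratic_space.K2U bar act B L (n - 1) =
          odd_quadratic_space.K2U bar act B L n \<longrightarrow>
        odd_quadratic_space.K2U bar act B L n \<subseteq>
          center (odd_quadratic_space.StU bar act B L n))) \<and>
     (odd_quadratic_space.K2U_inf bar act B L \<subseteq>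
        center (odd_quadratic_space.StU_inf bar act B L) \<longrightarrow>
      schur_multiplier TYPE('h) TYPE('u)
        (odd_quadratic_space.K2U_inf bar act B L)
        (odd_quadratic_space.StU_inf bar act B L)
        (odd_quadratic_space.EU_inf bar act B L)
        (odd_quadratic_space.proj_inf bar act B L)) \<and>
     odd_quadratic_space.K2U_inf bar act B L \<subseteq>
       center (odd_quadratic_space.StU_inf bar act B L)"
proof -
  interpret odd_quadratic_space bar act B L by fact
  show ?thesis
    using StU_schur_multiplier K2U_central_if_surjective StU_inf_schur_multiplier K2U_inf_central by auto
qed

end
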